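(* Let $\overline{B}=(B_0,B_1)$ be an interpolation couple of complex Banach spaces and let $\theta\in(0,1)$. If the dual norm on $B_0^*$ is rotund, then the dual norm on $B_\theta^*$ (the dual of the complex interpolation space $B_\theta=(B_0,B_1)_\theta$) is rotund.
   Context: An interpolation couple $(B_0,B_1)$ is a pair of complex Banach spaces continuously embedded in a common Hausdorff topological vector space; $B_0+B_1$ carries the norm $\|a\|_{B_0+B_1}=\inf\{\|a_0\|_{B_0}+\|a_1\|_{B_1}: a=a_0+a_1,\ a_j\in B_j\}$. Complex interpolation space: let $S_0=\{z\in\mathbb{C}: 0<\operatorname{Re} z<1\}$ and $S=\overline{S_0}$. Let $\mathcal{F}(\overline{B})$ be the space of functions $F:S\to B_0+B_1$ that are bounded and continuous on $S$, holomorphic on $S_0$, and such that for $j\in\{0,1\}$ the map $\tau\mapsto F(j+i\tau)$ lies in $C_0(\mathbb{R},B_j)$ (continuous, vanishing at infinity), with norm $\|F\|_{\mathcal{F}(\overline{B})}=\max_{j\in\{0,1\}}\sup_{\tau\in\mathbb{R}}\|F(j+i\tau)\|_{B_j}$. For $0<\theta<1$, $B_\theta=\{F(\theta): F\in\mathcal{F}(\overline{B})\}$ with norm $\|a\|_{B_\theta}=\inf\{\|F\|_{\mathcal{F}(\overline{B})}: F(\theta)=a\}$. A norm $\|\cdot\|$ on a Banach space $X$ is rotund if $\|\frac{x+y}{2}\|<1$ whenever $\|x\|=\|y\|=1$ and $x\neq y$. *)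

theory Defs
  imports "HOL-Analysis.Analysis" "HOL-Library.Function_Algebras"
begin

text \<open>
  HOL-Analysis has no class of complex normed spaces, and the spaces \<open>B\<^sub>0\<close>, \<open>B\<^sub>1\<close>, \<open>B\<^sub>0 + B\<^sub>1\<close> and
  \<open>B\<^sub>\<theta>\<close> all live inside one ambient space. A complex normed space is therefore represented by a
  set of points of an ambient abelian group with complex scalar multiplication \<open>s\<close>, and a norm
  whose values matter only at these points.
\<close>

record 'a nspace =
  pts :: "'a set"
  nrm :: "'a \<Rightarrow> real"

locale complex_normed_space = vector_space s
  for s :: "complex \<Rightarrow> 'a::ab_group_add \<Rightarrow> 'a" and X :: "'a nspace" +
  assumes subspace_pts: "subspace (pts X)"
    and nrm_eq_0: "x \<in> pts X \<Longrightarrow> nrm X x = 0 \<Longrightarrow> x = 0"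
    and nrm_triangle: "x \<in> pts X \<Longrightarrow> y \<in> pts X \<Longrightarrow> nrm X (x + y) \<le> nrm X x + nrm X y"
    and nrm_scale: "x \<in> pts X \<Longrightarrow> nrm X (s c x) = cmod c * nrm X x"

text \<open>
  The value 0 off the points of \<open>X\<close> is irrelevant for the topology; it makes the library locale
  \<open>Metric_space\<close>, which demands nonnegativity and symmetry on the whole type, applicable.
\<close>

definition ndist :: "'a::ab_group_add nspace \<Rightarrow> 'a \<Rightarrow> 'a \<Rightarrow> real" where
  "ndist X x y = (if x \<in> pts X \<and> y \<in> pts X then nrm X (x - y) else 0)"

definition ntop :: "'a::ab_group_add nspace \<Rightarrow> 'a topology" where
  "ntop X = Metric_space.mtopology (pts X) (ndist X)"

locale complex_banach_space = complex_normed_space +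
  assumes complete: "Metric_space.mcomplete (pts X) (ndist X)"

lemma (in complex_normed_space) Metric_space_ndist: "Metric_space (pts X) (ndist X)"
proof
  have zero: "nrm X 0 = 0"
    using nrm_scale[of 0 0] subspace_0[OF subspace_pts] by simp
  have neg: "nrm X (- x) = nrm X x" if "x \<in> pts X" for x
    using nrm_scale[OF that, of "-1"] by simp
  have nonneg: "0 \<le> nrm X x" if "x \<in> pts X" for x
    using nrm_triangle[OF that subspace_neg[OF subspace_pts that]] neg[OF that] zero by simp
  note sub = subspace_diff[OF subspace_pts]
  fix x y z
  show "0 \<le> ndist X x y"
    by (simp add: ndist_def nonneg sub)
  show "ndist X x y = ndist X y x"
    using neg[OF sub, of x y] by (simp add: ndist_def)
  show "ndist X x y = 0 \<longleftrightarrow> x = y" if "x \<in> pts X" "y \<in> pts X"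
    using that nrm_eq_0[OF sub, of x y] by (auto simp: ndist_def zero)
  show "ndist X x z \<le> ndist X x y + ndist X y z"
    if "x \<in> pts X" "y \<in> pts X" "z \<in> pts X"
    using that nrm_triangle[OF sub sub, of x y y z] by (simp add: ndist_def)
qed

definition rotund :: "(complex \<Rightarrow> 'a::ab_group_add \<Rightarrow> 'a) \<Rightarrow> 'a nspace \<Rightarrow> bool" where
  "rotund s X \<longleftrightarrow> (\<forall>x\<in>pts X. \<forall>y\<in>pts X.
     nrm X x = 1 \<and> nrm X y = 1 \<and> x \<noteq> y \<longrightarrow> nrm X (s (1/2) (x + y)) < 1)"

text \<open>
  A functional on \<open>X\<close> is represented by its extension by 0 to the ambient type, so that
  equality of functionals is equality on \<open>X\<close> and the vector operations are the pointwise ones.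
\<close>

definition dual :: "(complex \<Rightarrow> 'a::ab_group_add \<Rightarrow> 'a) \<Rightarrow> 'a nspace \<Rightarrow> ('a \<Rightarrow> complex) nspace" where
  "dual s X = \<lparr>
     pts = {f. (\<forall>x\<in>pts X. \<forall>y\<in>pts X. f (x + y) = f x + f y)
             \<and> (\<forall>c. \<forall>x\<in>pts X. f (s c x) = c * f x)
             \<and> (\<exists>C. \<forall>x\<in>pts X. cmod (f x) \<le> C * nrm X x)
             \<and> (\<forall>x. x \<notin> pts X \<longrightarrow> f x = 0)},
     nrm = (\<lambda>f. SUP x\<in>{x\<in>pts X. nrm X x \<le> 1}. cmod (f x))\<rparr>"

definition fun_scale :: "complex \<Rightarrow> ('a \<Rightarrow> complex) \<Rightarrow> 'a \<Rightarrow> complex" where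
  "fun_scale c f = (\<lambda>x. c * f x)"

text \<open>The common Hausdorff topological vector space is the whole ambient type.\<close>

locale interpolation_couple =
  B0: complex_banach_space s B0 + B1: complex_banach_space s B1
  for s :: "complex \<Rightarrow> 'v::{t2_space, topological_ab_group_add} \<Rightarrow> 'v"
    and B0 B1 :: "'v nspace" +
  assumes continuous_scale: "continuous_on UNIV (\<lambda>(c, x). s c x)"
    and embedding_0: "continuous_map (ntop B0) euclidean (\<lambda>x. x)"
    and embedding_1: "continuous_map (ntop B1) euclidean (\<lambda>x. x)"

definition sum_space :: "'v::ab_group_add nspace \<Rightarrow> 'v nspace \<Rightarrow> 'v nspace" where
  "sum_space B0 B1 = \<lparr>
     pts = {a0 + a1 |a0 a1. a0 \<in> pts B0 \<and> a1 \<in> pts B1},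
     nrm = (\<lambda>a. Inf {nrm B0 a0 + nrm B1 a1 |a0 a1. a0 \<in> pts B0 \<and> a1 \<in> pts B1 \<and> a = a0 + a1})\<rparr>"

definition open_strip :: "complex set" where
  "open_strip = {z. 0 < Re z \<and> Re z < 1}"

definition strip :: "complex set" where
  "strip = closure open_strip"

definition holomorphic_into ::
    "(complex \<Rightarrow> 'a::ab_group_add \<Rightarrow> 'a) \<Rightarrow> 'a nspace \<Rightarrow> (complex \<Rightarrow> 'a) \<Rightarrow> complex set \<Rightarrow> bool" where
  "holomorphic_into s X F U \<longleftrightarrow>
     (\<forall>z\<in>U. \<exists>D. limitin (ntop X) (\<lambda>w. s (1 / (w - z)) (F w - F z)) D (at z))"

definition C0_into :: "'a::ab_group_add nspace \<Rightarrow> (real \<Rightarrow> 'a) set" where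
  "C0_into X = {g. continuous_map euclidean (ntop X) g \<and> ((\<lambda>t. nrm X (g t)) \<longlongrightarrow> 0) at_infinity}"

text \<open>
  Elements are functions on all of the complex plane, but neither membership nor the norm below
  depends on their values outside the closed strip.
\<close>

definition interp_functions ::
    "(complex \<Rightarrow> 'v::ab_group_add \<Rightarrow> 'v) \<Rightarrow> 'v nspace \<Rightarrow> 'v nspace \<Rightarrow> (complex \<Rightarrow> 'v) set" where
  "interp_functions s B0 B1 = {F.
     F ` strip \<subseteq> pts (sum_space B0 B1)
     \<and> (\<exists>C. \<forall>z\<in>strip. nrm (sum_space B0 B1) (F z) \<le> C)
     \<and> continuous_map (top_of_set strip) (ntop (sum_space B0 B1)) F
     \<and> holomorphic_into s (sum_space B0 B1) F open_strip
     \<and> (\<lambda>t. F (Complex 0 t)) \<in> C0_into B0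
     \<and> (\<lambda>t. F (Complex 1 t)) \<in> C0_into B1}"

definition interp_function_norm :: "'v nspace \<Rightarrow> 'v nspace \<Rightarrow> (complex \<Rightarrow> 'v) \<Rightarrow> real" where
  "interp_function_norm B0 B1 F =
     max (SUP t. nrm B0 (F (Complex 0 t))) (SUP t. nrm B1 (F (Complex 1 t)))"

definition interp_space ::
    "(complex \<Rightarrow> 'v::ab_group_add \<Rightarrow> 'v) \<Rightarrow> 'v nspace \<Rightarrow> 'v nspace \<Rightarrow> real \<Rightarrow> 'v nspace" where
  "interp_space s B0 B1 \<theta> = \<lparr>
     pts = {F (of_real \<theta>) |F. F \<in> interp_functions s B0 B1},
     nrm = (\<lambda>a. Inf {interp_function_norm B0 B1 F |F.
                       F \<in> interp_functions s B0 B1 \<and> F (of_real \<theta>) = a})\<rparr>"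

end

theory Submission
  imports Defs "HOL-Computational_Algebra.Polynomial"
begin

text \<open>
  Suppose \<open>\<phi>\<close>, \<open>\<psi>\<close> and their midpoint lie on the unit sphere of the dual of \<open>B\<^sub>\<theta>\<close>. Jensen's
  inequality on the strip bounds \<open>\<bar>\<phi> (F \<theta>)\<bar>\<close> by the integral of \<open>\<parallel>F\<parallel>\<close> against harmonic measure on the
  boundary. By Hahn-Banach \<open>\<phi>\<close> and \<open>\<psi>\<close> therefore split into a vector measure on the imaginary axis,
  with values in the dual of \<open>B\<^sub>0\<close> and dominated by harmonic measure, and a part that sees only the
  values of \<open>F\<close> on the line \<open>Re z = 1\<close>. Multiplying \<open>F\<close> by \<open>exp (- n (z - \<theta>))\<close> kills the second part, so
  that \<open>\<phi> \<noteq> \<psi>\<close> forces the two vector measures to differ, by a definite amount against one vector \<open>x\<close> on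
  all subsets of some set of positive measure. Since the midpoint has norm 1, this set contains
  a decreasing sequence of sets on which the averages of the two vector measures are jointly
  almost normed by vectors of the unit ball. A weak limit of these averages is a pair of
  functionals in the dual unit ball of \<open>B\<^sub>0\<close> whose midpoint has norm 1 and which differ at \<open>x\<close>,
  contradicting rotundity.
\<close>

section \<open>Harmonic polynomials and Hahn decomposition\<close>

text \<open>The obstacle is that \<open>B0\<close> is arbitrary: a vector measure with values in its
  dual may have no density, so there is no single point of the axis at which two functionals could
  be compared. Averages over Borel sets replace the values of a density. An average is stable under
  shrinking of the set only if its bound is hereditary, that is, valid on every Borel subset. Each
  lower bound is therefore made hereditary by a Hahn decomposition before the next shrinking step.
  Near-norming vectors exist on every set of positive measure because nothing is left over: the line
  \<open>Re z = 1\<close> contributes at most \<theta>, the imaginary axis at most 1 - \<theta>, and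
  a midpoint of norm 1 uses up both. Jensen's inequality is indispensable here. The norm of \<phi>
  only gives a bound by the supremum of the boundary norms, which would admit parts singular to
  harmonic measure; the integral bound excludes them and makes the measures countably additive. The
  limit is taken for the pair of functionals at once, since the midpoint condition and the
  separation at \<open>x\<close> both couple the two.\<close>

lemma has_integral_cis_mult:
  "((\<lambda>t. cis (real n * t)) has_integral (if n = 0 then 2 * pi else 0)) {0..2 * pi}"
proof (cases "n = 0")
  case True
  then show ?thesis
    using has_integral_const_real[of "1::complex" 0 "2 * pi"]
    by (simp add: scaleR_conv_of_real)
next
  case False
  have "((\<lambda>t. cis (real n * t)) has_integral
      cis (real n * (2 * pi)) / (\<i> * n) - cis (real n * 0) / (\<i> * n)) {0..2 * pi}"
  proof (rule fundamental_theorem_of_calculus)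
    fix t :: real
    show "((\<lambda>t. cis (real n * t) / (\<i> * n)) has_vector_derivative cis (real n * t))
            (at t within {0..2 * pi})"
    proof -
      have "((\<lambda>z. exp (\<i> * n * z) / (\<i> * n)) has_field_derivative exp (\<i> * n * of_real t))
              (at (of_real t))"
        using False by (auto intro!: derivative_eq_intros)
      from has_vector_derivative_real_field[OF this] show ?thesis
        by (simp add: cis_conv_exp mult.assoc)
    qed
  qed simp
  moreover have "cis (real n * (2 * pi)) = 1"
    using cis_multiple_2pi[of "real n"] by (simp add: mult_ac)
  ultimately show ?thesis
    using False by simp
qed

text \<open>The mean value property for polynomials suffices, since the exponent of the outer
  function in Jensen's inequality will be a polynomial in the disc variable.\<close>

lemma has_integral_Re_poly_cis:
  "((\<lambda>t. Re (poly p (cis t))) has_integral 2 * pi * Re (poly p 0)) {0..2 * pi}"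
proof -
  have "((\<lambda>t. \<Sum>i\<le>degree p. coeff p i * cis (real i * t)) has_integral
          (\<Sum>i\<le>degree p. coeff p i * (if i = 0 then 2 * pi else 0))) {0..2 * pi}"
    by (intro has_integral_sum has_integral_mult_right has_integral_cis_mult) auto
  moreover have "(\<Sum>i\<le>degree p. coeff p i * (if i = 0 then 2 * pi else 0)) = 2 * pi * poly p 0"
    by (simp add: if_distrib poly_0_coeff_0 cong: if_cong)
  ultimately have "((\<lambda>t. poly p (cis t)) has_integral 2 * pi * poly p 0) {0..2 * pi}"
    by (simp only: poly_altdef Complex.DeMoivre)
  from has_integral_Re[OF this] show ?thesis
    by simp
qed

text \<open>These are the real trigonometric polynomials. They are presented through a holomorphic
  polynomial \<open>p\<close> because \<open>exp (- p)\<close> later serves as a multiplier of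
  prescribed modulus on the circle.\<close>

definition Re_poly_on_circle :: "(complex \<Rightarrow> real) \<Rightarrow> bool" where
  "Re_poly_on_circle f \<longleftrightarrow> (\<exists>p. \<forall>z\<in>sphere 0 1. f z = Re (poly p z))"

lemma Re_poly_on_circle_add:
  assumes "Re_poly_on_circle f" "Re_poly_on_circle g"
  shows "Re_poly_on_circle (\<lambda>z. f z + g z)"
proof -
  from assms obtain p q where "\<forall>z\<in>sphere 0 1. f z = Re (poly p z)"
    "\<forall>z\<in>sphere 0 1. g z = Re (poly q z)"
    unfolding Re_poly_on_circle_def by blast
  then show ?thesis
    unfolding Re_poly_on_circle_def by (intro exI[of _ "p + q"]) auto
qed

lemma Re_poly_on_circle_monom: "Re_poly_on_circle (\<lambda>z. Re (a * z ^ n))"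
  unfolding Re_poly_on_circle_def by (intro exI[of _ "monom a n"]) (simp add: poly_monom)

lemma Re_poly_on_circle_sum:
  assumes "\<And>i. i \<in> I \<Longrightarrow> Re_poly_on_circle (f i)"
  shows "Re_poly_on_circle (\<lambda>z. \<Sum>i\<in>I. f i z)"
  using assms
proof (induction I rule: infinite_finite_induct)
  case (insert i I)
  then show ?case
    using Re_poly_on_circle_add[of "f i" "\<lambda>z. \<Sum>i\<in>I. f i z"] by simp
qed (use Re_poly_on_circle_monom[of 0] in simp_all)

lemma Re_poly_on_circle_cong:
  assumes "Re_poly_on_circle f" "\<And>z. cmod z = 1 \<Longrightarrow> g z = f z"
  shows "Re_poly_on_circle g"
  using assms unfolding Re_poly_on_circle_def by auto

text \<open>The identity \<open>Re u * Re v = Re (u * v / 2) + Re (u * cnj v / 2)\<close> linearises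
  the product. On the circle \<open>cnj z\<close> is the inverse of \<open>z\<close>, and ordering
  the exponents keeps \<open>m - n\<close> a genuine power.\<close>

lemma Re_poly_on_circle_monom_mult:
  "Re_poly_on_circle (\<lambda>z. Re (a * z ^ m) * Re (b * z ^ n))"
proof (induction n m arbitrary: a b rule: linorder_wlog)
  case (le n m)
  have "Re_poly_on_circle (\<lambda>z. Re (a * b / 2 * z ^ (m + n)) + Re (a * cnj b / 2 * z ^ (m - n)))"
    by (intro Re_poly_on_circle_add Re_poly_on_circle_monom)
  then show ?case
  proof (rule Re_poly_on_circle_cong)
    fix z :: complex assume z: "cmod z = 1"
    have [simp]: "z ^ n * cnj z ^ n = 1"
      using z by (simp flip: power_mult_distrib add: complex_norm_square[symmetric])
    have "z ^ m = z ^ (m - n) * z ^ n"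
      using le by (simp flip: power_add)
    then have "z ^ m * cnj z ^ n = z ^ (m - n)"
      by (simp add: mult.assoc)
    then have "a * cnj b / 2 * z ^ (m - n) = (a * z ^ m) * cnj (b * z ^ n) / 2"
      by simp
    moreover have "a * b / 2 * z ^ (m + n) = (a * z ^ m) * (b * z ^ n) / 2"
      by (simp add: power_add)
    moreover have "Re u * Re v = Re (u * v / 2) + Re (u * cnj v / 2)" for u v
      by (simp add: field_simps)
    ultimately show "Re (a * z ^ m) * Re (b * z ^ n) =
        Re (a * b / 2 * z ^ (m + n)) + Re (a * cnj b / 2 * z ^ (m - n))"
      by metis
  qed
next
  case (sym n m)
  show ?case
    using sym[of b a] by (simp add: mult.commute)
qed

lemma Re_poly_on_circle_mult:
  assumes "Re_poly_on_circle f" "Re_poly_on_circle g"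
  shows "Re_poly_on_circle (\<lambda>z. f z * g z)"
proof -
  from assms obtain p q where pq: "\<forall>z\<in>sphere 0 1. f z = Re (poly p z)"
    "\<forall>z\<in>sphere 0 1. g z = Re (poly q z)"
    unfolding Re_poly_on_circle_def by blast
  have "Re_poly_on_circle (\<lambda>z. \<Sum>i\<le>degree p. \<Sum>j\<le>degree q.
      Re (coeff p i * z ^ i) * Re (coeff q j * z ^ j))"
    by (intro Re_poly_on_circle_sum Re_poly_on_circle_monom_mult)
  then show ?thesis
    by (rule Re_poly_on_circle_cong) (use pq in \<open>simp add: poly_altdef sum_product\<close>)
qed

lemma Re_poly_on_circle_real_polynomial:
  "real_polynomial_function f \<Longrightarrow> Re_poly_on_circle f"
proof (induction rule: real_polynomial_function.induct)
  case (linear f)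
  interpret bounded_linear f by fact
  have "f z = Re ((f 1 - \<i> * f \<i>) * z ^ 1)" for z
  proof -
    have "z = Re z *\<^sub>R 1 + Im z *\<^sub>R \<i>"
      by (simp add: complex_eq_iff)
    then have "f z = f (Re z *\<^sub>R 1 + Im z *\<^sub>R \<i>)"
      by (rule arg_cong)
    also have "\<dots> = Re z * f 1 + Im z * f \<i>"
      by (simp only: add scaleR real_scaleR_def)
    finally have "f z = Re z * f 1 + Im z * f \<i>" .
    then show ?thesis by simp
  qed
  then show ?case
    using Re_poly_on_circle_cong[OF Re_poly_on_circle_monom[of "f 1 - \<i> * f \<i>" 1]] by blast
next
  case (const c)
  then show ?case
    using Re_poly_on_circle_monom[of "of_real c" 0] by simp
qed (auto intro: Re_poly_on_circle_add Re_poly_on_circle_mult)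

lemma Re_poly_approximation_on_circle:
  assumes "continuous_on (sphere 0 1) g" "0 < e"
  obtains p :: "complex poly" where "\<And>z. z \<in> sphere 0 1 \<Longrightarrow> \<bar>g z - Re (poly p z)\<bar> < e"
proof -
  obtain f where "real_polynomial_function f" "\<And>z. z \<in> sphere 0 1 \<Longrightarrow> \<bar>g z - f z\<bar> < e"
    using Stone_Weierstrass_real_polynomial_function[OF compact_sphere assms] by blast
  moreover from this(1) obtain p where "\<forall>z\<in>sphere 0 1. f z = Re (poly p z)"
    using Re_poly_on_circle_real_polynomial unfolding Re_poly_on_circle_def by blast
  ultimately show ?thesis
    using that[of p] by simp
qed

text \<open>Hahn decomposition of \<open>\<kappa> - c M\<close>.\<close>

lemma (in finite_measure) hereditary_lower_bound:
  fixes \<kappa> :: "'a set \<Rightarrow> real"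
  assumes add: "\<And>X Y. X \<in> sets M \<Longrightarrow> Y \<in> sets M \<Longrightarrow> X \<inter> Y = {} \<Longrightarrow> \<kappa> (X \<union> Y) = \<kappa> X + \<kappa> Y"
    and bound: "\<And>X. X \<in> sets M \<Longrightarrow> \<bar>\<kappa> X\<bar> \<le> C * measure M X"
    and E: "E \<in> sets M" and less: "c * measure M E < \<kappa> E"
  obtains E' where "E' \<in> sets M" "E' \<subseteq> E" "0 < measure M E'"
    "\<And>X. X \<in> sets M \<Longrightarrow> X \<subseteq> E' \<Longrightarrow> c * measure M X \<le> \<kappa> X"
proof -
  \<comment> \<open>Adding \<open>D * measure M\<close> to both sides makes \<kappa> and
    \<open>c * measure M\<close> nonnegative, as the unsigned Hahn decomposition requires:
    \<open>C \<le> D\<close> serves the first and \<open>- c \<le> D\<close> the second.\<close>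
  define D where "D = max C (- c)"
  have D: "\<bar>\<kappa> X\<bar> \<le> D * measure M X" if "X \<in> sets M" for X
    using bound[OF that] mult_right_mono[of C D "measure M X"] by (simp add: D_def)
  define f where "f X = ennreal (\<kappa> X + D * measure M X)" for X
  define N where "N = measure_of (space M) (sets M) f"
  have nonneg: "0 \<le> \<kappa> X + D * measure M X" if "X \<in> sets M" for X
    using D[OF that] by linarith
  have \<kappa>0: "\<kappa> {} = 0"
    using add[of "{}" "{}"] by simp
  have f: "positive (sets M) f"
    by (simp add: positive_def f_def \<kappa>0)
  \<comment> \<open>Domination by the finite measure \<open>M\<close> gives continuity from above at
    the empty set, which upgrades finite additivity.\<close>
  have "countably_additive (sets M) f"
  proof (rule sets.empty_continuous_imp_countably_additive[OF f])
    show "additive (sets M) f"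
      unfolding additive_def f_def
      by (auto simp: add finite_measure_Union nonneg algebra_simps simp flip: ennreal_plus)
    show "\<forall>X\<in>sets M. f X \<noteq> \<infinity>" by (simp add: f_def)
    fix A :: "nat \<Rightarrow> 'a set"
    assume A: "range A \<subseteq> sets M" "decseq A" "\<Inter> (range A) = {}"
    have "(\<lambda>i. measure M (A i)) \<longlonglongrightarrow> 0"
      using finite_Lim_measure_decseq[OF A(1,2)] A(3) by simp
    then have "(\<lambda>i. 2 * D * measure M (A i)) \<longlonglongrightarrow> 0"
      by (rule tendsto_mult_right_zero)
    then have "(\<lambda>i. \<kappa> (A i) + D * measure M (A i)) \<longlonglongrightarrow> 0"
    proof (rule Lim_null_comparison[rotated])
      show "\<forall>\<^sub>F i in sequentially. norm (\<kappa> (A i) + D * measure M (A i)) \<le> 2 * D * measure M (A i)"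
        using A(1) D nonneg by (intro always_eventually) (force simp: abs_le_iff)
    qed
    then show "(\<lambda>i. f (A i)) \<longlonglongrightarrow> 0"
      unfolding f_def using tendsto_ennrealI by fastforce
  qed
  then have N: "emeasure N X = f X" if "X \<in> sets M" for X
    unfolding N_def using that f
    by (intro emeasure_measure_of_sigma sets.sigma_algebra_axioms)
  define M' where "M' = scale_measure (ennreal (c + D)) M"
  have cD: "0 \<le> c + D" by (simp add: D_def)
  have M': "emeasure M' X = ennreal ((c + D) * measure M X)" for X
    using cD by (simp add: M'_def emeasure_eq_measure ennreal_mult)
  obtain Y where Y: "Y \<in> sets M" "Y \<subseteq> E"
    "\<And>X. X \<in> sets M \<Longrightarrow> X \<subseteq> Y \<Longrightarrow> emeasure N X \<le> emeasure M' X"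
    "\<And>X. X \<in> sets M \<Longrightarrow> X \<subseteq> E \<Longrightarrow> X \<inter> Y = {} \<Longrightarrow> emeasure M' X \<le> emeasure N X"
  proof -
    have "sets N = sets M" "sets M' = sets M"
      by (simp_all add: N_def M'_def)
    moreover have "emeasure N E \<noteq> top" "emeasure M' E \<noteq> top"
      using E by (simp_all add: N f_def M')
    ultimately show ?thesis
      using unsigned_Hahn_decomposition[of N M' E] E that by metis
  qed
  have YE: "E - Y \<in> sets M" using E Y by auto
  have "\<kappa> Y \<le> c * measure M Y"
  proof -
    have "ennreal (\<kappa> Y + D * measure M Y) \<le> ennreal ((c + D) * measure M Y)"
      using Y(3)[of Y] Y(1) by (simp add: N M' f_def)
    moreover have "0 \<le> (c + D) * measure M Y"
      using cD by simp
    ultimately have "\<kappa> Y + D * measure M Y \<le> (c + D) * measure M Y"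
      by (simp only: ennreal_le_iff)
    then show ?thesis
      by (simp add: algebra_simps)
  qed
  moreover have "\<kappa> E = \<kappa> Y + \<kappa> (E - Y)" "measure M E = measure M Y + measure M (E - Y)"
    using add[OF Y(1) YE] finite_measure_Union[OF Y(1) YE] Y(2)
    by (simp_all add: Un_absorb1)
  ultimately have "c * measure M (E - Y) < \<kappa> (E - Y)"
    using less by (simp add: algebra_simps)
  then have "measure M (E - Y) \<noteq> 0"
    using bound[OF YE] by auto
  then have "0 < measure M (E - Y)"
    by (simp add: zero_less_measure_iff)
  moreover have "c * measure M X \<le> \<kappa> X" if "X \<in> sets M" "X \<subseteq> E - Y" for X
  proof -
    have "ennreal ((c + D) * measure M X) \<le> ennreal (\<kappa> X + D * measure M X)"
      using Y(4)[of X] that by (simp add: N M' f_def disjoint_eq_subset_Compl subset_iff)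
    then show ?thesis
      using nonneg[OF that(1)] by (simp add: ennreal_le_iff algebra_simps)
  qed
  ultimately show ?thesis
    using that[OF YE] by auto
qed

section \<open>The Hahn-Banach theorem\<close>

text \<open>Minimal sublinear functionals are linear.\<close>

theorem Hahn_Banach_dominated:
  fixes scale :: "real \<Rightarrow> 'b::ab_group_add \<Rightarrow> 'b" and p :: "'b \<Rightarrow> real"
  assumes "vector_space scale" and U: "module.subspace scale U"
    and subadd: "\<And>x y. x \<in> U \<Longrightarrow> y \<in> U \<Longrightarrow> p (x + y) \<le> p x + p y"
    and homog: "\<And>c x. 0 < c \<Longrightarrow> x \<in> U \<Longrightarrow> p (scale c x) = c * p x"
  obtains f where "\<And>x y. x \<in> U \<Longrightarrow> y \<in> U \<Longrightarrow> f (x + y) = f x + f y"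
    "\<And>c x. x \<in> U \<Longrightarrow> f (scale c x) = c * f x"
    "\<And>x. x \<in> U \<Longrightarrow> f x \<le> p x"
proof -
  interpret vector_space scale by fact
  note [simp] = subspace_0[OF U] and [intro] = subspace_neg[OF U] subspace_add[OF U]
    subspace_diff[OF U] subspace_scale[OF U]
  \<comment> \<open>Fixing the value 0 off \<open>U\<close> lets the pointwise order on the whole
    type compare values on \<open>U\<close> only.\<close>
  define S where "S = {q. (\<forall>x\<in>U. \<forall>y\<in>U. q (x + y) \<le> q x + q y)
      \<and> (\<forall>c>0. \<forall>x\<in>U. q (scale c x) = c * q x) \<and> (\<forall>x\<in>U. q x \<le> p x) \<and> (\<forall>x. x \<notin> U \<longrightarrow> q x = 0)}"
  have SD: "q (x + y) \<le> q x + q y" "q (scale c x) = c * q x" "q x \<le> p x"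
    if "q \<in> S" "x \<in> U" "y \<in> U" "c > 0" for q x y c
    using that unfolding S_def by auto
  have S0: "q 0 = 0" if "q \<in> S" for q
    using SD(2)[OF that, of 0 0 2] by simp
  have neg: "- q (- x) \<le> q x" if "q \<in> S" "x \<in> U" for q x
    using SD(1)[OF that(1,2) subspace_neg[OF U that(2)] zero_less_one] S0[OF that(1)] by simp
  have "\<exists>m\<in>S. \<forall>q\<in>S. m \<ge> q \<longrightarrow> q = m"
  proof (rule predicate_Zorn)
    show "partial_order_on S (relation_of (\<lambda>a b. b \<le> a) S)"
      by (auto simp: partial_order_on_def preorder_on_def refl_on_def trans_def antisym_def
          relation_of_def)
    fix C assume C: "C \<in> Chains (relation_of (\<lambda>a b. b \<le> a) S)"
    then have CS: "C \<subseteq> S" and chain: "\<And>a b. a \<in> C \<Longrightarrow> b \<in> C \<Longrightarrow> a \<le> b \<or> b \<le> a"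
      unfolding Chains_def relation_of_def by auto
    \<comment> \<open>Adjoining the largest element of \<open>S\<close> to the chain covers the
      empty chain.\<close>
    define q0 where "q0 x = (if x \<in> U then p x else 0)" for x
    have q0: "q0 \<in> S"
      unfolding S_def q0_def using subadd homog by auto
    define D where "D = insert q0 C"
    have "q \<le> q0" if "q \<in> S" for q
      using that unfolding S_def q0_def by (auto simp: le_fun_def)
    then have D: "D \<noteq> {}" "D \<subseteq> S" and Dchain: "\<And>a b. a \<in> D \<Longrightarrow> b \<in> D \<Longrightarrow> a \<le> b \<or> b \<le> a"
      unfolding D_def using CS chain q0 by auto
    define u where "u x = (INF q\<in>D. q x)" for x
    \<comment> \<open>This bound is uniform in \<open>q\<close>, so the pointwise infimum of the
      chain is finite.\<close>
    have low: "- p (- x) \<le> q x" if "x \<in> U" "q \<in> D" for x q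
    proof -
      have "q \<in> S" using that D by auto
      from neg[OF this that(1)] SD(3)[OF this subspace_neg[OF U that(1)], of x 1] that(1)
      show ?thesis by linarith
    qed
    then have bdd: "bdd_below ((\<lambda>q. q x) ` D)" if "x \<in> U" for x
      using that by (intro bdd_belowI2)
    have u_le: "u x \<le> q x" if "x \<in> U" "q \<in> D" for x q
      unfolding u_def using cINF_lower[OF bdd that(2)] that by blast
    have u_greatest: "c \<le> u x" if "\<And>q. q \<in> D \<Longrightarrow> c \<le> q x" for x c
      unfolding u_def using cINF_greatest[OF D(1)] that by metis
    have u_out: "u x = 0" if "x \<notin> U" for x
    proof -
      have "\<And>q. q \<in> D \<Longrightarrow> q x = 0" using D that by (auto simp: S_def)
      then have "(\<lambda>q. q x) ` D = {0}" using D(1) by (auto simp: image_iff)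
      then show ?thesis unfolding u_def by simp
    qed
    have "u \<in> S"
      unfolding S_def
    proof (intro CollectI conjI ballI allI impI)
      fix x y assume xy: "x \<in> U" "y \<in> U"
      have "u (x + y) \<le> q x + q' y" if "q \<in> D" "q' \<in> D" for q q'
      proof -
        have "\<exists>r\<in>D. r \<le> q \<and> r \<le> q'"
          using Dchain[OF that] that by blast
        then obtain r where r: "r \<in> D" "r \<le> q" "r \<le> q'" by blast
        have "u (x + y) \<le> r (x + y)"
          using u_le xy r by blast
        also have "\<dots> \<le> r x + r y"
          using SD(1)[of r x y 1] r D xy by auto
        also have "\<dots> \<le> q x + q' y"
          using r by (simp add: le_fun_def add_mono)
        finally show ?thesis .
      qed
      then have "u (x + y) - q' y \<le> u x" if "q' \<in> D" for q'
        using that by (intro u_greatest) (simp add: algebra_simps)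
      then have "u (x + y) - u x \<le> u y"
        by (intro u_greatest) (simp add: algebra_simps)
      then show "u (x + y) \<le> u x + u y" by simp
    next
      fix c :: real and x assume c: "c > 0" "x \<in> U"
      have hom: "q (scale c x) = c * q x" if "q \<in> D" for q
        using SD(2)[of q x x c] that D c by auto
      show "u (scale c x) = c * u x"
      proof (rule antisym)
        have "u (scale c x) / c \<le> u x"
          using u_le[of "scale c x"] c hom
          by (intro u_greatest) (auto simp: field_simps)
        then show "u (scale c x) \<le> c * u x"
          using c by (simp add: field_simps)
        show "c * u x \<le> u (scale c x)"
        proof (rule u_greatest)
          fix q assume "q \<in> D"
          then show "c * u x \<le> q (scale c x)"
            using mult_left_mono[OF u_le[OF c(2), of q], of c] c(1) hom[of q] by simp
        qed
      qed
    next
      show "u x \<le> p x" if "x \<in> U" for x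
        using u_le[OF that, of q0] that by (simp add: D_def q0_def)
    qed (simp add: u_out)
    moreover have "u \<le> q" if "q \<in> C" for q
      unfolding le_fun_def using u_le[of _ q] u_out that CS
      by (metis (mono_tags, lifting) D_def S_def insertCI mem_Collect_eq order_refl subsetD)
    ultimately show "\<exists>u\<in>S. \<forall>q\<in>C. u \<le> q" by blast
  qed
  then obtain m where m: "m \<in> S" "\<And>q. q \<in> S \<Longrightarrow> q \<le> m \<Longrightarrow> q = m" by blast
  have super: "m x + m y \<le> m (x + y)" if x: "x \<in> U" and y: "y \<in> U" for x y
  proof -
    \<comment> \<open>The infimum of \<open>r x t\<close> over \<open>t > 0\<close> is again
      sublinear and lies below \<open>m\<close>. Minimality makes it equal to \<open>m\<close>, and
      \<open>t = 1\<close> then reads \<open>m x \<le> m (x + y) - m y\<close>.\<close>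
    define r where "r x t = m (x + scale t y) - t * m y" for x t
    define q where "q x = (if x \<in> U then INF t\<in>{0<..}. r x t else 0)" for x
    have bound: "- m (- x) \<le> r x t" if "x \<in> U" "t > 0" for x t
    proof -
      have "t * m y = m (scale t y)" using SD(2)[OF m(1) y y] that by simp
      also have "\<dots> = m ((x + scale t y) + (- x))" by simp
      also have "\<dots> \<le> m (x + scale t y) + m (- x)"
        using that y by (intro SD(1)[OF m(1), of _ _ 1]) auto
      finally show ?thesis by (simp add: r_def)
    qed
    then have bdd: "bdd_below (r x ` {0<..})" if "x \<in> U" for x
      using that by (intro bdd_belowI2) auto
    have q_le: "q x \<le> r x t" if "x \<in> U" "t > 0" for x t
      using cINF_lower[OF bdd, of x t] that by (simp add: q_def)
    have q_greatest: "c \<le> q x" if "x \<in> U" "\<And>t. t > 0 \<Longrightarrow> c \<le> r x t" for x c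
      using that unfolding q_def by (auto intro!: cINF_greatest)
    have qm: "q x \<le> m x" if x: "x \<in> U" for x
    proof -
      have "r x 1 \<le> m x"
        using SD(1)[OF m(1) x y zero_less_one] by (simp add: r_def)
      with q_le[OF x, of 1] show ?thesis by simp
    qed
    have "q \<in> S"
      unfolding S_def
    proof (intro CollectI conjI ballI allI impI)
      fix x x' assume xx: "x \<in> U" "x' \<in> U"
      have "q (x + x') \<le> r x t + r x' t'" if "t > 0" "t' > 0" for t t'
      proof -
        have "q (x + x') \<le> r (x + x') (t + t')" using xx that by (intro q_le) auto
        also have "m (x + x' + scale (t + t') y) \<le> m (x + scale t y) + m (x' + scale t' y)"
          using SD(1)[OF m(1), of "x + scale t y" "x' + scale t' y" 1] xx y
          by (auto simp: scale_left_distrib algebra_simps)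
        then have "r (x + x') (t + t') \<le> r x t + r x' t'"
          by (simp add: r_def algebra_simps)
        finally show ?thesis .
      qed
      then have "q (x + x') - r x' t' \<le> q x" if "t' > 0" for t'
        using that xx by (intro q_greatest) (auto simp: algebra_simps)
      then have "q (x + x') - q x \<le> q x'"
        using xx by (intro q_greatest) (auto simp: algebra_simps)
      then show "q (x + x') \<le> q x + q x'" by simp
    next
      fix c :: real and x assume c: "c > 0" and x: "x \<in> U"
      have hom: "r (scale c x) (c * t) = c * r x t" for t
        using SD(2)[OF m(1), of "x + scale t y" y c] x y c
        by (auto simp: r_def scale_right_distrib algebra_simps)
      show "q (scale c x) = c * q x"
      proof (rule antisym)
        have "q (scale c x) / c \<le> r x t" if "t > 0" for t
          using q_le[of "scale c x" "c * t"] c x hom[of t] that by (auto simp: field_simps)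
        then have "q (scale c x) / c \<le> q x"
          using x by (intro q_greatest) auto
        then show "q (scale c x) \<le> c * q x"
          using c by (simp add: field_simps)
        have "c * q x \<le> r (scale c x) t" if "t > 0" for t
          using q_le[of x "t / c"] c x hom[of "t / c"] that by auto
        then show "c * q x \<le> q (scale c x)"
          using x by (intro q_greatest) auto
      qed
    next
      show "q x \<le> p x" if "x \<in> U" for x
        using qm[OF that] SD(3)[OF m(1) that that zero_less_one] by simp
    qed (simp add: q_def)
    moreover have "q \<le> m"
      unfolding le_fun_def using qm m(1) by (auto simp: q_def S_def)
    ultimately have "q = m" by (rule m(2))
    then have "m x \<le> r x 1" using q_le[OF x, of 1] by simp
    then show ?thesis by (simp add: r_def)
  qed
  have add: "m (x + y) = m x + m y" if "x \<in> U" "y \<in> U" for x y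
    using super[OF that] SD(1)[OF m(1) that zero_less_one] by simp
  have mneg: "m (- x) = - m x" if "x \<in> U" for x
    using add[OF that subspace_neg[OF U that]] S0[OF m(1)] by simp
  have "m (scale c x) = c * m x" if x: "x \<in> U" for c x
  proof (cases c "0::real" rule: linorder_cases)
    case less
    then have "m (- scale c x) = - c * m x"
      using SD(2)[OF m(1) x x, of "- c"] by simp
    moreover have "m (- scale c x) = - m (scale c x)"
      using mneg x by auto
    ultimately show ?thesis by simp
  next
    case equal
    then show ?thesis using S0[OF m(1)] by simp
  next
    case greater
    then show ?thesis using SD(2)[OF m(1) x x] by simp
  qed
  with add SD(3)[OF m(1)] that show ?thesis
    using zero_less_one by metis
qed

text \<open>Here the dominating sublinear functional is the pointwise infimum of \<open>A\<close>.\<close>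

corollary Hahn_Banach_upper_bounds:
  fixes scale :: "real \<Rightarrow> 'b::ab_group_add \<Rightarrow> 'b" and A :: "'b \<Rightarrow> real set"
  assumes vs: "vector_space scale" and U: "module.subspace scale U"
    and nonempty: "\<And>x. x \<in> U \<Longrightarrow> A x \<noteq> {}"
    and bdd: "\<And>x. x \<in> U \<Longrightarrow> bdd_below (A x)"
    and add: "\<And>x y a b. x \<in> U \<Longrightarrow> y \<in> U \<Longrightarrow> a \<in> A x \<Longrightarrow> b \<in> A y \<Longrightarrow> a + b \<in> A (x + y)"
    and homog: "\<And>c x a. 0 < c \<Longrightarrow> x \<in> U \<Longrightarrow> a \<in> A x \<Longrightarrow> c * a \<in> A (scale c x)"
  obtains f where "\<And>x y. x \<in> U \<Longrightarrow> y \<in> U \<Longrightarrow> f (x + y) = f x + f y"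
    "\<And>c x. x \<in> U \<Longrightarrow> f (scale c x) = c * f x"
    "\<And>x a. x \<in> U \<Longrightarrow> a \<in> A x \<Longrightarrow> f x \<le> a"
proof -
  interpret vector_space scale by fact
  define p where "p x = Inf (A x)" for x
  have p_le: "p x \<le> a" if "x \<in> U" "a \<in> A x" for x a
    unfolding p_def using cInf_lower[OF that(2) bdd[OF that(1)]] .
  have p_ge: "r \<le> p x" if "x \<in> U" "\<And>a. a \<in> A x \<Longrightarrow> r \<le> a" for x r
    unfolding p_def using cInf_greatest[OF nonempty[OF that(1)] that(2)] .
  have subadd: "p (x + y) \<le> p x + p y" if xy: "x \<in> U" "y \<in> U" for x y
  proof -
    have le: "p (x + y) \<le> a + b" if "a \<in> A x" "b \<in> A y" for a b
      using p_le[OF subspace_add[OF U xy]] add[OF xy that] by blast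
    have "p (x + y) - b \<le> p x" if "b \<in> A y" for b
      using le[OF _ that] by (intro p_ge[OF xy(1)]) (simp add: algebra_simps)
    then have "p (x + y) - p x \<le> p y"
      by (intro p_ge[OF xy(2)]) (simp add: algebra_simps)
    then show ?thesis by simp
  qed
  have le: "p (scale c x) \<le> c * p x" if c: "0 < c" and x: "x \<in> U" for c x
  proof -
    have "p (scale c x) / c \<le> p x"
      using p_le[OF subspace_scale[OF U x]] homog[OF c x] c
      by (intro p_ge[OF x]) (simp add: field_simps)
    then show ?thesis using c by (simp add: field_simps)
  qed
  have homog': "p (scale c x) = c * p x" if c: "0 < c" and x: "x \<in> U" for c x
  proof (rule antisym[OF le[OF c x]])
    have "p x \<le> (1 / c) * p (scale c x)"
      using le[of "1 / c" "scale c x"] c subspace_scale[OF U x] by simp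
    then show "c * p x \<le> p (scale c x)"
      using c by (simp add: field_simps)
  qed
  obtain f where "\<And>x y. x \<in> U \<Longrightarrow> y \<in> U \<Longrightarrow> f (x + y) = f x + f y"
    "\<And>c x. x \<in> U \<Longrightarrow> f (scale c x) = c * f x" "\<And>x. x \<in> U \<Longrightarrow> f x \<le> p x"
    using Hahn_Banach_dominated[OF vs U subadd homog'] by blast
  then show ?thesis
    using p_le by (intro that[of f]) (blast intro: order_trans)+
qed

section \<open>Convergence in normed spaces\<close>

lemma continuous_map_top_of_set_iff_limitin:
  "continuous_map (top_of_set S) Y f \<longleftrightarrow> (\<forall>x\<in>S. limitin Y f (f x) (at x within S))"
proof -
  have "atin (top_of_set S) x = at x within S" if "x \<in> S" for x
    using that by (auto simp: filter_eq_iff atin_subtopology_within eventually_atin_within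
        eventually_at_topological)
  then show ?thesis
    by (simp add: continuous_map_atin)
qed

context complex_normed_space
begin

lemmas pts_0 [simp] = subspace_0[OF subspace_pts]
lemmas pts_add [intro] = subspace_add[OF subspace_pts]
lemmas pts_diff [intro] = subspace_diff[OF subspace_pts]
lemmas pts_scale [intro] = subspace_scale[OF subspace_pts]
lemmas pts_neg [intro] = subspace_neg[OF subspace_pts]

lemma nrm_0 [simp]: "nrm X 0 = 0"
  using nrm_scale[of 0 0] by simp

lemma nrm_minus [simp]: "x \<in> pts X \<Longrightarrow> nrm X (- x) = nrm X x"
  using nrm_scale[of x "-1"] by simp

lemma nrm_nonneg: "x \<in> pts X \<Longrightarrow> 0 \<le> nrm X x"
  using nrm_triangle[of x "- x"] by auto

lemma nrm_diff_triangle: "x \<in> pts X \<Longrightarrow> y \<in> pts X \<Longrightarrow> nrm X x \<le> nrm X y + nrm X (x - y)"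
  using nrm_triangle[of y "x - y"] by auto

lemma nrm_diff_commute: "x \<in> pts X \<Longrightarrow> y \<in> pts X \<Longrightarrow> nrm X (x - y) = nrm X (y - x)"
  using nrm_minus[OF pts_diff, of x y] by simp

lemma abs_nrm_diff_le:
  "x \<in> pts X \<Longrightarrow> y \<in> pts X \<Longrightarrow> \<bar>nrm X x - nrm X y\<bar> \<le> nrm X (x - y)"
  using nrm_diff_triangle[of x y] nrm_diff_triangle[of y x] nrm_diff_commute[of x y] by linarith

lemma topspace_ntop [simp]: "topspace (ntop X) = pts X"
  unfolding ntop_def using Metric_space.topspace_mtopology[OF Metric_space_ndist] .

lemma limitin_ntop_iff:
  "limitin (ntop X) f l F \<longleftrightarrow>
     l \<in> pts X \<and> (\<forall>\<^sub>F x in F. f x \<in> pts X) \<and> ((\<lambda>x. nrm X (f x - l)) \<longlongrightarrow> 0) F"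
  (is "?L \<longleftrightarrow> ?R")
proof -
  interpret Metric_space "pts X" "ndist X" by (rule Metric_space_ndist)
  have *: "?L \<longleftrightarrow> l \<in> pts X \<and> (\<forall>e>0. \<forall>\<^sub>F x in F. f x \<in> pts X \<and> ndist X (f x) l < e)"
    unfolding ntop_def by (rule limitin_metric)
  show ?thesis
  proof
    assume L: ?L
    then have ev: "\<forall>\<^sub>F x in F. f x \<in> pts X"
      unfolding * using zero_less_one eventually_mono by (metis (mono_tags, lifting))
    moreover have "((\<lambda>x. nrm X (f x - l)) \<longlongrightarrow> 0) F"
    proof (rule tendstoI)
      fix e :: real assume "0 < e"
      with L have l: "l \<in> pts X" and "\<forall>\<^sub>F x in F. f x \<in> pts X \<and> ndist X (f x) l < e"
        unfolding * by auto
      from this(2) show "\<forall>\<^sub>F x in F. dist (nrm X (f x - l)) 0 < e"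
        by eventually_elim (use l nrm_nonneg[OF pts_diff] in \<open>auto simp: ndist_def\<close>)
    qed
    ultimately show ?R using L unfolding * by blast
  next
    assume R: ?R
    have "\<forall>\<^sub>F x in F. f x \<in> pts X \<and> ndist X (f x) l < e" if "0 < e" for e
    proof -
      from R have "\<forall>\<^sub>F x in F. f x \<in> pts X" by simp
      moreover from R that have "\<forall>\<^sub>F x in F. dist (nrm X (f x - l)) 0 < e"
        by (intro tendstoD) auto
      ultimately show ?thesis
        by eventually_elim (use R in \<open>auto simp: ndist_def\<close>)
    qed
    with R show ?L unfolding * by blast
  qed
qed

lemma limitin_ntop_scale:
  assumes "limitin (ntop X) f l F" "(k \<longlongrightarrow> c) F"
  shows "limitin (ntop X) (\<lambda>x. s (k x) (f x)) (s c l) F"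
proof -
  from assms have l: "l \<in> pts X" and f: "\<forall>\<^sub>F x in F. f x \<in> pts X"
    and lim: "((\<lambda>x. nrm X (f x - l)) \<longlongrightarrow> 0) F"
    by (auto simp: limitin_ntop_iff)
  have "((\<lambda>x. cmod (k x) * nrm X (f x - l) + cmod (k x - c) * nrm X l) \<longlongrightarrow>
      cmod c * 0 + cmod (c - c) * nrm X l) F"
    by (intro tendsto_intros assms lim)
  then have "((\<lambda>x. cmod (k x) * nrm X (f x - l) + cmod (k x - c) * nrm X l) \<longlongrightarrow> 0) F"
    by simp
  moreover have "\<forall>\<^sub>F x in F. norm (nrm X (s (k x) (f x) - s c l)) \<le>
      cmod (k x) * nrm X (f x - l) + cmod (k x - c) * nrm X l"
    using f
  proof eventually_elim
    case (elim x)
    have "s (k x) (f x) - s c l = s (k x) (f x - l) + s (k x - c) l"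
      by (simp add: scale_left_diff_distrib scale_right_diff_distrib)
    then have "nrm X (s (k x) (f x) - s c l) \<le> nrm X (s (k x) (f x - l)) + nrm X (s (k x - c) l)"
      using elim l by (auto intro!: nrm_triangle)
    moreover have "0 \<le> nrm X (s (k x) (f x) - s c l)"
      using elim l by (auto intro!: nrm_nonneg)
    ultimately show ?case
      using elim l by (auto simp: nrm_scale pts_diff)
  qed
  ultimately have "((\<lambda>x. nrm X (s (k x) (f x) - s c l)) \<longlongrightarrow> 0) F"
    by (rule Lim_null_comparison[rotated])
  with l f show ?thesis
    by (auto simp: limitin_ntop_iff elim!: eventually_mono)
qed

lemma limitin_ntop_add:
  assumes "limitin (ntop X) f l F" "limitin (ntop X) g m F"
  shows "limitin (ntop X) (\<lambda>x. f x + g x) (l + m) F"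
proof -
  from assms have lm: "l \<in> pts X" "m \<in> pts X" and f: "\<forall>\<^sub>F x in F. f x \<in> pts X \<and> g x \<in> pts X"
    and lim: "((\<lambda>x. nrm X (f x - l)) \<longlongrightarrow> 0) F" "((\<lambda>x. nrm X (g x - m)) \<longlongrightarrow> 0) F"
    by (auto simp: limitin_ntop_iff eventually_conj_iff)
  have "((\<lambda>x. nrm X (f x - l) + nrm X (g x - m)) \<longlongrightarrow> 0 + 0) F"
    by (intro tendsto_intros lim)
  moreover have "\<forall>\<^sub>F x in F. norm (nrm X (f x + g x - (l + m))) \<le> nrm X (f x - l) + nrm X (g x - m)"
    using f
  proof eventually_elim
    case (elim x)
    have eq: "f x + g x - (l + m) = (f x - l) + (g x - m)" by simp
    have "f x - l \<in> pts X" "g x - m \<in> pts X" using elim lm by auto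
    then show ?case
      unfolding eq using nrm_nonneg[OF pts_add] nrm_triangle by simp
  qed
  ultimately have "((\<lambda>x. nrm X (f x + g x - (l + m))) \<longlongrightarrow> 0) F"
    by (simp add: Lim_null_comparison[where g = "\<lambda>x. nrm X (f x - l) + nrm X (g x - m)"])
  with lm f show ?thesis
    by (auto simp: limitin_ntop_iff elim!: eventually_mono)
qed

lemma limitin_ntop_const: "l \<in> pts X \<Longrightarrow> limitin (ntop X) (\<lambda>_. l) l F"
  unfolding limitin_ntop_iff by simp

lemma tendsto_nrm:
  assumes "limitin (ntop X) f l F"
  shows "((\<lambda>x. nrm X (f x)) \<longlongrightarrow> nrm X l) F"
proof -
  from assms have l: "l \<in> pts X" and f: "\<forall>\<^sub>F x in F. f x \<in> pts X"
    and lim: "((\<lambda>x. nrm X (f x - l)) \<longlongrightarrow> 0) F"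
    by (auto simp: limitin_ntop_iff)
  have "((\<lambda>x. nrm X (f x) - nrm X l) \<longlongrightarrow> 0) F"
    by (rule Lim_null_comparison[OF _ lim]) (use f l abs_nrm_diff_le in \<open>auto elim!: eventually_mono\<close>)
  then show ?thesis by (simp add: LIM_zero_iff)
qed

lemma C0_intoD:
  assumes "g \<in> C0_into X"
  shows "g t \<in> pts X" "continuous_on UNIV (\<lambda>t. nrm X (g t))"
    "((\<lambda>t. nrm X (g t)) \<longlongrightarrow> 0) at_infinity" "limitin (ntop X) g (g t) (at t)"
    "\<exists>C>0. \<forall>t. nrm X (g t) \<le> C"
proof -
  have lim: "limitin (ntop X) g (g t) (at t)" for t
    using assms continuous_map_top_of_set_iff_limitin[of UNIV "ntop X" g] by (simp add: C0_into_def)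
  show "limitin (ntop X) g (g t) (at t)" by (rule lim)
  show mem: "g t \<in> pts X" for t
    using lim by (auto simp: limitin_ntop_iff)
  show cont: "continuous_on UNIV (\<lambda>t. nrm X (g t))"
    using tendsto_nrm[OF lim] by (simp add: continuous_on_def)
  show zero: "((\<lambda>t. nrm X (g t)) \<longlongrightarrow> 0) at_infinity"
    using assms by (simp add: C0_into_def)
  obtain b where b: "\<And>t. norm t \<ge> b \<Longrightarrow> nrm X (g t) < 1"
  proof -
    have "\<forall>\<^sub>F t in at_infinity. dist (nrm X (g t)) 0 < 1"
      by (rule tendstoD[OF zero]) simp
    then obtain b where "\<forall>t. norm t \<ge> b \<longrightarrow> dist (nrm X (g t)) 0 < 1"
      unfolding eventually_at_infinity by blast
    then show ?thesis
      using nrm_nonneg[OF mem] by (intro that[of b]) auto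
  qed
  have "compact ((\<lambda>t. nrm X (g t)) ` {-b..b})"
    by (intro compact_continuous_image continuous_on_subset[OF cont]) auto
  then obtain C where C: "\<forall>t\<in>{-b..b}. \<bar>nrm X (g t)\<bar> \<le> C"
    by (auto dest!: compact_imp_bounded simp: bounded_iff)
  have "nrm X (g t) \<le> max C 1" for t
  proof (cases "norm t \<ge> b")
    case True
    then show ?thesis using b[of t] by auto
  next
    case False
    then have "t \<in> {-b..b}" by auto
    with C show ?thesis by fastforce
  qed
  then show "\<exists>C>0. \<forall>t. nrm X (g t) \<le> C"
    by (intro exI[of _ "max C 1"]) auto
qed

lemma C0_into_add:
  assumes "f \<in> C0_into X" "g \<in> C0_into X"
  shows "(\<lambda>t. f t + g t) \<in> C0_into X"
proof -
  have "continuous_map (top_of_set UNIV) (ntop X) (\<lambda>t. f t + g t)"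
    unfolding continuous_map_top_of_set_iff_limitin
    by (intro ballI limitin_ntop_add C0_intoD(4) assms)
  moreover have "((\<lambda>t. nrm X (f t + g t)) \<longlongrightarrow> 0) at_infinity"
  proof (rule Lim_null_comparison)
    show "((\<lambda>t. nrm X (f t) + nrm X (g t)) \<longlongrightarrow> 0) at_infinity"
      using tendsto_add[OF C0_intoD(3)[OF assms(1)] C0_intoD(3)[OF assms(2)]] by simp
    show "\<forall>\<^sub>F t in at_infinity. norm (nrm X (f t + g t)) \<le> nrm X (f t) + nrm X (g t)"
      using nrm_nonneg[OF pts_add] nrm_triangle C0_intoD(1)[OF assms(1)] C0_intoD(1)[OF assms(2)]
      by (intro always_eventually allI) simp
  qed
  ultimately show ?thesis by (simp add: C0_into_def)
qed

lemma C0_into_scale: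
  assumes f: "f \<in> C0_into X" and k: "continuous_on UNIV k" "\<And>t. cmod (k t) \<le> C"
  shows "(\<lambda>t. s (k t) (f t)) \<in> C0_into X"
proof -
  have "continuous_map (top_of_set UNIV) (ntop X) (\<lambda>t. s (k t) (f t))"
    unfolding continuous_map_top_of_set_iff_limitin
    using k(1) by (intro ballI limitin_ntop_scale C0_intoD(4) f) (simp add: continuous_on_def)
  moreover have "((\<lambda>t. nrm X (s (k t) (f t))) \<longlongrightarrow> 0) at_infinity"
  proof (rule Lim_null_comparison)
    show "((\<lambda>t. C * nrm X (f t)) \<longlongrightarrow> 0) at_infinity"
      using tendsto_mult_left[OF C0_intoD(3)[OF f], of C] by simp
    show "\<forall>\<^sub>F t in at_infinity. norm (nrm X (s (k t) (f t))) \<le> C * nrm X (f t)"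
      using C0_intoD(1)[OF f] by (intro always_eventually allI)
        (auto simp: nrm_scale abs_mult nrm_nonneg intro!: mult_right_mono k)
  qed
  ultimately show ?thesis by (simp add: C0_into_def)
qed

end

section \<open>Functions on the strip\<close>

lemma strip_eq: "strip = {z. 0 \<le> Re z \<and> Re z \<le> 1}"
proof -
  have eq: "open_strip = Re -` {0<..<1}"
    by (auto simp: open_strip_def)
  have "closure open_strip = {z. 0 \<le> Re z \<and> Re z \<le> 1}"
  proof (rule closure_unique)
    show "open_strip \<subseteq> {z. 0 \<le> Re z \<and> Re z \<le> 1}"
      by (auto simp: open_strip_def)
    show "closed {z. 0 \<le> Re z \<and> Re z \<le> 1}"
      by (intro closed_Collect_conj closed_Collect_le continuous_intros)
    fix T assume T: "open_strip \<subseteq> T" "closed T"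
    show "{z. 0 \<le> Re z \<and> Re z \<le> 1} \<subseteq> T"
    proof
      fix z assume z: "z \<in> {z. 0 \<le> Re z \<and> Re z \<le> 1}"
      \<comment> \<open>Moves \<open>z\<close> horizontally towards the line
        \<open>Re z = 1/2\<close>, hence into the open strip for small \<open>t > 0\<close>.\<close>
      define f where "f t = z + of_real t * (of_real (1/2) - of_real (Re z))" for t :: real
      have "(f \<longlongrightarrow> f 0) (at_right 0)"
        unfolding f_def by (intro tendsto_intros)
      moreover have "\<forall>\<^sub>F t in at_right 0. f t \<in> T"
      proof -
        have "f t \<in> T" if "0 < t" "t < 1" for t
        proof -
          have "Re (f t) = (1 - t) * Re z + t / 2"
            by (simp add: f_def algebra_simps)
          moreover have "0 \<le> (1 - t) * Re z" "(1 - t) * Re z \<le> 1 - t"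
            using that z mult_left_mono[of "Re z" 1 "1 - t"] by auto
          ultimately have "0 < Re (f t)" "Re (f t) < 1"
            using that by linarith+
          then have "f t \<in> open_strip"
            by (simp add: open_strip_def)
          with T show ?thesis by blast
        qed
        then show ?thesis
          unfolding eventually_at_right_field by (intro exI[of _ 1]) auto
      qed
      ultimately have "f 0 \<in> T"
        by (intro Lim_in_closed_set[OF T(2)]) auto
      then show "z \<in> T" by (simp add: f_def)
    qed
  qed
  then show ?thesis by (simp add: strip_def)
qed

lemma open_open_strip: "open open_strip"
  unfolding open_strip_def by (intro open_Collect_conj open_Collect_less continuous_intros)

lemma open_strip_subset: "open_strip \<subseteq> strip"
  unfolding strip_def by (rule closure_subset)

section \<open>The sum of the couple as a normed space\<close>

context interpolation_couple
begin

abbreviation "BS \<equiv> sum_space B0 B1"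

lemma pts_sum: "pts BS = {a0 + a1 |a0 a1. a0 \<in> pts B0 \<and> a1 \<in> pts B1}"
  by (simp add: sum_space_def)

lemma bdd_below_sum_norms:
  "bdd_below {nrm B0 a0 + nrm B1 a1 |a0 a1. a0 \<in> pts B0 \<and> a1 \<in> pts B1 \<and> a = a0 + a1}"
  by (rule bdd_belowI[of _ 0]) (auto intro!: add_nonneg_nonneg B0.nrm_nonneg B1.nrm_nonneg)

lemma nrm_sum_le:
  "a0 \<in> pts B0 \<Longrightarrow> a1 \<in> pts B1 \<Longrightarrow> nrm BS (a0 + a1) \<le> nrm B0 a0 + nrm B1 a1"
  unfolding sum_space_def nspace.simps by (rule cInf_lower[OF _ bdd_below_sum_norms]) blast

lemma nrm_sum_lessE:
  assumes "a \<in> pts BS" "nrm BS a < r"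
  obtains a0 a1 where "a0 \<in> pts B0" "a1 \<in> pts B1" "a = a0 + a1" "nrm B0 a0 + nrm B1 a1 < r"
proof -
  have "{nrm B0 a0 + nrm B1 a1 |a0 a1. a0 \<in> pts B0 \<and> a1 \<in> pts B1 \<and> a = a0 + a1} \<noteq> {}"
    using assms(1) by (auto simp: pts_sum)
  from cInf_lessD[OF this] assms(2) that show ?thesis
    by (auto simp: sum_space_def)
qed

text \<open>Both embeddings enter here, to make the sum norm definite: a vector of sum norm 0 has
  decompositions with both norms tending to 0, so the constant sequence tends to 0 in the ambient
  Hausdorff topology.\<close>

lemma tendsto_zero_of_nrm:
  assumes "\<And>n. f n \<in> pts B0" "(\<lambda>n. nrm B0 (f n)) \<longlonglongrightarrow> 0"
    and "\<And>n. g n \<in> pts B1" "(\<lambda>n. nrm B1 (g n)) \<longlonglongrightarrow> 0"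
  shows "(\<lambda>n. f n + g n) \<longlonglongrightarrow> 0"
proof -
  have "limitin (ntop B0) f 0 sequentially"
    using assms(1,2) by (simp add: B0.limitin_ntop_iff)
  from continuous_map_limit[OF embedding_0 this] have "f \<longlonglongrightarrow> 0"
    by (simp add: o_def)
  moreover have "limitin (ntop B1) g 0 sequentially"
    using assms(3,4) by (simp add: B1.limitin_ntop_iff)
  from continuous_map_limit[OF embedding_1 this] have "g \<longlonglongrightarrow> 0"
    by (simp add: o_def)
  ultimately have "(\<lambda>n. f n + g n) \<longlonglongrightarrow> 0 + 0"
    by (rule tendsto_add)
  then show ?thesis by simp
qed

lemma nrm_sum_scale_le:
  assumes a: "a \<in> pts BS"
  shows "nrm BS (s c a) \<le> cmod c * nrm BS a"
proof (cases "c = 0")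
  case True
  then show ?thesis
    using nrm_sum_le[of 0 0] by simp
next
  case False
  show ?thesis
  proof (rule field_le_epsilon)
    fix e :: real assume "0 < e"
    then have "nrm BS a < nrm BS a + e / cmod c" using False by simp
    from nrm_sum_lessE[OF a this] obtain a0 a1 where a01: "a0 \<in> pts B0" "a1 \<in> pts B1" "a = a0 + a1"
      "nrm B0 a0 + nrm B1 a1 < nrm BS a + e / cmod c" .
    have "nrm BS (s c a) \<le> nrm B0 (s c a0) + nrm B1 (s c a1)"
      using nrm_sum_le[OF B0.pts_scale[OF a01(1)] B1.pts_scale[OF a01(2)], of c c] a01(3)
      by (simp add: B0.scale_right_distrib)
    also have "\<dots> = cmod c * (nrm B0 a0 + nrm B1 a1)"
      using a01 by (simp add: B0.nrm_scale B1.nrm_scale algebra_simps)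
    also have "\<dots> \<le> cmod c * (nrm BS a + e / cmod c)"
      using a01 by (intro mult_left_mono) auto
    also have "\<dots> = cmod c * nrm BS a + e"
      using False by (simp add: field_simps)
    finally show "nrm BS (s c a) \<le> cmod c * nrm BS a + e" .
  qed
qed

lemma pts_sum_scale: "a \<in> pts BS \<Longrightarrow> s c a \<in> pts BS"
  unfolding pts_sum using B0.pts_scale B1.pts_scale by (fastforce simp: B0.scale_right_distrib)

end

sublocale interpolation_couple \<subseteq> BS: complex_normed_space s "sum_space B0 B1"
proof
  show "B0.subspace (pts BS)"
    using B0.subspace_sums[OF B0.subspace_pts B1.subspace_pts] by (simp add: pts_sum)
  fix a b c
  assume a: "a \<in> pts BS"
  show "a = 0" if 0: "nrm BS a = 0"
  proof -
    have "\<exists>a0 a1. a0 \<in> pts B0 \<and> a1 \<in> pts B1 \<and> a = a0 + a1 \<and> nrm B0 a0 + nrm B1 a1 < inverse (real (Suc n))"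
      for n
      by (rule nrm_sum_lessE[OF a, of "inverse (real (Suc n))"]) (use 0 in auto)
    then obtain f g where fg: "\<And>n. f n \<in> pts B0" "\<And>n. g n \<in> pts B1" "\<And>n. a = f n + g n"
      "\<And>n. nrm B0 (f n) + nrm B1 (g n) < inverse (real (Suc n))"
      by metis
    have nn: "0 \<le> nrm B0 (f n)" "0 \<le> nrm B1 (g n)" for n
      using B0.nrm_nonneg B1.nrm_nonneg fg by auto
    have "(\<lambda>n. nrm B0 (f n)) \<longlonglongrightarrow> 0"
      by (rule Lim_null_comparison[OF _ LIMSEQ_inverse_real_of_nat])
        (use fg(4) nn in \<open>intro always_eventually allI, smt (verit) real_norm_def\<close>)
    moreover have "(\<lambda>n. nrm B1 (g n)) \<longlonglongrightarrow> 0"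
      by (rule Lim_null_comparison[OF _ LIMSEQ_inverse_real_of_nat])
        (use fg(4) nn in \<open>intro always_eventually allI, smt (verit) real_norm_def\<close>)
    ultimately have "(\<lambda>n. f n + g n) \<longlonglongrightarrow> 0"
      using fg by (intro tendsto_zero_of_nrm)
    then have "(\<lambda>n::nat. a) \<longlonglongrightarrow> 0"
      by (simp flip: fg(3))
    then show ?thesis
      by (simp add: LIMSEQ_const_iff)
  qed
  show "nrm BS (a + b) \<le> nrm BS a + nrm BS b" if b: "b \<in> pts BS"
  proof (rule field_le_epsilon)
    fix e :: real assume e: "0 < e"
    obtain a0 a1 where a01: "a0 \<in> pts B0" "a1 \<in> pts B1" "a = a0 + a1"
      "nrm B0 a0 + nrm B1 a1 < nrm BS a + e / 2"
      using nrm_sum_lessE[OF a, of "nrm BS a + e / 2"] e by auto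
    obtain b0 b1 where b01: "b0 \<in> pts B0" "b1 \<in> pts B1" "b = b0 + b1"
      "nrm B0 b0 + nrm B1 b1 < nrm BS b + e / 2"
      using nrm_sum_lessE[OF b, of "nrm BS b + e / 2"] e by auto
    have "nrm BS (a + b) \<le> nrm B0 (a0 + b0) + nrm B1 (a1 + b1)"
      using nrm_sum_le[OF B0.pts_add[OF a01(1) b01(1)] B1.pts_add[OF a01(2) b01(2)]]
      by (simp add: a01(3) b01(3) algebra_simps)
    also have "\<dots> \<le> (nrm B0 a0 + nrm B0 b0) + (nrm B1 a1 + nrm B1 b1)"
      using a01 b01 by (intro add_mono B0.nrm_triangle B1.nrm_triangle)
    finally show "nrm BS (a + b) \<le> nrm BS a + nrm BS b + e"
      using a01(4) b01(4) by linarith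
  qed
  show "nrm BS (s c a) = cmod c * nrm BS a"
  proof (cases "c = 0")
    case True
    have "\<not> nrm BS 0 < 0"
    proof
      assume "nrm BS 0 < 0"
      moreover have "0 \<in> pts BS"
        using pts_sum_scale[OF a, of 0] by simp
      ultimately obtain a0 a1 where "a0 \<in> pts B0" "a1 \<in> pts B1" "nrm B0 a0 + nrm B1 a1 < 0"
        by (metis nrm_sum_lessE)
      then show False
        using B0.nrm_nonneg[of a0] B1.nrm_nonneg[of a1] by linarith
    qed
    then have "nrm BS 0 = 0"
      using nrm_sum_le[of 0 0] by simp
    then show ?thesis using True by simp
  next
    case False
    have "nrm BS a = nrm BS (s (inverse c) (s c a))"
      using False by simp
    also have "\<dots> \<le> cmod (inverse c) * nrm BS (s c a)"
      using pts_sum_scale[OF a] by (rule nrm_sum_scale_le)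
    finally have "cmod c * nrm BS a \<le> nrm BS (s c a)"
      using False by (simp add: norm_divide field_simps)
    with nrm_sum_scale_le[OF a, of c] show ?thesis by simp
  qed
qed

section \<open>Operations on the function space \<F>\<close>

context interpolation_couple
begin

abbreviation "\<F> \<equiv> interp_functions s B0 B1"

lemma interp_functionsD:
  assumes "F \<in> \<F>"
  shows "z \<in> strip \<Longrightarrow> F z \<in> pts BS"
    "\<exists>C. \<forall>z\<in>strip. nrm BS (F z) \<le> C"
    "z \<in> strip \<Longrightarrow> limitin (ntop BS) F (F z) (at z within strip)"
    "holomorphic_into s BS F open_strip"
    "(\<lambda>t. F (Complex 0 t)) \<in> C0_into B0"
    "(\<lambda>t. F (Complex 1 t)) \<in> C0_into B1"
  using assms unfolding interp_functions_def continuous_map_top_of_set_iff_limitin by auto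

lemma interp_functionsI:
  assumes "\<And>z. z \<in> strip \<Longrightarrow> limitin (ntop BS) F (F z) (at z within strip)"
    "\<And>z. z \<in> strip \<Longrightarrow> nrm BS (F z) \<le> C"
    "holomorphic_into s BS F open_strip"
    "(\<lambda>t. F (Complex 0 t)) \<in> C0_into B0"
    "(\<lambda>t. F (Complex 1 t)) \<in> C0_into B1"
  shows "F \<in> \<F>"
  using assms unfolding interp_functions_def continuous_map_top_of_set_iff_limitin
  by (auto simp: BS.limitin_ntop_iff)

lemma interp_functions_add:
  assumes F: "F \<in> \<F>" and G: "G \<in> \<F>"
  shows "(\<lambda>z. F z + G z) \<in> \<F>"
proof -
  obtain C D where CD: "\<And>z. z \<in> strip \<Longrightarrow> nrm BS (F z) \<le> C" "\<And>z. z \<in> strip \<Longrightarrow> nrm BS (G z) \<le> D"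
    using interp_functionsD(2)[OF F] interp_functionsD(2)[OF G] by auto
  show ?thesis
  proof (rule interp_functionsI[where C = "C + D"])
    show "nrm BS (F z + G z) \<le> C + D" if "z \<in> strip" for z
      using BS.nrm_triangle[OF interp_functionsD(1)[OF F that] interp_functionsD(1)[OF G that]]
        CD[OF that] by simp
    show "holomorphic_into s BS (\<lambda>z. F z + G z) open_strip"
      unfolding holomorphic_into_def
    proof
      fix z assume z: "z \<in> open_strip"
      obtain D E where "limitin (ntop BS) (\<lambda>w. s (1 / (w - z)) (F w - F z)) D (at z)"
        "limitin (ntop BS) (\<lambda>w. s (1 / (w - z)) (G w - G z)) E (at z)"
        using interp_functionsD(4)[OF F] interp_functionsD(4)[OF G] z
        unfolding holomorphic_into_def by blast
      from BS.limitin_ntop_add[OF this]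
      show "\<exists>D. limitin (ntop BS) (\<lambda>w. s (1 / (w - z)) (F w + G w - (F z + G z))) D (at z)"
        by (auto simp: B0.scale_right_distrib B0.scale_right_diff_distrib algebra_simps)
    qed
  qed (intro BS.limitin_ntop_add interp_functionsD B0.C0_into_add B1.C0_into_add F G; assumption)+
qed

text \<open>Scalar multipliers are the means of changing boundary norms: outer functions in Jensen's
  inequality, exponentials in the separation argument, constants for rotations and
  rescaling.\<close>

lemma interp_functions_scale:
  assumes F: "F \<in> \<F>" and k: "continuous_on strip k" "k holomorphic_on open_strip"
    and C: "\<And>z. z \<in> strip \<Longrightarrow> cmod (k z) \<le> C"
  shows "(\<lambda>z. s (k z) (F z)) \<in> \<F>"
proof -
  obtain D where D: "\<And>z. z \<in> strip \<Longrightarrow> nrm BS (F z) \<le> D"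
    using interp_functionsD(2)[OF F] by auto
  have side: "(\<lambda>t. Complex j t) ` UNIV \<subseteq> strip" if "j = 0 \<or> j = 1" for j
    using that by (auto simp: strip_eq)
  have cont: "continuous_on UNIV (\<lambda>t. k (Complex j t))" if "j = 0 \<or> j = 1" for j
    by (rule continuous_on_compose2[OF k(1)]) (use side[OF that] in \<open>auto simp: Complex_eq intro!: continuous_intros\<close>)
  show ?thesis
  proof (rule interp_functionsI[where C = "C * D"])
    fix z assume z: "z \<in> strip"
    show "limitin (ntop BS) (\<lambda>z. s (k z) (F z)) (s (k z) (F z)) (at z within strip)"
      using k(1) z by (intro BS.limitin_ntop_scale interp_functionsD(3) F) (auto simp: continuous_on_def)
    have "cmod (k z) * nrm BS (F z) \<le> C * D"
      using C[OF z] D[OF z] BS.nrm_nonneg[OF interp_functionsD(1)[OF F z]] norm_ge_zero[of "k z"]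
      by (intro mult_mono) linarith+
    then show "nrm BS (s (k z) (F z)) \<le> C * D"
      using BS.nrm_scale[OF interp_functionsD(1)[OF F z]] by simp
  next
    show "holomorphic_into s BS (\<lambda>z. s (k z) (F z)) open_strip"
      unfolding holomorphic_into_def
    proof
      fix z assume z: "z \<in> open_strip"
      obtain D where D: "limitin (ntop BS) (\<lambda>w. s (1 / (w - z)) (F w - F z)) D (at z)"
        using interp_functionsD(4)[OF F] z unfolding holomorphic_into_def by blast
      obtain k' where k': "(k has_field_derivative k') (at z)"
        using k(2) z open_open_strip by (metis holomorphic_derivI)
      then have "((\<lambda>w. (k w - k z) / (w - z)) \<longlongrightarrow> k') (at z)"
        by (simp add: has_field_derivative_iff)
      moreover have "F z \<in> pts BS"
        using interp_functionsD(1)[OF F] z open_strip_subset by auto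
      moreover have "(k \<longlongrightarrow> k z) (at z)"
        using DERIV_isCont[OF k'] by (simp add: isCont_def)
      ultimately have "limitin (ntop BS) (\<lambda>w. s (k w) (s (1 / (w - z)) (F w - F z)) +
          s ((k w - k z) / (w - z)) (F z)) (s (k z) D + s k' (F z)) (at z)"
        by (intro BS.limitin_ntop_add BS.limitin_ntop_scale D BS.limitin_ntop_const)
      moreover have "s (k w) (s (1 / (w - z)) (F w - F z)) + s ((k w - k z) / (w - z)) (F z) =
          s (1 / (w - z)) (s (k w) (F w) - s (k z) (F z))" for w
        by (simp add: B0.scale_right_diff_distrib B0.scale_left_diff_distrib diff_divide_distrib)
      ultimately show "\<exists>D. limitin (ntop BS) (\<lambda>w. s (1 / (w - z)) (s (k w) (F w) - s (k z) (F z))) D (at z)"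
        by auto
    qed
    show "(\<lambda>t. s (k (Complex 0 t)) (F (Complex 0 t))) \<in> C0_into B0"
      using side[of 0] by (intro B0.C0_into_scale[where C = C] interp_functionsD F cont C) auto
    show "(\<lambda>t. s (k (Complex 1 t)) (F (Complex 1 t))) \<in> C0_into B1"
      using side[of 1] by (intro B1.C0_into_scale[where C = C] interp_functionsD F cont C) auto
  qed
qed

lemma interp_functions_scale_const: "F \<in> \<F> \<Longrightarrow> (\<lambda>z. s c (F z)) \<in> \<F>"
  by (rule interp_functions_scale[where C = "cmod c"]) auto

lemma interp_functions_zero: "(\<lambda>z. 0) \<in> \<F>"
proof (rule interp_functionsI[where C = 0])
  show "holomorphic_into s BS (\<lambda>z. 0) open_strip"
    unfolding holomorphic_into_def by (auto intro!: exI[of _ 0])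
  show "(\<lambda>t. 0) \<in> C0_into B0" "(\<lambda>t. 0) \<in> C0_into B1"
    unfolding C0_into_def using B0.limitin_ntop_const[of 0] B1.limitin_ntop_const[of 0]
      continuous_map_top_of_set_iff_limitin[of UNIV "ntop B0" "\<lambda>t. 0"]
      continuous_map_top_of_set_iff_limitin[of UNIV "ntop B1" "\<lambda>t. 0"]
    by auto
  show "limitin (ntop BS) (\<lambda>z. 0) 0 (at z within strip)" for z
    by (rule BS.limitin_ntop_const) simp
qed simp

lemma interp_functions_boundary:
  assumes "F \<in> \<F>"
  shows "F (Complex 0 t) \<in> pts B0" "F (Complex 1 t) \<in> pts B1"
  using B0.C0_intoD(1)[OF interp_functionsD(5)[OF assms]]
    B1.C0_intoD(1)[OF interp_functionsD(6)[OF assms]] by auto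

lemma interp_function_norm_le_iff:
  assumes F: "F \<in> \<F>"
  shows "interp_function_norm B0 B1 F \<le> r \<longleftrightarrow>
    (\<forall>t. nrm B0 (F (Complex 0 t)) \<le> r \<and> nrm B1 (F (Complex 1 t)) \<le> r)"
proof -
  have "bdd_above (range (\<lambda>t. nrm B0 (F (Complex 0 t))))"
    using B0.C0_intoD(5)[OF interp_functionsD(5)[OF F]] by (auto intro: bdd_aboveI2)
  moreover have "bdd_above (range (\<lambda>t. nrm B1 (F (Complex 1 t))))"
    using B1.C0_intoD(5)[OF interp_functionsD(6)[OF F]] by (auto intro: bdd_aboveI2)
  ultimately show ?thesis
    unfolding interp_function_norm_def by (auto simp: cSUP_le_iff)
qed

end

section \<open>The conformal map onto the disc\<close>

text \<open>The variable is \<open>w = exp (\<i> * pi * z)\<close>, which is real on the boundary of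
  the strip: \<open>w > 0\<close> on the imaginary axis and \<open>w < 0\<close> on
  \<open>Re z = 1\<close>, with \<open>Im z = - ln \<bar>w\<bar> / pi\<close> on both. The points 0
  and infinity stand for the two ends of the strip, where functions in \<F> vanish on the
  boundary.\<close>

definition glue :: "(real \<Rightarrow> real) \<Rightarrow> (real \<Rightarrow> real) \<Rightarrow> real \<Rightarrow> real" where
  "glue f g w = (if w > 0 then f (- ln w / pi) else if w < 0 then g (- ln (- w) / pi) else 0)"

lemma glue_limits:
  assumes "continuous_on UNIV f" "(f \<longlongrightarrow> 0) at_infinity"
    and "continuous_on UNIV g" "(g \<longlongrightarrow> 0) at_infinity"
  shows "continuous_on UNIV (glue f g)" "(glue f g \<longlongrightarrow> 0) at_infinity"
proof -
  have top: "((\<lambda>w. h (- ln w / pi)) \<longlongrightarrow> 0) at_top" "((\<lambda>w. h (- ln w / pi)) \<longlongrightarrow> 0) (at_right 0)"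
    if "(h \<longlongrightarrow> 0) at_infinity" for h :: "real \<Rightarrow> real"
  proof -
    have "(h \<longlongrightarrow> 0) at_top" "(h \<longlongrightarrow> 0) at_bot"
      by (rule tendsto_mono[OF _ that]; simp add: at_top_le_at_infinity at_bot_le_at_infinity)+
    moreover have "filterlim (\<lambda>w. - ln w / pi) at_bot at_top"
      using filterlim_tendsto_pos_mult_at_bot[OF tendsto_const, of "1 / pi" "\<lambda>w. - ln w" at_top]
      by (simp add: filterlim_uminus_at_bot ln_at_top)
    moreover have "filterlim (\<lambda>w. - ln w / pi) at_top (at_right 0)"
      using filterlim_tendsto_pos_mult_at_top[OF tendsto_const, of "1 / pi" "\<lambda>w. - ln w" "at_right 0"]
      by (simp add: filterlim_uminus_at_top ln_at_0)
    ultimately show "((\<lambda>w. h (- ln w / pi)) \<longlongrightarrow> 0) at_top"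
      "((\<lambda>w. h (- ln w / pi)) \<longlongrightarrow> 0) (at_right 0)"
      by (auto intro: filterlim_compose[where g = h])
  qed
  have r: "(glue f g \<longlongrightarrow> 0) (at_right 0)"
    using top(2)[OF assms(2)]
    by (rule Lim_transform_eventually) (auto simp: glue_def eventually_at_right_field intro!: exI[of _ 1])
  have l: "(glue f g \<longlongrightarrow> 0) (at_left 0)"
    unfolding filterlim_at_left_to_right
    using top(2)[OF assms(4)]
    by (simp, rule_tac Lim_transform_eventually)
      (auto simp: glue_def eventually_at_right_field intro!: exI[of _ 1])
  have at0: "isCont (glue f g) 0"
    unfolding isCont_def using filterlim_split_at[OF l r] by (simp add: glue_def)
  have "isCont (glue f g) w" if w: "w > 0" for w
  proof -
    have "isCont (\<lambda>w. f (- ln w / pi)) w"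
    proof (rule isCont_o2[where f = "\<lambda>w. - ln w / pi"])
      show "isCont (\<lambda>w. - ln w / pi) w" using w by (auto intro!: continuous_intros)
    qed (use assms(1) in \<open>simp add: continuous_on_eq_continuous_at\<close>)
    moreover have "\<forall>\<^sub>F x in nhds w. glue f g x = f (- ln x / pi)"
      using eventually_nhds_in_open[of "{0<..}" w] w by (auto simp: glue_def elim!: eventually_mono)
    ultimately show ?thesis by (rule iffD2[OF isCont_cong, rotated])
  qed
  moreover have "isCont (glue f g) w" if w: "w < 0" for w
  proof -
    have "isCont (\<lambda>w. g (- ln (- w) / pi)) w"
    proof (rule isCont_o2[where f = "\<lambda>w. - ln (- w) / pi"])
      show "isCont (\<lambda>w. - ln (- w) / pi) w" using w by (auto intro!: continuous_intros)
    qed (use assms(3) in \<open>simp add: continuous_on_eq_continuous_at\<close>)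
    moreover have "\<forall>\<^sub>F x in nhds w. glue f g x = g (- ln (- x) / pi)"
      using eventually_nhds_in_open[of "{..<0}" w] w by (auto simp: glue_def elim!: eventually_mono)
    ultimately show ?thesis by (rule iffD2[OF isCont_cong, rotated])
  qed
  ultimately show "continuous_on UNIV (glue f g)"
    unfolding continuous_on_eq_continuous_at[OF open_UNIV] using at0
    by (intro ballI) (metis linorder_neqE_linordered_idom)
  have "(glue f g \<longlongrightarrow> 0) at_top"
    using top(1)[OF assms(2)] by (rule Lim_transform_eventually)
      (auto simp: glue_def intro!: eventually_mono[OF eventually_gt_at_top[of 0]])
  moreover have "(glue f g \<longlongrightarrow> 0) at_bot"
    unfolding filterlim_at_bot_mirror using top(1)[OF assms(4)] by (rule Lim_transform_eventually)
      (auto simp: glue_def intro!: eventually_mono[OF eventually_gt_at_top[of 0]])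
  ultimately show "(glue f g \<longlongrightarrow> 0) at_infinity"
    by (simp add: at_infinity_eq_at_top_bot filterlim_sup)
qed

locale complex_interpolation = interpolation_couple +
  fixes \<theta> :: real
  assumes \<theta>: "0 < \<theta>" "\<theta> < 1"
begin

text \<open>The image of \<theta> under \<open>exp (\<i> * pi * z)\<close>, which maps the open
  strip onto the upper half-plane.\<close>

definition "\<omega> = cis (pi * \<theta>)"

text \<open>The conformal map of the strip onto the unit disc that sends \<open>\<theta>\<close> to 0; its inverse on
  the boundary is given by \<open>height\<close>, the value of \<open>exp (\<i> \<pi> z)\<close>.\<close>

definition disc_map :: "complex \<Rightarrow> complex" where
  "disc_map z = (exp (\<i> * pi * z) - \<omega>) / (exp (\<i> * pi * z) - cnj \<omega>)"

definition height :: "complex \<Rightarrow> real" where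
  "height \<zeta> = Re ((\<omega> - cnj \<omega> * \<zeta>) / (1 - \<zeta>))"

lemma pi_\<theta>: "0 < pi * \<theta>" "pi * \<theta> < pi"
  using \<theta> by simp_all

lemma Im_\<omega>: "0 < Im \<omega>"
  using \<theta> by (simp add: \<omega>_def sin_gt_zero)

lemma Im_exp_strip:
  assumes "z \<in> strip"
  shows "0 \<le> Im (exp (\<i> * pi * z))"
proof -
  have "0 \<le> sin (pi * Re z)"
    using assms by (intro sin_ge_zero) (auto simp: strip_eq mult_left_le)
  then show ?thesis by (simp add: Im_exp)
qed

lemma disc_map_denominator:
  assumes "z \<in> strip"
  shows "exp (\<i> * pi * z) - cnj \<omega> \<noteq> 0"
proof -
  have "Im (exp (\<i> * pi * z) - cnj \<omega>) > 0"
    using Im_exp_strip[OF assms] Im_\<omega> by simp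
  then show ?thesis by auto
qed

text \<open>A point of the closed upper half-plane is at least as close to \<omega> as to its
  conjugate; the squared distances differ by \<open>4 * Im w * Im \<omega>\<close>.\<close>

lemma norm_disc_map_le:
  assumes "z \<in> strip"
  shows "cmod (disc_map z) \<le> 1"
proof -
  let ?w = "exp (\<i> * pi * z)"
  have "(cmod (?w - cnj \<omega>))\<^sup>2 - (cmod (?w - \<omega>))\<^sup>2 = 4 * Im ?w * Im \<omega>"
    by (simp only: cmod_power2) (simp add: power2_eq_square algebra_simps)
  moreover have "0 \<le> Im ?w * Im \<omega>"
    using Im_exp_strip[OF assms] Im_\<omega> by simp
  ultimately have "(cmod (?w - \<omega>))\<^sup>2 \<le> (cmod (?w - cnj \<omega>))\<^sup>2" by linarith
  then have "cmod (?w - \<omega>) \<le> cmod (?w - cnj \<omega>)"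
    by (rule power2_le_imp_le) simp
  with disc_map_denominator[OF assms] show ?thesis
    by (simp add: disc_map_def norm_divide)
qed

lemma norm_disc_map_boundary:
  assumes "exp (\<i> * pi * z) = of_real w"
  shows "cmod (disc_map z) = 1"
proof -
  have "of_real w - cnj \<omega> = cnj (of_real w - \<omega>)" by simp
  then have "cmod (of_real w - cnj \<omega>) = cmod (of_real w - \<omega>)"
    by (simp only: complex_mod_cnj)
  moreover have "of_real w - \<omega> \<noteq> 0"
    using Im_\<omega> by (auto simp: complex_eq_iff)
  ultimately show ?thesis
    unfolding disc_map_def assms norm_divide by simp
qed

lemma height_disc_map:
  assumes "exp (\<i> * pi * z) = of_real w"
  shows "height (disc_map z) = w"
proof -
  have d: "of_real w - cnj \<omega> \<noteq> 0" "\<omega> - cnj \<omega> \<noteq> 0"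
    using Im_\<omega> by (auto simp: complex_eq_iff)
  have "\<omega> - cnj \<omega> * disc_map z = of_real w * (\<omega> - cnj \<omega>) / (of_real w - cnj \<omega>)"
    unfolding disc_map_def assms using d by (simp add: field_simps)
  moreover have "1 - disc_map z = (\<omega> - cnj \<omega>) / (of_real w - cnj \<omega>)"
    unfolding disc_map_def assms using d by (simp add: field_simps)
  ultimately have "(\<omega> - cnj \<omega> * disc_map z) / (1 - disc_map z) = of_real w"
    using d by simp
  then show ?thesis by (simp add: height_def)
qed

lemma disc_map_\<theta> [simp]: "disc_map (of_real \<theta>) = 0"
  by (simp add: disc_map_def \<omega>_def cis_conv_exp mult.assoc)

lemma continuous_on_disc_map: "continuous_on strip disc_map"
  unfolding disc_map_def using disc_map_denominator by (auto intro!: continuous_intros)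

lemma holomorphic_disc_map: "disc_map holomorphic_on open_strip"
  unfolding disc_map_def using disc_map_denominator open_strip_subset
  by (auto intro!: holomorphic_intros)

lemma exp_boundary:
  "exp (\<i> * pi * Complex 0 t) = of_real (exp (- pi * t))"
  "exp (\<i> * pi * Complex 1 t) = of_real (- exp (- pi * t))"
proof -
  have "\<i> * pi * Complex 0 t = of_real (- pi * t)"
    by (simp add: complex_eq_iff)
  then show "exp (\<i> * pi * Complex 0 t) = of_real (exp (- pi * t))"
    by (simp only: exp_of_real)
  have "\<i> * pi * Complex 1 t = of_real (- pi * t) + \<i> * pi"
    by (simp add: complex_eq_iff)
  then show "exp (\<i> * pi * Complex 1 t) = of_real (- exp (- pi * t))"
    by (simp only: exp_add exp_of_real) simp
qed

text \<open>The half-angle form shows that the quotient is real on the circle and gives its sign: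
  the angles between 0 and \<open>2 * pi * \<theta>\<close> belong to the line
  \<open>Re z = 1\<close>, those between \<open>2 * pi * \<theta>\<close> and \<open>2 * pi\<close>
  to the imaginary axis.\<close>

lemma height_cis_complex:
  assumes "0 < t" "t < 2 * pi"
  shows "(\<omega> - cnj \<omega> * cis t) / (1 - cis t) = of_real (sin (t / 2 - pi * \<theta>) / sin (t / 2))"
proof -
  define a b where "a = t / 2" and "b = pi * \<theta> - a"
  have diff: "cis x - cis (- x) = 2 * \<i> * sin x" for x
    by (simp add: complex_eq_iff)
  have "\<omega> = cis a * cis b" "cnj \<omega> * cis t = cis a * cis (- b)"
    by (simp_all add: \<omega>_def b_def cis_mult cis_cnj) (simp add: a_def)
  then have "\<omega> - cnj \<omega> * cis t = cis a * (cis b - cis (- b))"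
    by (simp add: algebra_simps)
  then have num: "\<omega> - cnj \<omega> * cis t = cis a * (2 * \<i> * sin b)"
    by (simp only: diff)
  have "1 = cis a * cis (- a)" "cis t = cis a * cis a"
    by (simp_all add: cis_mult a_def)
  then have "1 - cis t = - (cis a * (cis a - cis (- a)))"
    by (simp add: algebra_simps)
  then have den: "1 - cis t = - (cis a * (2 * \<i> * sin a))"
    by (simp only: diff)
  have "sin a > 0"
    using assms by (intro sin_gt_zero) (auto simp: a_def)
  then have "(\<omega> - cnj \<omega> * cis t) / (1 - cis t) = of_real (- sin b / sin a)"
    unfolding num den by (simp add: field_simps)
  also have "- sin b = sin (a - pi * \<theta>)"
    unfolding b_def by (metis minus_diff_eq sin_minus)
  finally show ?thesis by (simp add: a_def)
qed

lemma height_cis: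
  assumes "0 < t" "t < 2 * pi"
  shows "height (cis t) = sin (t / 2 - pi * \<theta>) / sin (t / 2)"
  unfolding height_def height_cis_complex[OF assms] by simp

lemma height_cis_pos:
  assumes "2 * pi * \<theta> < t" "t < 2 * pi"
  shows "0 < height (cis t)"
proof -
  have t: "0 < t" using assms pi_\<theta> by simp
  have "t / 2 - pi * \<theta> < pi"
    using assms(2) pi_\<theta>(1) by linarith
  with assms t have "0 < sin (t / 2)" "0 < sin (t / 2 - pi * \<theta>)"
    by (auto intro!: sin_gt_zero)
  with height_cis[OF t assms(2)] show ?thesis by simp
qed

lemma height_cis_neg:
  assumes "0 < t" "t < 2 * pi * \<theta>"
  shows "height (cis t) < 0"
proof -
  have t: "t < 2 * pi" using assms(2) pi_\<theta>(2) by linarith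
  have "pi * \<theta> - t / 2 < pi"
    using assms(1) pi_\<theta>(2) by linarith
  with assms t have "0 < sin (t / 2)" "0 < sin (pi * \<theta> - t / 2)"
    by (auto intro!: sin_gt_zero)
  moreover have "sin (t / 2 - pi * \<theta>) = - sin (pi * \<theta> - t / 2)"
    by (metis minus_diff_eq sin_minus)
  ultimately show ?thesis
    using height_cis[OF assms(1) t] by (simp add: divide_neg_pos)
qed

lemma height_ends [simp]: "height 1 = 0" "height (cis (2 * pi * \<theta>)) = 0"
proof -
  show "height 1 = 0" by (simp add: height_def)
  show "height (cis (2 * pi * \<theta>)) = 0"
    using height_cis[of "2 * pi * \<theta>"] \<theta> by simp
qed

text \<open>The critical point is 1, where \<open>height\<close> blows up along the circle while
  division by zero gives \<open>height 1 = 0\<close>. The limit of \<open>k\<close> at infinity must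
  therefore be \<open>k 0\<close>.\<close>

lemma continuous_on_circle_height:
  assumes k: "continuous_on UNIV k" "(k \<longlongrightarrow> k 0) at_infinity"
  shows "continuous_on (sphere 0 1) (\<lambda>\<zeta>. k (height \<zeta>))"
  unfolding continuous_on_eq_continuous_within
proof
  fix \<zeta> :: complex assume \<zeta>: "\<zeta> \<in> sphere 0 1"
  show "continuous (at \<zeta> within sphere 0 1) (\<lambda>\<zeta>. k (height \<zeta>))"
  proof (cases "\<zeta> = 1")
    case False
    have "isCont height \<zeta>"
      unfolding height_def using False by (auto intro!: continuous_intros isCont_Re)
    then have "isCont (\<lambda>\<zeta>. k (height \<zeta>)) \<zeta>"
      by (rule isCont_o2) (use k(1) in \<open>simp add: continuous_on_eq_continuous_at\<close>)
    then show ?thesis by (rule continuous_at_imp_continuous_within)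
  next
    case True
    let ?q = "\<lambda>\<zeta>. (\<omega> - cnj \<omega> * \<zeta>) / (1 - \<zeta>)"
    let ?F = "at 1 within sphere 0 1"
    have "filterlim ?q at_infinity ?F"
    proof (rule filterlim_divide_at_infinity)
      show "((\<lambda>\<zeta>. \<omega> - cnj \<omega> * \<zeta>) \<longlongrightarrow> \<omega> - cnj \<omega> * 1) ?F"
        by (intro tendsto_intros)
      have "((\<lambda>\<zeta>::complex. 1 - \<zeta>) \<longlongrightarrow> 1 - 1) ?F" by (intro tendsto_intros)
      then show "filterlim (\<lambda>\<zeta>::complex. 1 - \<zeta>) (at 0) ?F"
        by (auto simp: filterlim_at eventually_at_filter)
      show "\<omega> - cnj \<omega> * 1 \<noteq> 0"
        using Im_\<omega> by (auto simp: complex_eq_iff)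
    qed
    then have "filterlim (\<lambda>\<zeta>. norm (?q \<zeta>)) at_top ?F"
      by (rule filterlim_at_infinity_imp_norm_at_top)
    \<comment> \<open>The quotient is real on the circle, so taking its real part in
      \<open>height\<close> does not change its modulus.\<close>
    moreover have "\<forall>\<^sub>F \<zeta> in ?F. norm (?q \<zeta>) = norm (height \<zeta>)"
      unfolding eventually_at_filter
    proof (intro always_eventually allI impI)
      fix \<zeta> :: complex assume \<zeta>: "\<zeta> \<noteq> 1" "\<zeta> \<in> sphere 0 1"
      then have "cis (Arg2pi \<zeta>) = \<zeta>"
        using Arg2pi[of \<zeta>] by (simp add: cis_conv_exp is_Arg_def)
      moreover from this \<zeta>(1) have "Arg2pi \<zeta> \<noteq> 0" by auto
      ultimately show "norm (?q \<zeta>) = norm (height \<zeta>)"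
        using height_cis_complex[of "Arg2pi \<zeta>"] Arg2pi_ge_0[of \<zeta>] Arg2pi_lt_2pi[of \<zeta>]
        by (simp add: height_def norm_divide)
    qed
    ultimately have "filterlim (\<lambda>\<zeta>. norm (height \<zeta>)) at_top ?F"
      by (simp cong: filterlim_cong)
    then have "filterlim height at_infinity ?F"
      by (rule filterlim_norm_at_top_imp_at_infinity)
    from filterlim_compose[OF k(2) this] show ?thesis
      using True by (simp add: continuous_within)
  qed
qed

end

section \<open>Jensen's inequality\<close>

context complex_interpolation
begin

definition boundary_norm :: "(complex \<Rightarrow> 'a) \<Rightarrow> real \<Rightarrow> real" where
  "boundary_norm F = glue (\<lambda>t. nrm B0 (F (Complex 0 t))) (\<lambda>t. nrm B1 (F (Complex 1 t)))"

text \<open>The closed arc of angles that corresponds to the imaginary axis. Its share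
  \<open>1 - \<theta>\<close> of the circle is the harmonic measure of that axis seen from
  \<theta>.\<close>

definition J :: "real set" where "J = {2 * pi * \<theta>..2 * pi}"

text \<open>The boundary values of \<open>F\<close> on the imaginary axis, parametrised by the angle on the
  unit circle and continued by 0 at the two points that correspond to \<open>\<plusminus>\<i>\<infinity>\<close>.\<close>

definition arc_values :: "(complex \<Rightarrow> 'a) \<Rightarrow> real \<Rightarrow> 'a" where
  "arc_values F t = (if 2 * pi * \<theta> < t \<and> t < 2 * pi
     then F (Complex 0 (- ln (height (cis t)) / pi)) else 0)"

lemma boundary_norm_limits:
  assumes "F \<in> \<F>"
  shows "continuous_on UNIV (boundary_norm F)" "(boundary_norm F \<longlongrightarrow> 0) at_infinity"
proof -
  note B0.C0_intoD(2,3)[OF interp_functionsD(5)[OF assms]]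
    B1.C0_intoD(2,3)[OF interp_functionsD(6)[OF assms]]
  from glue_limits[OF this]
  show "continuous_on UNIV (boundary_norm F)" "(boundary_norm F \<longlongrightarrow> 0) at_infinity"
    by (simp_all add: boundary_norm_def)
qed

lemma continuous_on_boundary_norm_height:
  assumes "F \<in> \<F>"
  shows "continuous_on (sphere 0 1) (\<lambda>\<zeta>. boundary_norm F (height \<zeta>))"
proof -
  have "boundary_norm F 0 = 0" by (simp add: boundary_norm_def glue_def)
  then show ?thesis
    using boundary_norm_limits[OF assms] by (intro continuous_on_circle_height) simp_all
qed

lemma continuous_on_boundary_norm_cis:
  assumes "F \<in> \<F>"
  shows "continuous_on A (\<lambda>t. boundary_norm F (height (cis t)))"
  by (rule continuous_on_compose2[OF continuous_on_boundary_norm_height[OF assms]])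
    (auto intro!: continuous_intros)

lemma boundary_norm_nonneg:
  assumes "F \<in> \<F>"
  shows "0 \<le> boundary_norm F w"
  using interp_functions_boundary[OF assms] B0.nrm_nonneg B1.nrm_nonneg
  by (simp add: boundary_norm_def glue_def)

lemma boundary_norm_disc_map:
  "boundary_norm F (height (disc_map (Complex 0 t))) = nrm B0 (F (Complex 0 t))"
  "boundary_norm F (height (disc_map (Complex 1 t))) = nrm B1 (F (Complex 1 t))"
  using height_disc_map[OF exp_boundary(1), of t] height_disc_map[OF exp_boundary(2), of t]
  by (simp_all add: boundary_norm_def glue_def)

lemma boundary_norm_height_cis:
  assumes "t \<in> J"
  shows "boundary_norm F (height (cis t)) = nrm B0 (arc_values F t)"
proof (cases "2 * pi * \<theta> < t \<and> t < 2 * pi")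
  case True
  then show ?thesis
    using height_cis_pos[of t] by (simp add: boundary_norm_def glue_def arc_values_def)
next
  case False
  with assms have "t = 2 * pi * \<theta> \<or> t = 2 * pi" by (auto simp: J_def)
  then have "height (cis t) = 0" by auto
  moreover have "arc_values F t = 0"
    using False by (auto simp: arc_values_def)
  ultimately show ?thesis by (simp add: boundary_norm_def glue_def)
qed

lemma boundary_norm_height_cis_le:
  assumes F: "F \<in> \<F>" and K: "\<And>t. nrm B1 (F (Complex 1 t)) \<le> K" and t: "t \<in> {0..2 * pi * \<theta>}"
  shows "boundary_norm F (height (cis t)) \<le> K"
proof (cases "0 < t \<and> t < 2 * pi * \<theta>")
  case True
  then show ?thesis
    using height_cis_neg[of t] K by (simp add: boundary_norm_def glue_def)
next
  case False
  with t have "t = 2 * pi * \<theta> \<or> t = 0" by auto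
  then have "height (cis t) = 0" by auto
  moreover have "0 \<le> K"
    using B1.nrm_nonneg[OF interp_functions_boundary(2)[OF F]] K order_trans by blast
  ultimately show ?thesis by (simp add: boundary_norm_def glue_def)
qed

lemma arc_values_mem: "F \<in> \<F> \<Longrightarrow> arc_values F t \<in> pts B0"
  using interp_functions_boundary by (simp add: arc_values_def)

text \<open>Norm continuity up to the ends of \<open>J\<close> lets \<open>localise\<close> replace
  a function by a constant vector on short intervals. At the ends it comes from the decay of the
  boundary values at infinity.\<close>

lemma limitin_arc_values:
  assumes F: "F \<in> \<F>" and t: "t \<in> J"
  shows "limitin (ntop B0) (arc_values F) (arc_values F t) (at t within J)"
proof (cases "2 * pi * \<theta> < t \<and> t < 2 * pi")
  case True
  let ?\<tau> = "\<lambda>u. - ln (height (cis u)) / pi" and ?S = "{2 * pi * \<theta><..<2 * pi}"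
  let ?f = "\<lambda>\<tau>. nrm B0 (F (Complex 0 \<tau>) - F (Complex 0 (?\<tau> t)))"
  have t0: "0 < t" using True pi_\<theta>(1) by linarith
  have "isCont (\<lambda>u. - ln (sin (u / 2 - pi * \<theta>) / sin (u / 2)) / pi) t"
    using height_cis_pos[of t] height_cis[of t] True t0
    by (auto intro!: continuous_intros)
  moreover have ev: "\<forall>\<^sub>F u in nhds t. u \<in> ?S"
    using True by (intro eventually_nhds_in_open) auto
  then have "\<forall>\<^sub>F u in nhds t. ?\<tau> u = - ln (sin (u / 2 - pi * \<theta>) / sin (u / 2)) / pi"
  proof eventually_elim
    case (elim u)
    then have "0 < u" using pi_\<theta>(1) by simp
    with elim show ?case using height_cis[of u] by simp
  qed
  ultimately have "isCont ?\<tau> t"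
    by (rule iffD2[OF isCont_cong, rotated])
  moreover have "isCont ?f (?\<tau> t)"
  proof -
    have "(?f \<longlongrightarrow> 0) (at (?\<tau> t))"
      using B0.C0_intoD(4)[OF interp_functionsD(5)[OF F], of "?\<tau> t"]
      by (simp add: B0.limitin_ntop_iff)
    then show ?thesis by (simp add: isCont_def)
  qed
  ultimately have "isCont (\<lambda>u. ?f (?\<tau> u)) t"
    by (rule isCont_o2)
  then have "((\<lambda>u. ?f (?\<tau> u)) \<longlongrightarrow> 0) (at t within J)"
    by (auto simp: isCont_def intro: tendsto_within_subset[of _ _ _ UNIV])
  moreover have "\<forall>\<^sub>F u in at t within J. ?f (?\<tau> u) = nrm B0 (arc_values F u - arc_values F t)"
    using filter_leD[OF at_within_le_nhds ev]
    by (rule eventually_mono) (use True in \<open>simp add: arc_values_def\<close>)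
  ultimately have "((\<lambda>u. nrm B0 (arc_values F u - arc_values F t)) \<longlongrightarrow> 0) (at t within J)"
    by (rule Lim_transform_eventually)
  then show ?thesis
    by (simp add: B0.limitin_ntop_iff arc_values_mem[OF F])
next
  case False
  then have 0: "arc_values F t = 0" by (auto simp: arc_values_def)
  have "((\<lambda>u. boundary_norm F (height (cis u))) \<longlongrightarrow> boundary_norm F (height (cis t))) (at t within J)"
    using continuous_on_boundary_norm_cis[OF F, of J] t by (simp add: continuous_on_def)
  then have "((\<lambda>u. boundary_norm F (height (cis u))) \<longlongrightarrow> 0) (at t within J)"
    using boundary_norm_height_cis[OF t, of F] by (simp add: 0)
  then have "((\<lambda>u. nrm B0 (arc_values F u)) \<longlongrightarrow> 0) (at t within J)"
    by (rule Lim_transform_eventually) (auto simp: eventually_at_filter boundary_norm_height_cis)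
  then show ?thesis
    by (simp add: 0 B0.limitin_ntop_iff arc_values_mem[OF F])
qed

text \<open>As \<open>disc_map\<close> sends \<theta> to the centre, this is \<open>2 * pi\<close>
  times harmonic measure at \<theta> on the imaginary axis. Leaving it unnormalised is the source of
  the factors \<open>2 * pi\<close> below.\<close>

definition arc_measure :: "real measure" where
  "arc_measure = restrict_space lborel J"

lemma finite_arc_measure: "finite_measure arc_measure"
  unfolding arc_measure_def J_def
  using emeasure_lborel_cbox_finite[of "2 * pi * \<theta>" "2 * pi"]
  by (intro finite_measureI)
    (simp add: emeasure_restrict_space space_restrict_space del: emeasure_lborel_Icc_eq)

lemma space_arc_measure [simp]: "space arc_measure = J"
  by (simp add: arc_measure_def space_restrict_space)

lemma sets_arc_measure: "E \<in> sets arc_measure \<longleftrightarrow> E \<in> sets borel \<and> E \<subseteq> J"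
  by (auto simp: arc_measure_def J_def sets_restrict_space_iff)

lemma measure_arc_J: "measure arc_measure J = 2 * pi * (1 - \<theta>)"
  using pi_\<theta> by (simp add: arc_measure_def J_def measure_restrict_space algebra_simps)

lemma integrable_arc_values:
  assumes "F \<in> \<F>"
  shows "integrable arc_measure (\<lambda>t. nrm B0 (arc_values F t))"
    "(\<integral>t. nrm B0 (arc_values F t) \<partial>arc_measure) = integral J (\<lambda>t. boundary_norm F (height (cis t)))"
proof -
  let ?h = "\<lambda>t. boundary_norm F (height (cis t))"
  have set: "set_integrable lborel J ?h"
    unfolding J_def by (intro borel_integrable_atLeastAtMost' continuous_on_boundary_norm_cis assms)
  then have "integrable arc_measure ?h"
    by (simp add: arc_measure_def J_def integrable_restrict_space set_integrable_def)
  then show "integrable arc_measure (\<lambda>t. nrm B0 (arc_values F t))"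
    by (rule Bochner_Integration.integrable_cong[THEN iffD1, rotated -1])
      (simp_all add: boundary_norm_height_cis)
  have "(\<integral>t. nrm B0 (arc_values F t) \<partial>arc_measure) = (\<integral>t. ?h t \<partial>arc_measure)"
    by (rule Bochner_Integration.integral_cong) (simp_all add: boundary_norm_height_cis)
  also have "\<dots> = integral J ?h"
    using set_borel_integral_eq_integral(2)[OF set]
    by (simp add: arc_measure_def J_def integral_restrict_space set_lebesgue_integral_def)
  finally show "(\<integral>t. nrm B0 (arc_values F t) \<partial>arc_measure) = integral J ?h" .
qed

end

text \<open>A functional of norm at most 1 on the interpolation space, expressed through
  representatives \<open>F\<close> so that the infimum defining the norm of that space
  disappears.\<close>

locale interpolation_functional = complex_interpolation +
  fixes \<phi> :: "'a \<Rightarrow> complex"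
  assumes functional_add: "F \<in> \<F> \<Longrightarrow> G \<in> \<F> \<Longrightarrow> \<phi> (F \<theta> + G \<theta>) = \<phi> (F \<theta>) + \<phi> (G \<theta>)"
    and functional_scale: "F \<in> \<F> \<Longrightarrow> \<phi> (s c (F \<theta>)) = c * \<phi> (F \<theta>)"
    and functional_le: "F \<in> \<F> \<Longrightarrow> (\<And>t. nrm B0 (F (Complex 0 t)) \<le> r) \<Longrightarrow>
      (\<And>t. nrm B1 (F (Complex 1 t)) \<le> r) \<Longrightarrow> cmod (\<phi> (F \<theta>)) \<le> r"
begin

text \<open>Jensen's inequality: division of \<open>F\<close> by an outer function whose modulus on the boundary is
  approximately that of \<open>F\<close> reduces the bound to \<open>functional_le\<close>.\<close>

lemma functional_le_circle_mean:
  assumes F: "F \<in> \<F>"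
  shows "2 * pi * cmod (\<phi> (F \<theta>)) \<le> integral {0..2 * pi} (\<lambda>t. boundary_norm F (height (cis t)))"
proof -
  define N where "N \<zeta> = boundary_norm F (height \<zeta>)" for \<zeta>
  define I where "I = integral {0..2 * pi} (\<lambda>t. N (cis t))"
  have N0: "0 \<le> N \<zeta>" for \<zeta>
    unfolding N_def by (rule boundary_norm_nonneg[OF F])
  have contN: "continuous_on (sphere 0 1) N"
    unfolding N_def[abs_def] by (rule continuous_on_boundary_norm_height[OF F])
  have N_int: "(\<lambda>t. N (cis t)) integrable_on {0..2 * pi}"
    unfolding N_def
    by (intro integrable_continuous_interval continuous_on_boundary_norm_cis F)
  have bound: "2 * pi * cmod (\<phi> (F \<theta>)) \<le> exp (2 * e) * (I + 2 * pi * e)" if e: "0 < e" for e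
  proof -
    \<comment> \<open>Adding \<open>e\<close> keeps the logarithm finite where the boundary norm
      vanishes.\<close>
    define g where "g \<zeta> = ln (N \<zeta> + e)" for \<zeta>
    have Ne: "0 < N \<zeta> + e" for \<zeta>
      using N0[of \<zeta>] e by linarith
    have "continuous_on (sphere 0 1) g"
      unfolding g_def using contN Ne by (intro continuous_intros) (auto simp: less_imp_neq[symmetric])
    then obtain p :: "complex poly" where p: "\<And>\<zeta>. \<zeta> \<in> sphere 0 1 \<Longrightarrow> \<bar>g \<zeta> - Re (poly p \<zeta>)\<bar> < e"
      using Re_poly_approximation_on_circle e by blast
    have p1: "Re (poly p \<zeta>) \<le> g \<zeta> + e" "g \<zeta> \<le> Re (poly p \<zeta>) + e" if "cmod \<zeta> = 1" for \<zeta>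
      using p[of \<zeta>] that by auto
    \<comment> \<open>On the boundary the modulus of \<open>k\<close> is \<open>1 / (N + e)\<close>
      up to a factor between \<open>exp (- e)\<close> and \<open>exp e\<close>; at \<theta> it is
      \<open>exp (- m)\<close>.\<close>
    define k where "k z = exp (- poly p (disc_map z))" for z
    define m where "m = Re (poly p 0)"
    have "compact ((\<lambda>\<zeta>. poly p \<zeta>) ` cball 0 1)"
      by (intro compact_continuous_image continuous_intros) auto
    then obtain C where "\<forall>\<zeta>\<in>cball 0 1. cmod (poly p \<zeta>) \<le> C"
      by (auto dest!: compact_imp_bounded simp: bounded_iff)
    then have C: "\<And>\<zeta>. cmod \<zeta> \<le> 1 \<Longrightarrow> cmod (poly p \<zeta>) \<le> C"
      by simp
    have k_bound: "cmod (k z) \<le> exp C" if "z \<in> strip" for z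
      using C[OF norm_disc_map_le[OF that]] abs_Re_le_cmod[of "poly p (disc_map z)"]
      by (simp add: k_def)
    have H: "(\<lambda>z. s (k z) (F z)) \<in> \<F>"
    proof (rule interp_functions_scale[OF F _ _ k_bound])
      show "continuous_on strip k"
        unfolding k_def by (intro continuous_intros continuous_on_disc_map)
      show "k holomorphic_on open_strip"
        unfolding k_def poly_altdef by (intro holomorphic_intros holomorphic_disc_map)
    qed
    have le: "cmod (k z) * N (disc_map z) \<le> exp e" if z: "cmod (disc_map z) = 1" for z
    proof -
      have "cmod (k z) * N (disc_map z) \<le> exp (- Re (poly p (disc_map z))) * (N (disc_map z) + e)"
        using e by (simp add: k_def)
      also have "N (disc_map z) + e = exp (g (disc_map z))"
        using Ne by (simp add: g_def)
      also have "exp (- Re (poly p (disc_map z))) * \<dots> = exp (g (disc_map z) - Re (poly p (disc_map z)))"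
        by (simp flip: exp_add)
      also have "\<dots> \<le> exp e"
        using p1[OF z] by simp
      finally show ?thesis .
    qed
    have "cmod (\<phi> (s (k \<theta>) (F \<theta>))) \<le> exp e"
    proof (rule functional_le[OF H])
      show "nrm B0 (s (k (Complex 0 t)) (F (Complex 0 t))) \<le> exp e" for t
        using le[OF norm_disc_map_boundary[OF exp_boundary(1)], of t]
        by (simp add: N_def boundary_norm_disc_map B0.nrm_scale interp_functions_boundary[OF F])
      show "nrm B1 (s (k (Complex 1 t)) (F (Complex 1 t))) \<le> exp e" for t
        using le[OF norm_disc_map_boundary[OF exp_boundary(2)], of t]
        by (simp add: N_def boundary_norm_disc_map B1.nrm_scale interp_functions_boundary[OF F])
    qed
    then have "exp (- m) * cmod (\<phi> (F \<theta>)) \<le> exp e"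
      by (simp add: functional_scale[OF F] norm_mult k_def m_def)
    then have 1: "cmod (\<phi> (F \<theta>)) \<le> exp e * exp m"
      by (simp add: exp_minus field_simps)
    have const: "((\<lambda>t. c) has_integral 2 * pi * c) {0..2 * pi}" for c :: real
      using has_integral_const_real[of c 0 "2 * pi"] by simp
    \<comment> \<open>The exponential lies above its tangent at \<open>m\<close>. Since
      \<open>m\<close> is the mean of \<open>Re p\<close> over the circle, the linear term
      integrates to 0, which bounds the geometric mean by the arithmetic mean.\<close>
    have "((\<lambda>t. exp m * (1 + (Re (poly p (cis t)) - m))) has_integral
        exp m * (2 * pi * 1 + (2 * pi * m - 2 * pi * m))) {0..2 * pi}"
      unfolding m_def by (intro has_integral_mult_right has_integral_add has_integral_diff
          has_integral_Re_poly_cis const)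
    moreover have "((\<lambda>t. exp e * (N (cis t) + e)) has_integral exp e * (I + 2 * pi * e)) {0..2 * pi}"
      unfolding I_def
      by (intro has_integral_mult_right has_integral_add integrable_integral N_int const)
    moreover have "exp m * (1 + (Re (poly p (cis t)) - m)) \<le> exp e * (N (cis t) + e)" for t
    proof -
      have "exp m * (1 + (Re (poly p (cis t)) - m)) \<le> exp m * exp (Re (poly p (cis t)) - m)"
        by (intro mult_left_mono exp_ge_add_one_self) simp
      also have "\<dots> = exp (Re (poly p (cis t)))"
        by (simp flip: exp_add)
      also have "\<dots> \<le> exp (g (cis t) + e)"
        using p1[of "cis t"] by simp
      also have "\<dots> = exp e * (N (cis t) + e)"
        using Ne by (simp add: exp_add g_def)
      finally show ?thesis .
    qed
    ultimately have 2: "2 * pi * exp m \<le> exp e * (I + 2 * pi * e)"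
      by (auto dest: has_integral_le simp: mult_ac)
    have "2 * pi * cmod (\<phi> (F \<theta>)) \<le> exp e * (2 * pi * exp m)"
      using mult_left_mono[OF 1, of "2 * pi"] by (simp add: mult_ac)
    also have "\<dots> \<le> exp e * (exp e * (I + 2 * pi * e))"
      using 2 by (intro mult_left_mono) auto
    also have "\<dots> = exp (2 * e) * (I + 2 * pi * e)"
      by (simp add: mult.assoc[symmetric] flip: exp_add)
    finally show ?thesis .
  qed
  have "((\<lambda>e. exp (2 * e) * (I + 2 * pi * e)) \<longlongrightarrow> exp (2 * 0) * (I + 2 * pi * 0)) (at_right 0)"
    by (intro tendsto_intros)
  moreover have "\<forall>\<^sub>F e in at_right 0. 2 * pi * cmod (\<phi> (F \<theta>)) \<le> exp (2 * e) * (I + 2 * pi * e)"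
    unfolding eventually_at_right_field using bound by (auto intro!: exI[of _ 1])
  ultimately have "2 * pi * cmod (\<phi> (F \<theta>)) \<le> exp (2 * 0) * (I + 2 * pi * 0)"
    by (intro tendsto_lowerbound) auto
  then show ?thesis by (simp add: I_def N_def)
qed

text \<open>The circle is cut at the angle \<open>2 * pi * \<theta>\<close>, and the arc of the line
  \<open>Re z = 1\<close> contributes at most its length times \<open>K\<close>. The majorant
  \<open>g\<close> prepares for functions whose own norm may fail to be measurable.\<close>

lemma functional_le_integral:
  assumes F: "F \<in> \<F>" and g: "integrable arc_measure g"
    and le: "\<And>t. t \<in> J \<Longrightarrow> nrm B0 (arc_values F t) \<le> g t"
    and K: "\<And>t. nrm B1 (F (Complex 1 t)) \<le> K"
  shows "2 * pi * cmod (\<phi> (F \<theta>)) \<le> (\<integral>t. g t \<partial>arc_measure) + 2 * pi * \<theta> * K"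
proof -
  let ?h = "\<lambda>t. boundary_norm F (height (cis t))"
  have int: "?h integrable_on {a..b}" for a b
    by (intro integrable_continuous_interval continuous_on_boundary_norm_cis F)
  have "2 * pi * cmod (\<phi> (F \<theta>)) \<le> integral {0..2 * pi} ?h"
    by (rule functional_le_circle_mean[OF F])
  also have "\<dots> = integral {0..2 * pi * \<theta>} ?h + integral J ?h"
    unfolding J_def using pi_\<theta> by (intro Henstock_Kurzweil_Integration.integral_combine[symmetric] int) auto
  also have "integral {0..2 * pi * \<theta>} ?h \<le> integral {0..2 * pi * \<theta>} (\<lambda>t. K)"
    using boundary_norm_height_cis_le[OF F K] by (intro integral_le int) auto
  also have "\<dots> = 2 * pi * \<theta> * K"
    using pi_\<theta> by simp
  also have "integral J ?h \<le> (\<integral>t. g t \<partial>arc_measure)"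
    unfolding integrable_arc_values(2)[OF F, symmetric]
    by (rule integral_mono[OF integrable_arc_values(1)[OF F] g]) (simp add: le)
  finally show ?thesis by simp
qed

end

section \<open>Extension to bounded functions on the arc\<close>

lemma (in complex_normed_space) vector_space_real_functions:
  "vector_space (\<lambda>(c::real) (u::'i \<Rightarrow> 'a) t. s (of_real c) (u t))"
  by unfold_locales (simp_all add: fun_eq_iff scale_right_distrib scale_left_distrib)

context complex_interpolation
begin

definition bounded_functions :: "(real \<Rightarrow> 'a) set" where
  "bounded_functions = {u. (\<forall>t. u t \<in> pts B0) \<and> (\<exists>C. \<forall>t. nrm B0 (u t) \<le> C)}"

lemma subspace_bounded_functions:
  "module.subspace (\<lambda>(c::real) (u::real \<Rightarrow> 'a) t. s (of_real c) (u t)) bounded_functions"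
proof -
  interpret fn: vector_space "\<lambda>(c::real) (u::real \<Rightarrow> 'a) t. s (of_real c) (u t)"
    by (rule B0.vector_space_real_functions)
  show ?thesis
  proof (rule fn.subspaceI)
    show "0 \<in> bounded_functions"
      by (auto simp: bounded_functions_def)
    fix u v :: "real \<Rightarrow> 'a" assume u: "u \<in> bounded_functions"
    then obtain C where C: "\<And>t. u t \<in> pts B0" "\<And>t. nrm B0 (u t) \<le> C"
      by (auto simp: bounded_functions_def)
    show "u + v \<in> bounded_functions" if v: "v \<in> bounded_functions"
    proof -
      from v obtain D where D: "\<And>t. v t \<in> pts B0" "\<And>t. nrm B0 (v t) \<le> D"
        by (auto simp: bounded_functions_def)
      have "nrm B0 (u t + v t) \<le> C + D" for t
        using B0.nrm_triangle[OF C(1) D(1), of t t] C(2)[of t] D(2)[of t] by linarith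
      then show ?thesis
        using C(1) D(1) B0.pts_add by (auto simp: bounded_functions_def)
    qed
    have "nrm B0 (s (of_real c) (u t)) \<le> \<bar>c\<bar> * C" for c :: real and t
      using C by (simp add: B0.nrm_scale mult_left_mono)
    then show "(\<lambda>t. s (of_real c) (u t)) \<in> bounded_functions" for c :: real
      using C(1) B0.pts_scale by (auto simp: bounded_functions_def)
  qed
qed

lemma bounded_functions_add:
  assumes "u \<in> bounded_functions" "v \<in> bounded_functions"
  shows "u + v \<in> bounded_functions"
proof -
  interpret fn: vector_space "\<lambda>(c::real) (u::real \<Rightarrow> 'a) t. s (of_real c) (u t)"
    by (rule B0.vector_space_real_functions)
  show ?thesis
    by (rule fn.subspace_add[OF subspace_bounded_functions assms])
qed

lemma bounded_functions_minus:
  assumes "u \<in> bounded_functions"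
  shows "- u \<in> bounded_functions"
proof -
  interpret fn: vector_space "\<lambda>(c::real) (u::real \<Rightarrow> 'a) t. s (of_real c) (u t)"
    by (rule B0.vector_space_real_functions)
  show ?thesis
    by (rule fn.subspace_neg[OF subspace_bounded_functions assms])
qed

definition restr :: "real set \<Rightarrow> (real \<Rightarrow> 'a) \<Rightarrow> real \<Rightarrow> 'a" where
  "restr E u t = (if t \<in> E then u t else 0)"

lemma restr_bounded: "u \<in> bounded_functions \<Longrightarrow> restr E u \<in> bounded_functions"
proof -
  assume "u \<in> bounded_functions"
  then obtain C where C: "\<And>t. u t \<in> pts B0" "\<And>t. nrm B0 (u t) \<le> C"
    by (auto simp: bounded_functions_def)
  have "nrm B0 (restr E u t) \<le> max C 0" for t
    using C(2)[of t] by (simp add: restr_def max_def)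
  moreover have "restr E u t \<in> pts B0" for t
    using C(1) by (simp add: restr_def)
  ultimately show ?thesis
    unfolding bounded_functions_def by blast
qed

lemma const_bounded: "x \<in> pts B0 \<Longrightarrow> (\<lambda>t. x) \<in> bounded_functions"
  by (auto simp: bounded_functions_def)

lemma arc_values_add: "arc_values (\<lambda>z. F z + G z) = arc_values F + arc_values G"
  by (auto simp: arc_values_def fun_eq_iff)

lemma arc_values_scale: "arc_values (\<lambda>z. s c (F z)) = (\<lambda>t. s c (arc_values F t))"
  by (auto simp: arc_values_def fun_eq_iff)

lemma arc_values_outside: "t \<notin> J \<Longrightarrow> arc_values F t = 0"
  by (auto simp: arc_values_def J_def)

lemma nrm_arc_values_le:
  assumes "F \<in> \<F>" "\<And>t. nrm B0 (F (Complex 0 t)) \<le> C"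
  shows "nrm B0 (arc_values F t) \<le> C"
proof -
  have "0 \<le> C"
    using B0.nrm_nonneg[OF interp_functions_boundary(1)[OF assms(1)]] assms(2) order_trans by blast
  with assms(2) show ?thesis by (simp add: arc_values_def)
qed

lemma arc_values_bounded: "F \<in> \<F> \<Longrightarrow> arc_values F \<in> bounded_functions"
  using B0.C0_intoD(5)[OF interp_functionsD(5)] arc_values_mem nrm_arc_values_le
  unfolding bounded_functions_def by blast

text \<open>A vector measure on \<open>J\<close> with values in the dual of \<open>B0\<close>, with density bounded by \<open>D\<close>.\<close>

definition dominated :: "((real \<Rightarrow> 'a) \<Rightarrow> real) \<Rightarrow> real \<Rightarrow> bool" where
  "dominated \<kappa> D \<longleftrightarrow> 0 \<le> D \<and>
     (\<forall>u\<in>bounded_functions. \<forall>v\<in>bounded_functions. \<kappa> (u + v) = \<kappa> u + \<kappa> v) \<and>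
     (\<forall>u\<in>bounded_functions. \<forall>c. \<kappa> (\<lambda>t. s (of_real c) (u t)) = c * \<kappa> u) \<and>
     (\<forall>u\<in>bounded_functions. \<forall>g. integrable arc_measure g \<longrightarrow> (\<forall>t\<in>J. nrm B0 (u t) \<le> g t) \<longrightarrow>
        \<bar>\<kappa> u\<bar> \<le> D * (\<integral>t. g t \<partial>arc_measure))"

lemma dominatedD:
  assumes "dominated \<kappa> D"
  shows "0 \<le> D"
    "u \<in> bounded_functions \<Longrightarrow> v \<in> bounded_functions \<Longrightarrow> \<kappa> (u + v) = \<kappa> u + \<kappa> v"
    "u \<in> bounded_functions \<Longrightarrow> \<kappa> (\<lambda>t. s (of_real c) (u t)) = c * \<kappa> u"
    "u \<in> bounded_functions \<Longrightarrow> integrable arc_measure g \<Longrightarrow> (\<And>t. t \<in> J \<Longrightarrow> nrm B0 (u t) \<le> g t) \<Longrightarrow>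
        \<bar>\<kappa> u\<bar> \<le> D * (\<integral>t. g t \<partial>arc_measure)"
  using assms unfolding dominated_def by blast+

lemma dominated_add:
  assumes "dominated \<kappa> D" "dominated \<mu> E"
  shows "dominated (\<lambda>u. \<kappa> u + \<mu> u) (D + E)"
  unfolding dominated_def
proof (intro conjI ballI allI impI)
  fix u g assume "u \<in> bounded_functions" "integrable arc_measure g" "\<forall>t\<in>J. nrm B0 (u t) \<le> g t"
  then have "\<bar>\<kappa> u\<bar> \<le> D * (\<integral>t. g t \<partial>arc_measure)" "\<bar>\<mu> u\<bar> \<le> E * (\<integral>t. g t \<partial>arc_measure)"
    using dominatedD(4)[OF assms(1)] dominatedD(4)[OF assms(2)] by auto
  then show "\<bar>\<kappa> u + \<mu> u\<bar> \<le> (D + E) * (\<integral>t. g t \<partial>arc_measure)"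
    unfolding distrib_right by linarith
qed (simp_all add: dominatedD[OF assms(1)] dominatedD[OF assms(2)] algebra_simps)

lemma dominated_minus:
  assumes "dominated \<kappa> D"
  shows "dominated (\<lambda>u. - \<kappa> u) D"
  using assms unfolding dominated_def by auto

lemma dominated_restr_le:
  assumes \<kappa>: "dominated \<kappa> D" and u: "u \<in> bounded_functions" and E: "E \<in> sets arc_measure"
    and le: "\<And>t. t \<in> E \<Longrightarrow> nrm B0 (u t) \<le> r"
  shows "\<bar>\<kappa> (restr E u)\<bar> \<le> D * (r * measure arc_measure E)"
proof -
  interpret finite_measure arc_measure by (rule finite_arc_measure)
  have "\<bar>\<kappa> (restr E u)\<bar> \<le> D * (\<integral>t. r * indicator E t \<partial>arc_measure)"
  proof (rule dominatedD(4)[OF \<kappa> restr_bounded[OF u]])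
    show "integrable arc_measure (\<lambda>t. r * indicator E t)"
      using E by (intro integrable_mult_right integrable_real_indicator) (auto simp: less_top[symmetric])
    show "nrm B0 (restr E u t) \<le> r * indicator E t" for t
      using le by (simp add: restr_def indicator_def)
  qed
  then show ?thesis
    using E by (simp add: Int_absorb2 sets_arc_measure)
qed

lemma dominated_restr_Un:
  assumes "dominated \<kappa> D" "u \<in> bounded_functions" "X \<inter> Y = {}"
  shows "\<kappa> (restr (X \<union> Y) u) = \<kappa> (restr X u) + \<kappa> (restr Y u)"
proof -
  have "restr (X \<union> Y) u = restr X u + restr Y u"
    using assms(3) by (auto simp: restr_def fun_eq_iff)
  then show ?thesis
    using dominatedD(2)[OF assms(1) restr_bounded restr_bounded] assms(2) by simp
qed

text \<open>Bisection localises a lower bound for \<open>\<kappa>\<close> at the value of \<open>F\<close> at one point, and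
  a Hahn decomposition makes it hereditary.\<close>

lemma localise:
  assumes \<kappa>: "dominated \<kappa> D" and F: "F \<in> \<F>" and E: "E \<in> sets arc_measure"
    and less: "c * measure arc_measure E < \<kappa> (restr E (arc_values F))" and c': "c' < c"
  obtains E' t where "E' \<in> sets arc_measure" "E' \<subseteq> E" "0 < measure arc_measure E'"
    "\<And>X. X \<in> sets arc_measure \<Longrightarrow> X \<subseteq> E' \<Longrightarrow>
      c' * measure arc_measure X \<le> \<kappa> (restr X (\<lambda>_. arc_values F t))"
proof (rule ccontr)
  interpret finite_measure arc_measure by (rule finite_arc_measure)
  assume "\<not> thesis"
  note contra = this[unfolded not_def, rule_format, OF that]
  \<comment> \<open>If the conclusion fails, constant values of \<open>F\<close> have average at
    most \<open>c'\<close> on every part of \<open>E\<close>; a larger average somewhere would yield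
    a hereditary set by the Hahn decomposition.\<close>
  have le: "\<kappa> (restr X (\<lambda>_. arc_values F t)) \<le> c' * measure arc_measure X"
    if X: "X \<in> sets arc_measure" "X \<subseteq> E" for X t
  proof (rule ccontr)
    let ?x = "\<lambda>_. arc_values F t"
    have x: "?x \<in> bounded_functions"
      using arc_values_mem[OF F] by (rule const_bounded)
    assume "\<not> \<kappa> (restr X ?x) \<le> c' * measure arc_measure X"
    then have "c' * measure arc_measure X < \<kappa> (restr X ?x)" by simp
    then obtain E' where E': "E' \<in> sets arc_measure" "E' \<subseteq> X" "0 < measure arc_measure E'"
      "\<And>Y. Y \<in> sets arc_measure \<Longrightarrow> Y \<subseteq> E' \<Longrightarrow> c' * measure arc_measure Y \<le> \<kappa> (restr Y ?x)"
    proof (rule hereditary_lower_bound[rotated 3])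
      show "\<kappa> (restr (Y \<union> Z) ?x) = \<kappa> (restr Y ?x) + \<kappa> (restr Z ?x)" if "Y \<inter> Z = {}" for Y Z
        by (rule dominated_restr_Un[OF \<kappa> x that])
      show "\<bar>\<kappa> (restr Y ?x)\<bar> \<le> D * nrm B0 (arc_values F t) * measure arc_measure Y"
        if "Y \<in> sets arc_measure" for Y
        using dominated_restr_le[OF \<kappa> x that order_refl] by (simp add: mult.assoc)
    qed (use X in auto)
    show False
      by (rule contra[OF E'(1) _ E'(3,4)]) (use E' X in auto)
  qed
  have Int: "E \<inter> A \<in> sets arc_measure" if "A \<in> sets borel" for A
    using E that by (auto simp: sets_arc_measure)
  \<comment> \<open>Intervals open on the left make the halves of a bisection disjoint, so that both
    sides of the inequality add up.\<close>
  define P where "P a b \<longleftrightarrow>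
    \<kappa> (restr (E \<inter> {a<..b}) (arc_values F)) \<le> c * measure arc_measure (E \<inter> {a<..b})" for a b
  note Fb = arc_values_bounded[OF F]
  \<comment> \<open>Starting 1 to the left of \<open>J\<close> makes the half-open interval contain
    the left end of \<open>J\<close>.\<close>
  have "P (2 * pi * \<theta> - 1) (2 * pi)"
  proof (rule Bolzano)
    show "2 * pi * \<theta> - 1 \<le> 2 * pi" using pi_\<theta>(2) by linarith
  next
    fix x y z assume xyz: "P x y" "P y z" "x \<le> y" "y \<le> z"
    then have eq: "E \<inter> {x<..z} = (E \<inter> {x<..y}) \<union> (E \<inter> {y<..z})"
      and disj: "(E \<inter> {x<..y}) \<inter> (E \<inter> {y<..z}) = {}" by auto
    show "P x z"
      using xyz(1,2) unfolding P_def eq dominated_restr_Un[OF \<kappa> Fb disj]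
      by (subst finite_measure_Union) (use disj in \<open>auto simp: Int algebra_simps\<close>)
  next
    fix x assume x: "2 * pi * \<theta> - 1 \<le> x" "x \<le> 2 * pi"
    show "\<exists>d>0. \<forall>a b. a \<le> x \<and> x \<le> b \<and> b - a < d \<longrightarrow> P a b"
    proof (cases "x < 2 * pi * \<theta>")
      case True
      have "P a b" if "a \<le> x" "x \<le> b" "b - a < 2 * pi * \<theta> - x" for a b
      proof -
        have empty: "E \<inter> {a<..b} = {}"
          using E that by (auto simp: sets_arc_measure J_def)
        have "restr {} (arc_values F) = restr {} (arc_values F) + restr {} (arc_values F)"
          by (simp add: restr_def fun_eq_iff)
        then have "\<kappa> (restr {} (arc_values F)) = 0"
          using dominated_restr_Un[OF \<kappa> Fb, of "{}" "{}"] by simp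
        then show ?thesis by (simp add: P_def empty)
      qed
      then show ?thesis
        using True by (intro exI[of _ "2 * pi * \<theta> - x"]) auto
    next
      case False
      then have xJ: "x \<in> J" using x by (simp add: J_def)
      \<comment> \<open>Freezing \<open>F\<close> at \<open>x\<close> costs at most
        \<open>D * e\<close> times the measure, which the gap \<open>c - c'\<close> pays for. The
        summand 1 covers \<open>D = 0\<close>.\<close>
      define e where "e = (c - c') / (D + 1)"
      have D: "0 \<le> D" by (rule dominatedD(1)[OF \<kappa>])
      then have e: "0 < e" "D * e \<le> c - c'"
        using c' by (auto simp: e_def field_simps)
      have "((\<lambda>u. nrm B0 (arc_values F u - arc_values F x)) \<longlongrightarrow> 0) (at x within J)"
        using limitin_arc_values[OF F xJ] by (simp add: B0.limitin_ntop_iff)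
      from tendstoD[OF this e(1)] obtain d where d: "0 < d"
        "\<And>u. u \<in> J \<Longrightarrow> u \<noteq> x \<Longrightarrow> dist u x < d \<Longrightarrow> dist (nrm B0 (arc_values F u - arc_values F x)) 0 < e"
        unfolding eventually_at by blast
      have near: "nrm B0 (arc_values F u - arc_values F x) \<le> e" if "u \<in> J" "dist u x < d" for u
        using d(2)[OF that(1) _ that(2)] e(1) by (cases "u = x") auto
      have "P a b" if ab: "a \<le> x" "x \<le> b" "b - a < d" for a b
      proof -
        let ?X = "E \<inter> {a<..b}"
        let ?x = "\<lambda>_::real. arc_values F x"
        have X: "?X \<in> sets arc_measure" "?X \<subseteq> E" by (auto simp: Int)
        have xb: "?x \<in> bounded_functions" by (rule const_bounded[OF arc_values_mem[OF F]])
        have diff: "arc_values F + - ?x \<in> bounded_functions"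
          by (intro bounded_functions_add bounded_functions_minus Fb xb)
        have "restr ?X (arc_values F) = restr ?X ?x + restr ?X (arc_values F + - ?x)"
          by (auto simp: restr_def fun_eq_iff)
        then have "\<kappa> (restr ?X (arc_values F)) = \<kappa> (restr ?X ?x) + \<kappa> (restr ?X (arc_values F + - ?x))"
          using dominatedD(2)[OF \<kappa> restr_bounded[OF xb] restr_bounded[OF diff]] by simp
        also have "\<bar>\<kappa> (restr ?X (arc_values F + - ?x))\<bar> \<le> D * (e * measure arc_measure ?X)"
        proof (rule dominated_restr_le[OF \<kappa> diff X(1)])
          fix t assume t: "t \<in> ?X"
          then have "t \<in> J" "dist t x < d"
            using E ab by (auto simp: sets_arc_measure dist_real_def)
          from near[OF this] show "nrm B0 ((arc_values F + - ?x) t) \<le> e" by simp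
        qed
        then have "\<kappa> (restr ?X (arc_values F + - ?x)) \<le> D * e * measure arc_measure ?X"
          by (simp add: mult.assoc)
        also have "\<dots> \<le> (c - c') * measure arc_measure ?X"
          using e(2) by (intro mult_right_mono) auto
        also have "\<kappa> (restr ?X ?x) \<le> c' * measure arc_measure ?X"
          by (rule le[OF X])
        finally show ?thesis
          by (simp add: P_def algebra_simps)
      qed
      then show ?thesis using d(1) by blast
    qed
  qed
  moreover have "E \<inter> {2 * pi * \<theta> - 1<..2 * pi} = E"
    using E by (auto simp: sets_arc_measure J_def)
  ultimately show False
    using less by (simp add: P_def)
qed

end

context interpolation_functional
begin

text \<open>The sublinear majorant is an infimum over all \<open>F\<close> of the integral of the
  distance from \<open>u\<close> to the boundary values of \<open>F\<close>, plus the cost of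
  \<open>F\<close> on \<open>Re z = 1\<close>, plus the value of the functional at \<open>F\<close>.
  It is finite by Jensen's inequality, applied to \<open>F\<close> with majorant
  \<open>C + g\<close>. The choice \<open>F = 0\<close> gives domination by
  \<open>arc_measure\<close>; the choice \<open>u = arc_values F\<close> with \<open>g = 0\<close>
  shows that \<open>m\<close> misses only a part controlled by \<open>K\<close>.\<close>

lemma extension_to_bounded_functions:
  obtains m where "dominated m 1"
    "\<And>F K. F \<in> \<F> \<Longrightarrow> (\<And>t. nrm B1 (F (Complex 1 t)) \<le> K) \<Longrightarrow>
       \<bar>m (arc_values F) - 2 * pi * Re (\<phi> (F \<theta>))\<bar> \<le> 2 * pi * \<theta> * K"
proof -
  define A where "A u = {(\<integral>t. g t \<partial>arc_measure) + 2 * pi * \<theta> * K + 2 * pi * Re (\<phi> (F \<theta>)) |g K F.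
      F \<in> \<F> \<and> integrable arc_measure g \<and> (\<forall>t\<in>J. nrm B0 (u t - arc_values F t) \<le> g t)
      \<and> (\<forall>t. nrm B1 (F (Complex 1 t)) \<le> K)}" for u
  interpret finite_measure arc_measure by (rule finite_arc_measure)
  have AI: "(\<integral>t. g t \<partial>arc_measure) + 2 * pi * \<theta> * K + 2 * pi * Re (\<phi> (F \<theta>)) \<in> A u"
    if "F \<in> \<F>" "integrable arc_measure g" "\<And>t. t \<in> J \<Longrightarrow> nrm B0 (u t - arc_values F t) \<le> g t"
      "\<And>t. nrm B1 (F (Complex 1 t)) \<le> K" for g K F u
    using that unfolding A_def by blast
  have zero: "arc_values (\<lambda>z. 0) = (\<lambda>t. 0)" by (auto simp: arc_values_def)
  have \<phi>0: "\<phi> 0 = 0" using functional_scale[OF interp_functions_zero, of 0] by simp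
  have AI0: "(\<integral>t. g t \<partial>arc_measure) \<in> A u"
    if "integrable arc_measure g" "\<And>t. t \<in> J \<Longrightarrow> nrm B0 (u t) \<le> g t" for g u
    using AI[OF interp_functions_zero that(1), of u 0] that(2) by (simp add: zero \<phi>0)
  obtain m where m: "\<And>u v. u \<in> bounded_functions \<Longrightarrow> v \<in> bounded_functions \<Longrightarrow> m (u + v) = m u + m v"
    "\<And>c u. u \<in> bounded_functions \<Longrightarrow> m (\<lambda>t. s (of_real c) (u t)) = c * m u"
    "\<And>u a. u \<in> bounded_functions \<Longrightarrow> a \<in> A u \<Longrightarrow> m u \<le> a"
  proof (rule Hahn_Banach_upper_bounds[OF B0.vector_space_real_functions subspace_bounded_functions, of A])
    fix u assume u: "u \<in> bounded_functions"
    then obtain C where C: "\<And>t. u t \<in> pts B0" "\<And>t. nrm B0 (u t) \<le> C"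
      by (auto simp: bounded_functions_def)
    show "A u \<noteq> {}"
      using AI0[of "\<lambda>_. C" u] C by auto
    show "bdd_below (A u)"
    proof (rule bdd_belowI[of _ "- (\<integral>t. C \<partial>arc_measure)"])
      fix a assume "a \<in> A u"
      then obtain g K F where a: "a = (\<integral>t. g t \<partial>arc_measure) + 2 * pi * \<theta> * K + 2 * pi * Re (\<phi> (F \<theta>))"
        and F: "F \<in> \<F>" and g: "integrable arc_measure g"
        and le: "\<And>t. t \<in> J \<Longrightarrow> nrm B0 (u t - arc_values F t) \<le> g t"
        and K: "\<And>t. nrm B1 (F (Complex 1 t)) \<le> K"
        unfolding A_def by blast
      have "2 * pi * cmod (\<phi> (F \<theta>)) \<le> (\<integral>t. C + g t \<partial>arc_measure) + 2 * pi * \<theta> * K"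
      proof (rule functional_le_integral[OF F _ _ K])
        show "integrable arc_measure (\<lambda>t. C + g t)" using g by simp
        show "nrm B0 (arc_values F t) \<le> C + g t" if t: "t \<in> J" for t
          using B0.nrm_diff_triangle[OF arc_values_mem[OF F] C(1), of t t] C(2)[of t] le[OF t]
            B0.nrm_diff_commute[OF arc_values_mem[OF F] C(1), of t t] by linarith
      qed
      also have "(\<integral>t. C + g t \<partial>arc_measure) = (\<integral>t. C \<partial>arc_measure) + (\<integral>t. g t \<partial>arc_measure)"
        using g by (intro Bochner_Integration.integral_add) auto
      finally have "2 * pi * cmod (\<phi> (F \<theta>)) \<le> a + (\<integral>t. C \<partial>arc_measure) - 2 * pi * Re (\<phi> (F \<theta>))"
        unfolding a by linarith
      moreover have "2 * pi * (- Re (\<phi> (F \<theta>))) \<le> 2 * pi * cmod (\<phi> (F \<theta>))"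
        using abs_Re_le_cmod[of "\<phi> (F \<theta>)"] by (intro mult_left_mono) auto
      ultimately show "- (\<integral>t. C \<partial>arc_measure) \<le> a"
        by linarith
    qed
  next
    fix u v a b assume uv: "u \<in> bounded_functions" "v \<in> bounded_functions" and "a \<in> A u" "b \<in> A v"
    then obtain g K F h L G where
      a: "a = (\<integral>t. g t \<partial>arc_measure) + 2 * pi * \<theta> * K + 2 * pi * Re (\<phi> (F \<theta>))"
        "F \<in> \<F>" "integrable arc_measure g" "\<And>t. t \<in> J \<Longrightarrow> nrm B0 (u t - arc_values F t) \<le> g t"
        "\<And>t. nrm B1 (F (Complex 1 t)) \<le> K"
      and b: "b = (\<integral>t. h t \<partial>arc_measure) + 2 * pi * \<theta> * L + 2 * pi * Re (\<phi> (G \<theta>))"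
        "G \<in> \<F>" "integrable arc_measure h" "\<And>t. t \<in> J \<Longrightarrow> nrm B0 (v t - arc_values G t) \<le> h t"
        "\<And>t. nrm B1 (G (Complex 1 t)) \<le> L"
      unfolding A_def by blast
    have "(\<integral>t. g t + h t \<partial>arc_measure) + 2 * pi * \<theta> * (K + L) + 2 * pi * Re (\<phi> (F \<theta> + G \<theta>)) \<in> A (u + v)"
    proof (rule AI[OF interp_functions_add[OF a(2) b(2)]])
      show "nrm B0 ((u + v) t - arc_values (\<lambda>z. F z + G z) t) \<le> g t + h t" if t: "t \<in> J" for t
      proof -
        have "(u + v) t - arc_values (\<lambda>z. F z + G z) t = (u t - arc_values F t) + (v t - arc_values G t)"
          by (simp add: arc_values_add)
        moreover have "u t - arc_values F t \<in> pts B0" "v t - arc_values G t \<in> pts B0"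
          using uv arc_values_mem a(2) b(2) by (auto simp: bounded_functions_def)
        ultimately have "nrm B0 ((u + v) t - arc_values (\<lambda>z. F z + G z) t) \<le>
            nrm B0 (u t - arc_values F t) + nrm B0 (v t - arc_values G t)"
          using B0.nrm_triangle by metis
        then show ?thesis
          using a(4)[OF t] b(4)[OF t] by linarith
      qed
      show "nrm B1 (F (Complex 1 t) + G (Complex 1 t)) \<le> K + L" for t
        using B1.nrm_triangle[OF interp_functions_boundary(2)[OF a(2), of t]
            interp_functions_boundary(2)[OF b(2), of t]] a(5)[of t] b(5)[of t] by linarith
    qed (use a b in simp)
    then show "a + b \<in> A (u + v)"
      using a b by (simp add: functional_add algebra_simps)
  next
    fix c :: real and u a assume c: "0 < c" and u: "u \<in> bounded_functions" and "a \<in> A u"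
    then obtain g K F where a: "a = (\<integral>t. g t \<partial>arc_measure) + 2 * pi * \<theta> * K + 2 * pi * Re (\<phi> (F \<theta>))"
        "F \<in> \<F>" "integrable arc_measure g" "\<And>t. t \<in> J \<Longrightarrow> nrm B0 (u t - arc_values F t) \<le> g t"
        "\<And>t. nrm B1 (F (Complex 1 t)) \<le> K"
      unfolding A_def by blast
    have "(\<integral>t. c * g t \<partial>arc_measure) + 2 * pi * \<theta> * (c * K) + 2 * pi * Re (\<phi> (s (of_real c) (F \<theta>)))
        \<in> A (\<lambda>t. s (of_real c) (u t))"
    proof (rule AI[OF interp_functions_scale_const[OF a(2)]])
      show "nrm B0 (s (of_real c) (u t) - arc_values (\<lambda>z. s (of_real c) (F z)) t) \<le> c * g t"
        if t: "t \<in> J" for t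
      proof -
        have "u t - arc_values F t \<in> pts B0"
          using u arc_values_mem a(2) by (auto simp: bounded_functions_def)
        then show ?thesis
          using B0.nrm_scale[of "u t - arc_values F t" "of_real c"] a(4)[OF t] c
          by (simp add: arc_values_scale B0.scale_right_diff_distrib mult_left_mono)
      qed
      show "nrm B1 (s (of_real c) (F (Complex 1 t))) \<le> c * K" for t
        using a(5)[of t] c by (simp add: B1.nrm_scale[OF interp_functions_boundary(2)[OF a(2)]] mult_left_mono)
    qed (use a in simp)
    then show "c * a \<in> A (\<lambda>t. s (of_real c) (u t))"
      using a by (simp add: functional_scale algebra_simps)
  qed blast
  have neg: "m (- u) = - m u" if "u \<in> bounded_functions" for u
    using m(2)[OF that, of "- 1"] by (simp add: fun_Compl_def)
  show ?thesis
  proof (rule that)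
    show "dominated m 1"
      unfolding dominated_def
    proof (intro conjI ballI allI impI)
      fix u g assume u: "u \<in> bounded_functions" and g: "integrable arc_measure g" "\<forall>t\<in>J. nrm B0 (u t) \<le> g t"
      have "m u \<le> (\<integral>t. g t \<partial>arc_measure)"
        using m(3)[OF u AI0[OF g(1)]] g(2) by blast
      moreover have "m (- u) \<le> (\<integral>t. g t \<partial>arc_measure)"
        using u g by (intro m(3) AI0 bounded_functions_minus) (auto simp: bounded_functions_def)
      ultimately show "\<bar>m u\<bar> \<le> 1 * (\<integral>t. g t \<partial>arc_measure)"
        using neg[OF u] by simp
    qed (use m in auto)
    have le: "m (arc_values F) \<le> 2 * pi * \<theta> * K + 2 * pi * Re (\<phi> (F \<theta>))"
      if F: "F \<in> \<F>" and K: "\<And>t. nrm B1 (F (Complex 1 t)) \<le> K" for F K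
      using m(3)[OF arc_values_bounded[OF F] AI[OF F _ _ K, of "\<lambda>_. 0"]] by simp
    fix F K assume F: "F \<in> \<F>" and K: "\<And>t. nrm B1 (F (Complex 1 t)) \<le> K"
    have "m (arc_values (\<lambda>z. s (- 1) (F z))) \<le> 2 * pi * \<theta> * K + 2 * pi * Re (\<phi> (s (- 1) (F \<theta>)))"
      using K B1.nrm_scale[OF interp_functions_boundary(2)[OF F], of "- 1"]
      by (intro le interp_functions_scale_const F) simp
    moreover have "arc_values (\<lambda>z. s (- 1) (F z)) = - arc_values F"
      by (auto simp: arc_values_def fun_eq_iff)
    ultimately show "\<bar>m (arc_values F) - 2 * pi * Re (\<phi> (F \<theta>))\<bar> \<le> 2 * pi * \<theta> * K"
      using le[OF F K] neg[OF arc_values_bounded[OF F]] functional_scale[OF F, of "- 1"]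
      by (simp add: abs_le_iff)
  qed
qed

end

section \<open>Rotundity\<close>

context complex_interpolation
begin

text \<open>The density of \<kappa> is at most 2 and \<open>J\<close> has length
  \<open>2 * pi * (1 - \<theta>)\<close>, so \<open>4 * pi * (1 - \<theta>)\<close> is the largest
  conceivable value. The whole deficit can at worst fall on \<open>E\<close>, where the average
  still exceeds \<open>2 - \<epsilon> / 2\<close>; \<open>localise\<close> spends the other half of
  \<epsilon>.\<close>

lemma approximate_norming:
  assumes \<kappa>: "dominated \<kappa> 2" and E: "E \<in> sets arc_measure" "0 < measure arc_measure E"
    and F: "F \<in> \<F>" "\<And>t. nrm B0 (F (Complex 0 t)) \<le> 1"
    and less: "4 * pi * (1 - \<theta>) - \<epsilon> * measure arc_measure E / 2 < \<kappa> (arc_values F)"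
    and e: "0 < \<epsilon>"
  obtains E' y where "E' \<in> sets arc_measure" "E' \<subseteq> E" "0 < measure arc_measure E'"
    "y \<in> pts B0" "nrm B0 y \<le> 1"
    "\<And>X. X \<in> sets arc_measure \<Longrightarrow> X \<subseteq> E' \<Longrightarrow>
      (2 - \<epsilon>) * measure arc_measure X \<le> \<kappa> (restr X (\<lambda>_. y))"
proof -
  interpret finite_measure arc_measure by (rule finite_arc_measure)
  note Fb = arc_values_bounded[OF F(1)]
  have JE: "J - E \<in> sets arc_measure" and EJ: "E \<subseteq> J" and Js: "J \<in> sets arc_measure"
    using E(1) sets.compl_sets[OF E(1)] sets.top[of arc_measure] by (auto simp: sets_arc_measure)
  have "restr (E \<union> (J - E)) (arc_values F) = arc_values F"
    using EJ arc_values_outside[of _ F] by (auto simp: restr_def fun_eq_iff)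
  then have split: "\<kappa> (arc_values F) = \<kappa> (restr E (arc_values F)) + \<kappa> (restr (J - E) (arc_values F))"
    using dominated_restr_Un[OF \<kappa> Fb, of E "J - E"] by simp
  have "\<bar>\<kappa> (restr (J - E) (arc_values F))\<bar> \<le> 2 * (1 * measure arc_measure (J - E))"
    by (rule dominated_restr_le[OF \<kappa> Fb JE]) (rule nrm_arc_values_le[OF F])
  moreover have "measure arc_measure (J - E) = 2 * pi * (1 - \<theta>) - measure arc_measure E"
    using finite_measure_Diff[OF Js E(1) EJ] measure_arc_J by simp
  ultimately have "\<kappa> (restr (J - E) (arc_values F)) \<le> 4 * pi * (1 - \<theta>) - 2 * measure arc_measure E"
    by (simp add: algebra_simps abs_le_iff)
  then have "(2 - \<epsilon> / 2) * measure arc_measure E < \<kappa> (restr E (arc_values F))"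
    using less split by (simp add: algebra_simps)
  moreover have "2 - \<epsilon> < 2 - \<epsilon> / 2" using e by simp
  ultimately obtain E' t where "E' \<in> sets arc_measure" "E' \<subseteq> E" "0 < measure arc_measure E'"
    "\<And>X. X \<in> sets arc_measure \<Longrightarrow> X \<subseteq> E' \<Longrightarrow>
      (2 - \<epsilon>) * measure arc_measure X \<le> \<kappa> (restr X (\<lambda>_. arc_values F t))"
    using localise[OF \<kappa> F(1) E(1)] by blast
  then show ?thesis
    using that[of E' "arc_values F t"] arc_values_mem[OF F(1)] nrm_arc_values_le[OF F] by blast
qed

text \<open>The multiplier fixes the value at \<theta> and makes \<open>F\<close> small on
  \<open>Re z = 1\<close>. It may be huge on the imaginary axis, which is harmless as only the sign
  of the difference is claimed.\<close>

lemma separating_vector: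
  assumes \<phi>: "interpolation_functional s B0 B1 \<theta> \<phi>" and \<psi>: "interpolation_functional s B0 B1 \<theta> \<psi>"
    and m: "\<And>F K. F \<in> \<F> \<Longrightarrow> (\<And>t. nrm B1 (F (Complex 1 t)) \<le> K) \<Longrightarrow>
       \<bar>m (arc_values F) - 2 * pi * Re (\<phi> (F \<theta>))\<bar> \<le> 2 * pi * \<theta> * K"
    and \<mu>: "\<And>F K. F \<in> \<F> \<Longrightarrow> (\<And>t. nrm B1 (F (Complex 1 t)) \<le> K) \<Longrightarrow>
       \<bar>\<mu> (arc_values F) - 2 * pi * Re (\<psi> (F \<theta>))\<bar> \<le> 2 * pi * \<theta> * K"
    and G: "G \<in> \<F>" "\<phi> (G \<theta>) \<noteq> \<psi> (G \<theta>)"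
  obtains F where "F \<in> \<F>" "0 < m (arc_values F) - \<mu> (arc_values F)"
proof -
  interpret \<phi>: interpolation_functional s B0 B1 \<theta> \<phi> by (rule \<phi>)
  interpret \<psi>: interpolation_functional s B0 B1 \<theta> \<psi> by (rule \<psi>)
  define a where "a = \<phi> (G \<theta>) - \<psi> (G \<theta>)"
  define d where "d = (cmod a)\<^sup>2"
  have d: "0 < d" using G(2) by (simp add: d_def a_def)
  \<comment> \<open>The extensions see real parts only; this rotation turns the difference at
    \<theta> into the positive number \<open>d\<close>.\<close>
  define G1 where "G1 z = s (cnj a) (G z)" for z
  have G1: "G1 \<in> \<F>"
    unfolding G1_def[abs_def] by (rule interp_functions_scale_const[OF G(1)])
  have "\<phi> (G1 \<theta>) - \<psi> (G1 \<theta>) = cnj a * a"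
    unfolding G1_def \<phi>.functional_scale[OF G(1)] \<psi>.functional_scale[OF G(1)] a_def
    by (simp add: algebra_simps)
  also have "\<dots> = of_real d"
    using complex_norm_square[of a] by (simp add: d_def mult.commute)
  finally have "Re (\<phi> (G1 \<theta>) - \<psi> (G1 \<theta>)) = d" by simp
  then have diff: "Re (\<phi> (G1 \<theta>)) = Re (\<psi> (G1 \<theta>)) + d" by simp
  obtain K where K: "0 < K" "\<And>t. nrm B1 (G1 (Complex 1 t)) \<le> K"
    using B1.C0_intoD(5)[OF interp_functionsD(6)[OF G1]] by blast
  \<comment> \<open>Gives \<open>k\<close> the modulus \<open>d / (4 * K)\<close> on
    \<open>Re z = 1\<close>. Each of the two errors then stays below \<open>pi * d\<close>, half of
    the gap \<open>2 * pi * d\<close>.\<close>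
  define n where "n = - ln (d / (4 * K)) / (1 - \<theta>)"
  define k where "k z = exp (- of_real n * (z - of_real \<theta>))" for z :: complex
  define F where "F z = s (k z) (G1 z)" for z
  have k: "cmod (k z) = exp (- n * (Re z - \<theta>))" for z
    by (simp add: k_def)
  have F: "F \<in> \<F>"
    unfolding F_def[abs_def]
  proof (rule interp_functions_scale[OF G1])
    show "continuous_on strip k" "k holomorphic_on open_strip"
      unfolding k_def[abs_def] by (auto intro!: continuous_intros holomorphic_intros)
    show "cmod (k z) \<le> exp \<bar>n\<bar>" if "z \<in> strip" for z
    proof -
      have "\<bar>Re z - \<theta>\<bar> \<le> 1" using that \<theta> by (auto simp: strip_eq)
      then have "\<bar>n\<bar> * \<bar>Re z - \<theta>\<bar> \<le> \<bar>n\<bar> * 1" by (intro mult_left_mono) auto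
      then have "\<bar>- n * (Re z - \<theta>)\<bar> \<le> \<bar>n\<bar>" by (simp add: abs_mult)
      then show ?thesis unfolding k by simp
    qed
  qed
  have F\<theta>: "F \<theta> = G1 \<theta>" by (simp add: F_def k_def)
  have "cmod (k (Complex 1 t)) = d / (4 * K)" for t
    unfolding k n_def using \<theta> d K by simp
  then have F1: "nrm B1 (F (Complex 1 t)) \<le> d / 4" for t
    using K d mult_left_mono[OF K(2)[of t], of "d / (4 * K)"]
    by (simp add: F_def B1.nrm_scale[OF interp_functions_boundary(2)[OF G1]])
  have "2 * pi * \<theta> * (d / 4) < pi * d"
    using \<theta> d mult_strict_right_mono[of \<theta> 2 "pi * d"] by simp
  moreover have "2 * pi * Re (\<phi> (G1 \<theta>)) = 2 * pi * Re (\<psi> (G1 \<theta>)) + 2 * (pi * d)"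
    by (simp add: diff algebra_simps)
  moreover note m[OF F F1] \<mu>[OF F F1]
  ultimately have "0 < m (arc_values F) - \<mu> (arc_values F)"
    unfolding F\<theta> by linarith
  with F that show ?thesis by blast
qed

text \<open>Hahn-Banach with the limit superior provides a weak limit of the averages of the two vector
  measures over shrinking sets.\<close>

lemma limit_functionals:
  fixes E :: "nat \<Rightarrow> real set"
  assumes m: "dominated m 1" and \<mu>: "dominated \<mu> 1"
    and E: "\<And>n. E n \<in> sets arc_measure" "\<And>n. 0 < measure arc_measure (E n)"
  obtains f g where
    "\<And>x y. x \<in> pts B0 \<Longrightarrow> y \<in> pts B0 \<Longrightarrow> f (x + y) = f x + f y"
    "\<And>c x. x \<in> pts B0 \<Longrightarrow> f (s (of_real c) x) = c * f x"
    "\<And>x. x \<in> pts B0 \<Longrightarrow> f x \<le> nrm B0 x"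
    "\<And>x y. x \<in> pts B0 \<Longrightarrow> y \<in> pts B0 \<Longrightarrow> g (x + y) = g x + g y"
    "\<And>c x. x \<in> pts B0 \<Longrightarrow> g (s (of_real c) x) = c * g x"
    "\<And>x. x \<in> pts B0 \<Longrightarrow> g x \<le> nrm B0 x"
    "\<And>x y r N. x \<in> pts B0 \<Longrightarrow> y \<in> pts B0 \<Longrightarrow>
      (\<And>n. N \<le> n \<Longrightarrow> r * measure arc_measure (E n) \<le>
         m (restr (E n) (\<lambda>_. x)) + \<mu> (restr (E n) (\<lambda>_. y))) \<Longrightarrow> r \<le> f x + g y"
proof -
  define av where "av \<kappa> n x = \<kappa> (restr (E n) (\<lambda>_. x)) / measure arc_measure (E n)"
    for \<kappa> :: "(real \<Rightarrow> 'a) \<Rightarrow> real" and n x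
  have av: "av \<kappa> n (x + y) = av \<kappa> n x + av \<kappa> n y" "av \<kappa> n (s (of_real c) x) = c * av \<kappa> n x"
    "\<bar>av \<kappa> n x\<bar> \<le> nrm B0 x" if \<kappa>: "dominated \<kappa> 1" and x: "x \<in> pts B0" "y \<in> pts B0" for \<kappa> n x y c
  proof -
    have b: "restr (E n) (\<lambda>_. x) \<in> bounded_functions" "restr (E n) (\<lambda>_. y) \<in> bounded_functions"
      by (intro restr_bounded const_bounded x)+
    have "restr (E n) (\<lambda>_. x + y) = restr (E n) (\<lambda>_. x) + restr (E n) (\<lambda>_. y)"
      by (auto simp: restr_def fun_eq_iff)
    then show "av \<kappa> n (x + y) = av \<kappa> n x + av \<kappa> n y"
      using dominatedD(2)[OF \<kappa> b] by (simp add: av_def add_divide_distrib)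
    have "restr (E n) (\<lambda>_. s (of_real c) x) = (\<lambda>t. s (of_real c) (restr (E n) (\<lambda>_. x) t))"
      by (auto simp: restr_def fun_eq_iff)
    then show "av \<kappa> n (s (of_real c) x) = c * av \<kappa> n x"
      using dominatedD(3)[OF \<kappa> b(1)] by (simp add: av_def)
    show "\<bar>av \<kappa> n x\<bar> \<le> nrm B0 x"
      using dominated_restr_le[OF \<kappa> const_bounded[OF x(1)] E(1) order_refl, of n] E(2)[of n]
      by (simp add: av_def field_simps)
  qed
  have av_minus: "av \<kappa> n (- x) = - av \<kappa> n x" if "dominated \<kappa> 1" "x \<in> pts B0" for \<kappa> n x
    using av(2)[OF that that(2), of n "- 1"] by simp
  have av0: "av \<kappa> n 0 = 0" if "dominated \<kappa> 1" for \<kappa> n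
    using av(2)[OF that, of 0 0 n 0] by simp
  define scl where "scl c z = (s (of_real c) (fst z), s (of_real c) (snd z))" for c :: real and z :: "'a \<times> 'a"
  \<comment> \<open>The infimum of these eventual upper bounds is the limit superior of the
    averages. Working on pairs lets inequalities that involve both measures pass to the
    limit.\<close>
  define A where "A z = {r. \<exists>N. \<forall>n\<ge>N. av m n (fst z) + av \<mu> n (snd z) \<le> r}" for z
  interpret pair: vector_space scl
    by unfold_locales
      (simp_all add: scl_def prod_eq_iff B0.scale_right_distrib B0.scale_left_distrib)
  have sub: "pair.subspace (pts B0 \<times> pts B0)"
    by (rule pair.subspaceI) (auto simp: scl_def zero_prod_def)
  obtain h where h: "\<And>z w. z \<in> pts B0 \<times> pts B0 \<Longrightarrow> w \<in> pts B0 \<times> pts B0 \<Longrightarrow> h (z + w) = h z + h w"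
    "\<And>c z. z \<in> pts B0 \<times> pts B0 \<Longrightarrow> h (scl c z) = c * h z"
    "\<And>z r. z \<in> pts B0 \<times> pts B0 \<Longrightarrow> r \<in> A z \<Longrightarrow> h z \<le> r"
  proof (rule Hahn_Banach_upper_bounds[OF pair.vector_space_axioms sub, of A])
    fix z assume z: "z \<in> pts B0 \<times> pts B0"
    then have x: "fst z \<in> pts B0" "snd z \<in> pts B0" by auto
    have b: "\<bar>av m n (fst z) + av \<mu> n (snd z)\<bar> \<le> nrm B0 (fst z) + nrm B0 (snd z)" for n
      using av(3)[OF m x(1,1), of n] av(3)[OF \<mu> x(2,2), of n] by linarith
    show "A z \<noteq> {}"
      using b unfolding A_def abs_le_iff by blast
    show "bdd_below (A z)"
    proof (rule bdd_belowI)
      fix r assume "r \<in> A z"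
      then obtain N where N: "\<And>n. N \<le> n \<Longrightarrow> av m n (fst z) + av \<mu> n (snd z) \<le> r"
        by (auto simp: A_def)
      have "av m N (fst z) + av \<mu> N (snd z) \<le> r" by (rule N) simp
      with b[of N] show "- (nrm B0 (fst z) + nrm B0 (snd z)) \<le> r" by linarith
    qed
  next
    fix z w r q assume zw: "z \<in> pts B0 \<times> pts B0" "w \<in> pts B0 \<times> pts B0" and "r \<in> A z" "q \<in> A w"
    then obtain N M where "\<And>n. N \<le> n \<Longrightarrow> av m n (fst z) + av \<mu> n (snd z) \<le> r"
      "\<And>n. M \<le> n \<Longrightarrow> av m n (fst w) + av \<mu> n (snd w) \<le> q"
      by (auto simp: A_def)
    moreover have "av m n (fst (z + w)) + av \<mu> n (snd (z + w)) =
        (av m n (fst z) + av \<mu> n (snd z)) + (av m n (fst w) + av \<mu> n (snd w))" for n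
      using zw av(1)[OF m, of "fst z" "fst w" n] av(1)[OF \<mu>, of "snd z" "snd w" n] by auto
    ultimately have "av m n (fst (z + w)) + av \<mu> n (snd (z + w)) \<le> r + q" if "max N M \<le> n" for n
      using that by (metis add_mono max.boundedE)
    then show "r + q \<in> A (z + w)"
      unfolding A_def by blast
  next
    fix c :: real and z r assume c: "0 < c" and z: "z \<in> pts B0 \<times> pts B0" and "r \<in> A z"
    then obtain N where N: "\<And>n. N \<le> n \<Longrightarrow> av m n (fst z) + av \<mu> n (snd z) \<le> r"
      by (auto simp: A_def)
    have "av m n (fst (scl c z)) + av \<mu> n (snd (scl c z)) = c * (av m n (fst z) + av \<mu> n (snd z))" for n
      using z av(2)[OF m, of "fst z" "fst z" n c] av(2)[OF \<mu>, of "snd z" "snd z" n c]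
      by (auto simp: scl_def algebra_simps)
    with N show "c * r \<in> A (scl c z)"
      unfolding A_def using c by (intro CollectI exI[of _ N] allI impI) simp
  qed blast
  show ?thesis
  proof (rule that[of "\<lambda>x. h (x, 0)" "\<lambda>y. h (0, y)"])
    fix x y assume x: "x \<in> pts B0" and y: "y \<in> pts B0"
    show "h (x + y, 0) = h (x, 0) + h (y, 0)" "h (0, x + y) = h (0, x) + h (0, y)"
      using h(1)[of "(x, 0)" "(y, 0)"] h(1)[of "(0, x)" "(0, y)"] x y by simp_all
    fix r N
    assume ge: "\<And>n. N \<le> n \<Longrightarrow> r * measure arc_measure (E n) \<le>
         m (restr (E n) (\<lambda>_. x)) + \<mu> (restr (E n) (\<lambda>_. y))"
    have "r \<le> av m n x + av \<mu> n y" if "N \<le> n" for n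
      using ge[OF that] E(2)[of n] by (simp add: av_def field_simps flip: add_divide_distrib)
    \<comment> \<open>A linear functional below the limit superior lies above the limit inferior;
      this is seen by passing to \<open>(- x, - y)\<close>.\<close>
    then have "- r \<in> A (- x, - y)"
      unfolding A_def using x y by (intro CollectI exI[of _ N]) (force simp: av_minus[OF m] av_minus[OF \<mu>])
    then have "h (- x, - y) \<le> - r"
      using x y by (intro h(3)) auto
    moreover have "h (- x, - y) = - (h (x, 0) + h (0, y))"
      using h(1)[of "(x, 0)" "(0, y)"] h(2)[of "(x, y)" "- 1"] x y by (simp add: scl_def)
    ultimately show "r \<le> h (x, 0) + h (0, y)" by simp
  next
    fix c x assume x: "x \<in> pts B0"
    show "h (s (of_real c) x, 0) = c * h (x, 0)" "h (0, s (of_real c) x) = c * h (0, x)"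
      using h(2)[of "(x, 0)" c] h(2)[of "(0, x)" c] x by (simp_all add: scl_def)
    have "av m n x \<le> nrm B0 x" "av \<mu> n x \<le> nrm B0 x" for n
      using av(3)[OF m x x, of n] av(3)[OF \<mu> x x, of n] by simp_all
    then have "nrm B0 x \<in> A (x, 0)" "nrm B0 x \<in> A (0, x)"
      by (auto simp: A_def av0[OF m] av0[OF \<mu>])
    then show "h (x, 0) \<le> nrm B0 x" "h (0, x) \<le> nrm B0 x"
      using x by (auto intro: h(3))
  qed
qed

text \<open>Inside a set on which one vector separates the measures hereditarily, sets are shrunk so
  that stage \<open>n\<close> is normed up to \<open>1 / (n + 1)\<close>. Being hereditary, every
  bound holds along a whole tail of the sequence, which is all that the limit sees.\<close>

lemma real_functionals:
  assumes \<phi>: "interpolation_functional s B0 B1 \<theta> \<phi>" and \<psi>: "interpolation_functional s B0 B1 \<theta> \<psi>"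
    and near: "\<And>e. 0 < e \<Longrightarrow> \<exists>F\<in>\<F>. (\<forall>t. nrm B0 (F (Complex 0 t)) \<le> 1) \<and>
      (\<forall>t. nrm B1 (F (Complex 1 t)) \<le> 1) \<and> 2 - e < Re (\<phi> (F \<theta>)) + Re (\<psi> (F \<theta>))"
    and G: "G \<in> \<F>" "\<phi> (G \<theta>) \<noteq> \<psi> (G \<theta>)"
  obtains f g where
    "\<And>x y. x \<in> pts B0 \<Longrightarrow> y \<in> pts B0 \<Longrightarrow> f (x + y) = f x + f y"
    "\<And>c x. x \<in> pts B0 \<Longrightarrow> f (s (of_real c) x) = c * f x"
    "\<And>x. x \<in> pts B0 \<Longrightarrow> f x \<le> nrm B0 x"
    "\<And>x y. x \<in> pts B0 \<Longrightarrow> y \<in> pts B0 \<Longrightarrow> g (x + y) = g x + g y"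
    "\<And>c x. x \<in> pts B0 \<Longrightarrow> g (s (of_real c) x) = c * g x"
    "\<And>x. x \<in> pts B0 \<Longrightarrow> g x \<le> nrm B0 x"
    "\<And>e. 0 < e \<Longrightarrow> \<exists>y\<in>pts B0. nrm B0 y \<le> 1 \<and> 2 - e \<le> f y + g y"
    "\<exists>x\<in>pts B0. f x \<noteq> g x"
proof -
  interpret finite_measure arc_measure by (rule finite_arc_measure)
  obtain m where m: "dominated m 1"
    and m': "\<And>F K. F \<in> \<F> \<Longrightarrow> (\<And>t. nrm B1 (F (Complex 1 t)) \<le> K) \<Longrightarrow>
       \<bar>m (arc_values F) - 2 * pi * Re (\<phi> (F \<theta>))\<bar> \<le> 2 * pi * \<theta> * K"
    using interpolation_functional.extension_to_bounded_functions[OF \<phi>] by blast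
  obtain \<mu> where \<mu>: "dominated \<mu> 1"
    and \<mu>': "\<And>F K. F \<in> \<F> \<Longrightarrow> (\<And>t. nrm B1 (F (Complex 1 t)) \<le> K) \<Longrightarrow>
       \<bar>\<mu> (arc_values F) - 2 * pi * Re (\<psi> (F \<theta>))\<bar> \<le> 2 * pi * \<theta> * K"
    using interpolation_functional.extension_to_bounded_functions[OF \<psi>] by blast
  have diff: "dominated (\<lambda>u. m u + - \<mu> u) (1 + 1)"
    by (intro dominated_add dominated_minus m \<mu>)
  have sum: "dominated (\<lambda>u. m u + \<mu> u) 2"
    using dominated_add[OF m \<mu>] by simp
  obtain H where H: "H \<in> \<F>" "0 < m (arc_values H) - \<mu> (arc_values H)"
    using separating_vector[OF \<phi> \<psi> m' \<mu>' G] by blast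
  \<comment> \<open>Half of the average over \<open>J\<close>: a strict inequality is required by
    \<open>localise\<close>, which then lowers the bound to \<open>c / 2\<close>.\<close>
  define c where "c = (m (arc_values H) - \<mu> (arc_values H)) / (2 * measure arc_measure J)"
  have mJ: "0 < measure arc_measure J"
    using measure_arc_J \<theta> by simp
  have "0 < c" using H(2) mJ by (simp add: c_def)
  then have c: "0 < c" "c / 2 < c" by simp_all
  have Js: "J \<in> sets arc_measure" using sets.top[of arc_measure] by simp
  have "restr J (arc_values H) = arc_values H"
    using arc_values_outside[of _ H] by (auto simp: restr_def fun_eq_iff)
  then have "c * measure arc_measure J < m (restr J (arc_values H)) + - \<mu> (restr J (arc_values H))"
    using H(2) mJ by (simp add: c_def)
  from localise[OF diff H(1) Js this c(2)] obtain E0 t0 where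
    E0: "E0 \<in> sets arc_measure" "0 < measure arc_measure E0"
    and x0: "\<And>X. X \<in> sets arc_measure \<Longrightarrow> X \<subseteq> E0 \<Longrightarrow>
      c / 2 * measure arc_measure X \<le>
        m (restr X (\<lambda>_. arc_values H t0)) + - \<mu> (restr X (\<lambda>_. arc_values H t0))"
    by metis
  define x where "x = arc_values H t0"
  have x: "x \<in> pts B0" unfolding x_def by (rule arc_values_mem[OF H(1)])
  have step: "\<exists>E'. (E' \<in> sets arc_measure \<and> 0 < measure arc_measure E' \<and> E' \<subseteq> E0) \<and>
      E' \<subseteq> E \<and> (\<exists>y\<in>pts B0. nrm B0 y \<le> 1 \<and> (\<forall>X\<in>sets arc_measure. X \<subseteq> E' \<longrightarrow>
        (2 - inverse (real (Suc n))) * measure arc_measure X \<le>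
          m (restr X (\<lambda>_. y)) + \<mu> (restr X (\<lambda>_. y))))"
    if E: "E \<in> sets arc_measure \<and> 0 < measure arc_measure E \<and> E \<subseteq> E0" for E n
  proof -
    \<comment> \<open>The defect \<open>q / (4 * pi)\<close> becomes \<open>q / 2\<close> after
      multiplication by \<open>2 * pi\<close>, the slack that \<open>approximate_norming\<close>
      allows. The two errors \<open>2 * pi * \<theta>\<close> turn \<open>4 * pi\<close> into
      \<open>4 * pi * (1 - \<theta>)\<close>.\<close>
    define q where "q = inverse (real (Suc n)) * measure arc_measure E"
    let ?e = "q / (4 * pi)"
    have "0 < ?e" using E by (simp add: q_def)
    from near[OF this] obtain F where F: "F \<in> \<F>" "\<And>t. nrm B0 (F (Complex 0 t)) \<le> 1"
      "\<And>t. nrm B1 (F (Complex 1 t)) \<le> 1" "2 - ?e < Re (\<phi> (F \<theta>)) + Re (\<psi> (F \<theta>))"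
      by blast
    have "2 * pi * (2 - ?e) < 2 * pi * (Re (\<phi> (F \<theta>)) + Re (\<psi> (F \<theta>)))"
      using F(4) by (intro mult_strict_left_mono) auto
    moreover have "2 * pi * (2 - ?e) = 4 * pi - q / 2"
      by (simp add: field_simps)
    ultimately have "4 * pi * (1 - \<theta>) - inverse (real (Suc n)) * measure arc_measure E / 2 <
        m (arc_values F) + \<mu> (arc_values F)"
      using m'[OF F(1,3)] \<mu>'[OF F(1,3)]
      unfolding q_def[symmetric] by (simp add: algebra_simps abs_le_iff)
    moreover have "0 < inverse (real (Suc n))" by simp
    ultimately obtain E' y where "E' \<in> sets arc_measure" "E' \<subseteq> E" "0 < measure arc_measure E'"
      "y \<in> pts B0" "nrm B0 y \<le> 1"
      "\<And>X. X \<in> sets arc_measure \<Longrightarrow> X \<subseteq> E' \<Longrightarrow> (2 - inverse (real (Suc n))) * measure arc_measure X \<le>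
        m (restr X (\<lambda>_. y)) + \<mu> (restr X (\<lambda>_. y))"
      using approximate_norming[OF sum _ _ F(1,2)] E by blast
    then show ?thesis using E by blast
  qed
  have "\<exists>E. \<forall>n. (E n \<in> sets arc_measure \<and> 0 < measure arc_measure (E n) \<and> E n \<subseteq> E0) \<and>
      (E (Suc n) \<subseteq> E n \<and> (\<exists>y\<in>pts B0. nrm B0 y \<le> 1 \<and> (\<forall>X\<in>sets arc_measure. X \<subseteq> E (Suc n) \<longrightarrow>
        (2 - inverse (real (Suc n))) * measure arc_measure X \<le>
          m (restr X (\<lambda>_. y)) + \<mu> (restr X (\<lambda>_. y)))))"
    by (rule dependent_nat_choice) (use E0 step in blast)+
  then obtain E where E: "\<And>n. E n \<in> sets arc_measure" "\<And>n. 0 < measure arc_measure (E n)"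
    "\<And>n. E n \<subseteq> E0" "\<And>n. E (Suc n) \<subseteq> E n"
    and y: "\<And>n. \<exists>y\<in>pts B0. nrm B0 y \<le> 1 \<and> (\<forall>X\<in>sets arc_measure. X \<subseteq> E (Suc n) \<longrightarrow>
        (2 - inverse (real (Suc n))) * measure arc_measure X \<le>
          m (restr X (\<lambda>_. y)) + \<mu> (restr X (\<lambda>_. y)))"
    by metis
  have mono: "E n \<subseteq> E k" if "k \<le> n" for n k
    by (rule lift_Suc_antimono_le[of E, OF E(4) that])
  show ?thesis
  proof (rule limit_functionals[OF m \<mu> E(1,2)])
    fix f g
    assume f: "\<And>x y. x \<in> pts B0 \<Longrightarrow> y \<in> pts B0 \<Longrightarrow> f (x + y) = f x + f y"
      "\<And>c x. x \<in> pts B0 \<Longrightarrow> f (s (of_real c) x) = c * f x" "\<And>x. x \<in> pts B0 \<Longrightarrow> f x \<le> nrm B0 x"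
      and g: "\<And>x y. x \<in> pts B0 \<Longrightarrow> y \<in> pts B0 \<Longrightarrow> g (x + y) = g x + g y"
      "\<And>c x. x \<in> pts B0 \<Longrightarrow> g (s (of_real c) x) = c * g x" "\<And>x. x \<in> pts B0 \<Longrightarrow> g x \<le> nrm B0 x"
      and ge: "\<And>x y r N. x \<in> pts B0 \<Longrightarrow> y \<in> pts B0 \<Longrightarrow>
        (\<And>n. N \<le> n \<Longrightarrow> r * measure arc_measure (E n) \<le>
         m (restr (E n) (\<lambda>_. x)) + \<mu> (restr (E n) (\<lambda>_. y))) \<Longrightarrow> r \<le> f x + g y"
    have "\<exists>y\<in>pts B0. nrm B0 y \<le> 1 \<and> 2 - e \<le> f y + g y" if "0 < e" for e
    proof -
      obtain k where k: "inverse (real (Suc k)) < e"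
        using reals_Archimedean[OF \<open>0 < e\<close>] by blast
      obtain y where y: "y \<in> pts B0" "nrm B0 y \<le> 1"
        "\<And>X. X \<in> sets arc_measure \<Longrightarrow> X \<subseteq> E (Suc k) \<Longrightarrow>
          (2 - inverse (real (Suc k))) * measure arc_measure X \<le>
            m (restr X (\<lambda>_. y)) + \<mu> (restr X (\<lambda>_. y))"
        using y[of k] by blast
      have "2 - inverse (real (Suc k)) \<le> f y + g y"
        by (intro ge[OF y(1,1), of "Suc k"] y(3) E(1) mono)
      with k y show ?thesis by (intro bexI[of _ y]) auto
    qed
    moreover have "\<mu> (restr (E n) (\<lambda>_. - x)) = - \<mu> (restr (E n) (\<lambda>_. x))" for n
    proof -
      have "restr (E n) (\<lambda>_. - x) = (\<lambda>t. s (of_real (- 1)) (restr (E n) (\<lambda>_. x) t))"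
        by (auto simp: restr_def fun_eq_iff)
      then show ?thesis
        using dominatedD(3)[OF \<mu> restr_bounded[OF const_bounded[OF x]], of "- 1"] by simp
    qed
    \<comment> \<open>The separation is the pair bound at \<open>(x, - x)\<close>, so it passes
      through the same limit as the norming bounds.\<close>
    then have "c / 2 \<le> f x + g (- x)"
      using x x0[OF E(1,3)] by (intro ge[of x "- x" 0]) (auto simp: x_def)
    then have "f x \<noteq> g x"
      using g(2)[OF x, of "- 1"] c by simp
    ultimately show thesis
      using x by (intro that[OF f g]) auto
  qed
qed

end

section \<open>From real functionals to rotundity of the complex dual\<close>

lemma rotation_to_modulus:
  obtains u where "cmod u = 1" "u * b = of_real (cmod b)"
proof (cases "b = 0")
  case False
  have "cnj b * b = of_real (cmod b) ^ 2"
    using complex_norm_square[of b] by (simp add: mult.commute)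
  then have "cnj b / of_real (cmod b) * b = of_real (cmod b) ^ 2 / of_real (cmod b)"
    by simp
  then show ?thesis
    using False by (intro that[of "cnj b / of_real (cmod b)"])
      (simp_all add: norm_divide power2_eq_square)
qed (rule that[of 1]; simp)

lemma (in complex_normed_space) complexification:
  assumes add: "\<And>x y. x \<in> pts X \<Longrightarrow> y \<in> pts X \<Longrightarrow> f (x + y) = f x + f y"
    and scale: "\<And>c x. x \<in> pts X \<Longrightarrow> f (s (of_real c) x) = c * f x"
    and le: "\<And>x. x \<in> pts X \<Longrightarrow> f x \<le> nrm X x"
  obtains h where "h \<in> pts (dual s X)" "\<And>x. x \<in> pts X \<Longrightarrow> Re (h x) = f x"
    "\<And>x. x \<in> pts X \<Longrightarrow> cmod (h x) \<le> nrm X x"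
proof -
  define h where "h x = (if x \<in> pts X then Complex (f x) (- f (s \<i> x)) else 0)" for x
  have hX: "h x = Complex (f x) (- f (s \<i> x))" if "x \<in> pts X" for x
    using that by (simp add: h_def)
  have h_add: "h (x + y) = h x + h y" if "x \<in> pts X" "y \<in> pts X" for x y
    using that by (simp add: hX pts_add pts_scale scale_right_distrib add complex_eq_iff)
  have h_scale: "h (s c x) = c * h x" if x: "x \<in> pts X" for c x
  proof -
    have split: "s d x = s (of_real (Re d)) x + s (of_real (Im d)) (s \<i> x)" for d
    proof -
      have "d = of_real (Re d) + of_real (Im d) * \<i>" by (simp add: complex_eq_iff)
      then show ?thesis by (metis scale_left_distrib scale_scale)
    qed
    have f: "f (s d x) = Re d * f x + Im d * f (s \<i> x)" for d
      unfolding split[of d] using x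
      by (simp only: add[OF pts_scale pts_scale[OF pts_scale]] scale[OF pts_scale] scale[OF x])
    have "f (s \<i> (s c x)) = - Im c * f x + Re c * f (s \<i> x)"
      using f[of "\<i> * c"] by simp
    then show ?thesis
      using x f[of c] by (simp add: hX pts_scale complex_eq_iff)
  qed
  have h_le: "cmod (h x) \<le> nrm X x" if x: "x \<in> pts X" for x
  proof -
    obtain u where u: "cmod u = 1" "u * h x = of_real (cmod (h x))"
      by (rule rotation_to_modulus)
    then have "cmod (h x) = Re (h (s u x))"
      by (simp add: h_scale[OF x])
    also have "\<dots> = f (s u x)"
      using x by (simp add: hX pts_scale)
    also have "\<dots> \<le> nrm X (s u x)"
      using x by (intro le pts_scale)
    also have "\<dots> = nrm X x"
      using x u(1) by (simp add: nrm_scale)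
    finally show ?thesis .
  qed
  have "h \<in> pts (dual s X)"
    unfolding dual_def using h_add h_scale h_le
    by (auto simp: h_def intro!: exI[of _ 1])
  with h_le hX that[of h] show ?thesis by simp
qed

lemma dual_nrm_ge:
  assumes "\<And>x. x \<in> pts X \<Longrightarrow> 0 \<le> nrm X x" "\<And>x. x \<in> pts X \<Longrightarrow> cmod (h x) \<le> C * nrm X x"
    and "x \<in> pts X" "nrm X x \<le> 1"
  shows "cmod (h x) \<le> nrm (dual s X) h"
  unfolding dual_def nspace.simps
proof (rule cSUP_upper)
  show "bdd_above ((\<lambda>x. cmod (h x)) ` {x \<in> pts X. nrm X x \<le> 1})"
  proof (rule bdd_aboveI2)
    fix x assume x: "x \<in> {x \<in> pts X. nrm X x \<le> 1}"
    have "cmod (h x) \<le> C * nrm X x" using assms(2) x by simp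
    also have "\<dots> \<le> \<bar>C\<bar> * 1" using assms(1) x by (intro mult_mono) auto
    finally show "cmod (h x) \<le> \<bar>C\<bar>" by simp
  qed
qed (use assms in simp)

lemma dual_nrm_le:
  assumes "0 \<in> pts X" "nrm X 0 \<le> 1" "\<And>x. x \<in> pts X \<Longrightarrow> nrm X x \<le> 1 \<Longrightarrow> cmod (h x) \<le> r"
  shows "nrm (dual s X) h \<le> r"
  unfolding dual_def nspace.simps using assms by (intro cSUP_least) auto

text \<open>Complexification puts both functionals in the dual unit ball. The norming vectors push
  the sum of the two norms up to 2 and the norm of the midpoint up to 1, so both lie on the sphere
  and rotundity forces them to agree.\<close>

lemma (in complex_normed_space) rotund_dual_real_functionals:
  assumes rot: "rotund fun_scale (dual s X)"
    and f: "\<And>x y. x \<in> pts X \<Longrightarrow> y \<in> pts X \<Longrightarrow> f (x + y) = f x + f y"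
    "\<And>c x. x \<in> pts X \<Longrightarrow> f (s (of_real c) x) = c * f x" "\<And>x. x \<in> pts X \<Longrightarrow> f x \<le> nrm X x"
    and g: "\<And>x y. x \<in> pts X \<Longrightarrow> y \<in> pts X \<Longrightarrow> g (x + y) = g x + g y"
    "\<And>c x. x \<in> pts X \<Longrightarrow> g (s (of_real c) x) = c * g x" "\<And>x. x \<in> pts X \<Longrightarrow> g x \<le> nrm X x"
    and norming: "\<And>e. 0 < e \<Longrightarrow> \<exists>y\<in>pts X. nrm X y \<le> 1 \<and> 2 - e \<le> f y + g y"
    and x: "x \<in> pts X"
  shows "f x = g x"
proof (rule ccontr)
  assume differ: "f x \<noteq> g x"
  obtain h where h: "h \<in> pts (dual s X)" "\<And>x. x \<in> pts X \<Longrightarrow> Re (h x) = f x"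
    "\<And>x. x \<in> pts X \<Longrightarrow> cmod (h x) \<le> nrm X x"
    using complexification[of f, OF f] by blast
  obtain k where k: "k \<in> pts (dual s X)" "\<And>x. x \<in> pts X \<Longrightarrow> Re (k x) = g x"
    "\<And>x. x \<in> pts X \<Longrightarrow> cmod (k x) \<le> nrm X x"
    using complexification[of g, OF g] by blast
  have nrm_le: "nrm (dual s X) h \<le> 1" "nrm (dual s X) k \<le> 1"
    using order_trans[OF h(3)] order_trans[OF k(3)] by (intro dual_nrm_le; simp)+
  have sum_ge: "2 - e \<le> nrm (dual s X) h + nrm (dual s X) k"
    and mid_ge: "1 - e / 2 \<le> nrm (dual s X) (fun_scale (1 / 2) (h + k))" if e: "0 < e" for e
  proof -
    obtain y where y: "y \<in> pts X" "nrm X y \<le> 1" "2 - e \<le> f y + g y"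
      using norming[OF e] by blast
    have "f y \<le> cmod (h y)" "g y \<le> cmod (k y)"
      using complex_Re_le_cmod[of "h y"] complex_Re_le_cmod[of "k y"] h(2) k(2) y(1) by simp_all
    moreover have "cmod (h y) \<le> nrm (dual s X) h" "cmod (k y) \<le> nrm (dual s X) k"
      using dual_nrm_ge[OF nrm_nonneg _ y(1,2), of h 1] h(3)
        dual_nrm_ge[OF nrm_nonneg _ y(1,2), of k 1] k(3) by simp_all
    ultimately show "2 - e \<le> nrm (dual s X) h + nrm (dual s X) k"
      using y(3) by linarith
    have "cmod (fun_scale (1 / 2) (h + k) y) \<le> nrm (dual s X) (fun_scale (1 / 2) (h + k))"
    proof (rule dual_nrm_ge[OF nrm_nonneg _ y(1,2), where C = 1])
      fix x assume x: "x \<in> pts X"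
      have "cmod (fun_scale (1 / 2) (h + k) x) = cmod (h x + k x) / 2"
        by (simp add: fun_scale_def norm_divide)
      also have "\<dots> \<le> 1 * nrm X x"
        using h(3)[OF x] k(3)[OF x] norm_triangle_ineq[of "h x" "k x"] by simp
      finally show "cmod (fun_scale (1 / 2) (h + k) x) \<le> 1 * nrm X x" .
    qed
    note le = this
    have "1 - e / 2 \<le> (f y + g y) / 2"
      using y(3) by simp
    also have "\<dots> = Re (fun_scale (1 / 2) (h + k) y)"
      using h(2)[OF y(1)] k(2)[OF y(1)] by (simp add: fun_scale_def)
    also have "\<dots> \<le> cmod (fun_scale (1 / 2) (h + k) y)"
      by (rule complex_Re_le_cmod)
    also note le
    finally show "1 - e / 2 \<le> nrm (dual s X) (fun_scale (1 / 2) (h + k))" .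
  qed
  have "2 \<le> nrm (dual s X) h + nrm (dual s X) k"
  proof (rule field_le_epsilon)
    fix e :: real assume "0 < e"
    from sum_ge[OF this] show "2 \<le> nrm (dual s X) h + nrm (dual s X) k + e" by linarith
  qed
  then have "nrm (dual s X) h = 1" "nrm (dual s X) k = 1"
    using nrm_le by auto
  moreover have "h \<noteq> k"
    using differ h(2)[OF x] k(2)[OF x] by auto
  moreover define M where "M = nrm (dual s X) (fun_scale (1 / 2) (h + k))"
  ultimately have "M < 1"
    using rot h(1) k(1) unfolding rotund_def by blast
  \<comment> \<open>With \<open>e = 1 - M\<close> the lower bound for the midpoint norm reads
    \<open>M \<ge> 1\<close>.\<close>
  moreover from this have "1 - (1 - M) / 2 \<le> M"
    using mid_ge[of "1 - M"] unfolding M_def[symmetric] by simp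
  ultimately show False by (simp add: field_simps)
qed

section \<open>The norm of the interpolation space and its dual\<close>

context complex_interpolation
begin

abbreviation "B\<theta> \<equiv> interp_space s B0 B1 \<theta>"

lemma pts_interp_space: "pts B\<theta> = {F \<theta> |F. F \<in> \<F>}"
  by (simp add: interp_space_def)

lemma interp_function_norm_nonneg:
  assumes "F \<in> \<F>"
  shows "0 \<le> interp_function_norm B0 B1 F"
proof -
  have "nrm B0 (F (Complex 0 0)) \<le> interp_function_norm B0 B1 F"
    using interp_function_norm_le_iff[OF assms, of "interp_function_norm B0 B1 F"] by simp
  then show ?thesis
    using B0.nrm_nonneg[OF interp_functions_boundary(1)[OF assms, of 0]] by linarith
qed

lemma nrm_interp_space_le:
  assumes "F \<in> \<F>" "\<And>t. nrm B0 (F (Complex 0 t)) \<le> r" "\<And>t. nrm B1 (F (Complex 1 t)) \<le> r"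
  shows "nrm B\<theta> (F \<theta>) \<le> r"
proof -
  have "nrm B\<theta> (F \<theta>) \<le> interp_function_norm B0 B1 F"
    unfolding interp_space_def nspace.simps
  proof (rule cInf_lower)
    show "bdd_below {interp_function_norm B0 B1 G |G. G \<in> \<F> \<and> G \<theta> = F \<theta>}"
      using interp_function_norm_nonneg by (intro bdd_belowI[of _ 0]) blast
  qed (use assms(1) in blast)
  moreover have "interp_function_norm B0 B1 F \<le> r"
    using interp_function_norm_le_iff[OF assms(1)] assms(2,3) by blast
  ultimately show ?thesis by linarith
qed

lemma nrm_interp_space_lessD:
  assumes "a \<in> pts B\<theta>" "nrm B\<theta> a < r"
  shows "\<exists>F\<in>\<F>. F \<theta> = a \<and> (\<forall>t. nrm B0 (F (Complex 0 t)) \<le> r) \<and> (\<forall>t. nrm B1 (F (Complex 1 t)) \<le> r)"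
proof -
  have "{interp_function_norm B0 B1 F |F. F \<in> \<F> \<and> F \<theta> = a} \<noteq> {}"
    using assms(1) by (auto simp: pts_interp_space)
  from cInf_lessD[OF this, of r] assms(2)
  have "\<exists>x\<in>{interp_function_norm B0 B1 F |F. F \<in> \<F> \<and> F \<theta> = a}. x < r"
    by (simp only: interp_space_def nspace.simps)
  then obtain F where F: "F \<in> \<F>" "F \<theta> = a" "interp_function_norm B0 B1 F < r"
    by blast
  then have "\<forall>t. nrm B0 (F (Complex 0 t)) \<le> r \<and> nrm B1 (F (Complex 1 t)) \<le> r"
    using interp_function_norm_le_iff[OF F(1), of r] by simp
  with F(1,2) show ?thesis by blast
qed

lemma nrm_interp_space_nonneg: "a \<in> pts B\<theta> \<Longrightarrow> 0 \<le> nrm B\<theta> a"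
  unfolding pts_interp_space unfolding interp_space_def nspace.simps
  using interp_function_norm_nonneg by (intro cInf_greatest) blast+

lemma interpolation_functional_dual:
  assumes \<phi>: "\<phi> \<in> pts (dual s B\<theta>)" and le: "nrm (dual s B\<theta>) \<phi> \<le> 1"
  shows "interpolation_functional s B0 B1 \<theta> \<phi>"
proof unfold_locales
  have "\<exists>C. \<forall>x\<in>pts B\<theta>. cmod (\<phi> x) \<le> C * nrm B\<theta> x"
    using \<phi> by (simp add: dual_def)
  then obtain C where C: "\<And>x. x \<in> pts B\<theta> \<Longrightarrow> cmod (\<phi> x) \<le> C * nrm B\<theta> x"
    by blast
  have mem: "F \<theta> \<in> pts B\<theta>" if "F \<in> \<F>" for F
    using that by (auto simp: pts_interp_space)
  fix F assume F: "F \<in> \<F>"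
  show "\<phi> (F \<theta> + G \<theta>) = \<phi> (F \<theta>) + \<phi> (G \<theta>)" if "G \<in> \<F>" for G
    using \<phi> mem[OF F] mem[OF that] by (simp add: dual_def)
  show scale: "\<phi> (s c (F \<theta>)) = c * \<phi> (F \<theta>)" for c
    using \<phi> mem[OF F] by (simp add: dual_def)
  fix r assume r: "\<And>t. nrm B0 (F (Complex 0 t)) \<le> r" "\<And>t. nrm B1 (F (Complex 1 t)) \<le> r"
  have "0 \<le> r"
    using B0.nrm_nonneg[OF interp_functions_boundary(1)[OF F]] r(1) order_trans by blast
  show "cmod (\<phi> (F \<theta>)) \<le> r"
  proof (rule field_le_epsilon)
    fix e :: real assume e: "0 < e"
    \<comment> \<open>As \<open>r\<close> may be 0, the rescaling to the unit ball divides by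
      \<open>r + e\<close>.\<close>
    let ?G = "\<lambda>z. s (of_real (inverse (r + e))) (F z)"
    have G: "?G \<in> \<F>" by (rule interp_functions_scale_const[OF F])
    have "nrm B\<theta> (?G \<theta>) \<le> 1"
    proof (rule nrm_interp_space_le[OF G])
      have *: "inverse (r + e) * x \<le> 1" if "x \<le> r" for x
        using that e \<open>0 \<le> r\<close> by (simp add: field_simps)
      show "nrm B0 (?G (Complex 0 t)) \<le> 1" "nrm B1 (?G (Complex 1 t)) \<le> 1" for t
        using *[OF r(1)[of t]] *[OF r(2)[of t]] e \<open>0 \<le> r\<close>
        by (simp_all add: B0.nrm_scale B1.nrm_scale interp_functions_boundary[OF F] norm_inverse
            flip: of_real_add)
    qed
    then have "cmod (\<phi> (?G \<theta>)) \<le> nrm (dual s B\<theta>) \<phi>"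
      by (intro dual_nrm_ge[OF nrm_interp_space_nonneg C mem[OF G]])
    then have "cmod (\<phi> (?G \<theta>)) \<le> 1"
      using le by (rule order_trans)
    then have "inverse (r + e) * cmod (\<phi> (F \<theta>)) \<le> 1"
      using e \<open>0 \<le> r\<close> by (simp only: scale norm_mult norm_of_real) simp
    then show "cmod (\<phi> (F \<theta>)) \<le> r + e"
      using e \<open>0 \<le> r\<close> by (simp add: field_simps)
  qed
qed

lemma nrm_interp_space_zero: "0 \<in> pts B\<theta>" "nrm B\<theta> 0 \<le> 1"
proof -
  show "0 \<in> pts B\<theta>"
    unfolding pts_interp_space using interp_functions_zero
    by (intro CollectI exI[of _ "\<lambda>z. 0"]) simp
  show "nrm B\<theta> 0 \<le> 1"
    using nrm_interp_space_le[OF interp_functions_zero, of 1] by simp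
qed

lemma rotund_dual_interp_space:
  assumes rot: "rotund fun_scale (dual s B0)"
  shows "rotund fun_scale (dual s B\<theta>)"
  unfolding rotund_def
proof (intro ballI impI, elim conjE)
  fix \<phi> \<psi>
  assume \<phi>: "\<phi> \<in> pts (dual s B\<theta>)" "nrm (dual s B\<theta>) \<phi> = 1"
    and \<psi>: "\<psi> \<in> pts (dual s B\<theta>)" "nrm (dual s B\<theta>) \<psi> = 1" and neq: "\<phi> \<noteq> \<psi>"
  interpret \<phi>: interpolation_functional s B0 B1 \<theta> \<phi>
    using \<phi> by (intro interpolation_functional_dual) simp_all
  interpret \<psi>: interpolation_functional s B0 B1 \<theta> \<psi>
    using \<psi> by (intro interpolation_functional_dual) simp_all
  show "nrm (dual s B\<theta>) (fun_scale (1 / 2) (\<phi> + \<psi>)) < 1"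
  proof (rule ccontr)
    assume not_less: "\<not> ?thesis"
    have near: "\<exists>F\<in>\<F>. (\<forall>t. nrm B0 (F (Complex 0 t)) \<le> 1) \<and> (\<forall>t. nrm B1 (F (Complex 1 t)) \<le> 1) \<and>
        2 - e < Re (\<phi> (F \<theta>)) + Re (\<psi> (F \<theta>))" if e: "0 < e" for e
    proof -
      \<comment> \<open>One loss of \<open>e / 4\<close> occurs at the norming vector, another below
        at its representative \<open>F\<close>, as the infimum over representatives need not be
        attained. Together they stay within \<open>e\<close> because
        \<open>(2 - e) * (1 + e / 4) < 2 - e / 2\<close>.\<close>
      have "\<exists>a\<in>pts B\<theta>. nrm B\<theta> a \<le> 1 \<and> 1 - e / 4 < cmod (fun_scale (1 / 2) (\<phi> + \<psi>) a)"
      proof (rule ccontr)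
        assume "\<not> ?thesis"
        then have "nrm (dual s B\<theta>) (fun_scale (1 / 2) (\<phi> + \<psi>)) \<le> 1 - e / 4"
          by (intro dual_nrm_le nrm_interp_space_zero) (auto simp: not_less)
        with not_less e show False by simp
      qed
      then obtain a where a: "a \<in> pts B\<theta>" "nrm B\<theta> a \<le> 1"
        "1 - e / 4 < cmod (fun_scale (1 / 2) (\<phi> + \<psi>) a)"
        by blast
      define b where "b = \<phi> a + \<psi> a"
      have b: "2 - e / 2 < cmod b"
        using a(3) by (simp add: b_def fun_scale_def norm_divide)
      have "nrm B\<theta> a < 1 + e / 4" using a(2) e by simp
      then obtain F where F: "F \<in> \<F>" "F \<theta> = a"
        "\<And>t. nrm B0 (F (Complex 0 t)) \<le> 1 + e / 4" "\<And>t. nrm B1 (F (Complex 1 t)) \<le> 1 + e / 4"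
        using nrm_interp_space_lessD[OF a(1)] by blast
      obtain u where u: "cmod u = 1" "u * b = of_real (cmod b)"
        by (rule rotation_to_modulus)
      \<comment> \<open>Rotates the value of the sum to the positive axis and scales
        \<open>F\<close> back to boundary norm at most 1.\<close>
      define w where "w = u / of_real (1 + e / 4)"
      have w: "cmod w \<le> 1 / (1 + e / 4)"
        unfolding w_def norm_divide norm_of_real using u(1) e by (simp add: divide_right_mono)
      have w': "cmod w * x \<le> 1" if "0 \<le> x" "x \<le> 1 + e / 4" for x
      proof -
        have "cmod w * x \<le> 1 / (1 + e / 4) * (1 + e / 4)"
          using w that e by (intro mult_mono) auto
        then show ?thesis using e by simp
      qed
      have "\<phi> (s w (F \<theta>)) + \<psi> (s w (F \<theta>)) = w * b"
        unfolding \<phi>.functional_scale[OF F(1)] \<psi>.functional_scale[OF F(1)]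
        by (simp add: F(2) b_def algebra_simps)
      also have "\<dots> = of_real (cmod b / (1 + e / 4))"
        using u(2) by (simp add: w_def)
      finally have "Re (\<phi> (s w (F \<theta>))) + Re (\<psi> (s w (F \<theta>))) = cmod b / (1 + e / 4)"
        by (metis Re_complex_of_real plus_complex.simps(1))
      moreover have "2 - e < cmod b / (1 + e / 4)"
      proof -
        have "(2 - e) * (1 + e / 4) = 2 - e / 2 - e * e / 4"
          by (simp add: field_simps)
        also have "\<dots> < cmod b"
          using b e mult_pos_pos[OF e e] by linarith
        finally show ?thesis
          using e by (simp add: pos_less_divide_eq)
      qed
      moreover have "nrm B0 (s w (F (Complex 0 t))) \<le> 1" "nrm B1 (s w (F (Complex 1 t))) \<le> 1" for t
        using w'[OF B0.nrm_nonneg F(3)[of t]] w'[OF B1.nrm_nonneg F(4)[of t]]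
        by (simp_all add: B0.nrm_scale B1.nrm_scale interp_functions_boundary[OF F(1)])
      ultimately show ?thesis
        using interp_functions_scale_const[OF F(1), of w]
        by (intro bexI[of _ "\<lambda>z. s w (F z)"]) auto
    qed
    obtain x where "\<phi> x \<noteq> \<psi> x" using neq by blast
    \<comment> \<open>Dual elements are extended by 0, so they can differ only at points of the
      space.\<close>
    moreover have "\<phi> x = \<psi> x" if "x \<notin> pts B\<theta>"
      using \<phi>(1) \<psi>(1) that by (simp add: dual_def)
    ultimately have "x \<in> pts B\<theta>" by blast
    then obtain G where "G \<in> \<F>" "x = G \<theta>"
      unfolding pts_interp_space by blast
    with \<open>\<phi> x \<noteq> \<psi> x\<close> have G: "G \<in> \<F>" "\<phi> (G \<theta>) \<noteq> \<psi> (G \<theta>)"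
      by simp_all
    show False
    proof (rule real_functionals[OF \<phi>.interpolation_functional_axioms
          \<psi>.interpolation_functional_axioms _ G])
      fix f g
      assume f: "\<And>x y. x \<in> pts B0 \<Longrightarrow> y \<in> pts B0 \<Longrightarrow> f (x + y) = f x + f y"
        "\<And>c x. x \<in> pts B0 \<Longrightarrow> f (s (of_real c) x) = c * f x" "\<And>x. x \<in> pts B0 \<Longrightarrow> f x \<le> nrm B0 x"
      and g: "\<And>x y. x \<in> pts B0 \<Longrightarrow> y \<in> pts B0 \<Longrightarrow> g (x + y) = g x + g y"
        "\<And>c x. x \<in> pts B0 \<Longrightarrow> g (s (of_real c) x) = c * g x" "\<And>x. x \<in> pts B0 \<Longrightarrow> g x \<le> nrm B0 x"
      and norming: "\<And>e. 0 < e \<Longrightarrow> \<exists>y\<in>pts B0. nrm B0 y \<le> 1 \<and> 2 - e \<le> f y + g y"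
      and "\<exists>x\<in>pts B0. f x \<noteq> g x"
      then obtain x where x: "x \<in> pts B0" "f x \<noteq> g x" by blast
      have "f x = g x"
        by (rule B0.rotund_dual_real_functionals[OF rot, of f g]) (fact f g norming x)+
      with x(2) show False by contradiction
    qed (rule near)
  qed
qed

end

theorem theorem4p2:
  fixes s :: "complex \<Rightarrow> 'v::{t2_space, topological_ab_group_add} \<Rightarrow> 'v"
    and B0 B1 :: "'v nspace" and \<theta> :: real
  assumes "interpolation_couple s B0 B1"
    and "\<theta> \<in> {0<..<1}"
    and "rotund fun_scale (dual s B0)"
  shows "rotund fun_scale (dual s (interp_space s B0 B1 \<theta>))"
proof -
  interpret complex_interpolation s B0 B1 \<theta>
    using assms(1,2) by (intro complex_interpolation.intro) (auto simp: complex_interpolation_axioms_def)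
  show ?thesis by (rule rotund_dual_interp_space[OF assms(3)])
qed

end
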